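(* Let $G$ be a finite group, let $k$ be a field whose characteristic divides the order of $G$, and let $(\mathcal{P},\mathcal{I})$ be a projective class on $\mathrm{StMod}(kG)$. Consider the Auslander-Reiten triangle $\Omega^2M \xrightarrow{\alpha} H(M) \xrightarrow{\beta} M \xrightarrow{\gamma} \Omega M$ for some indecomposable non-projective module $M$ in $\mathrm{stmod}(kG)$ with finite length $l$ with respect to $(\mathcal{P},\mathcal{I})$. Then \[ \mathrm{len}_{\mathcal{P}}(M)-1 \le \mathrm{len}_{\mathcal{P}}(H(M)) \le \mathrm{len}_{\mathcal{P}}(M)+1, \] and $\gamma$ is a non-trivial map in $\mathcal{I}^{l-1}$.
   Context: $\mathrm{StMod}(kG)$ is the stable module category (left $kG$-modules, with maps modulo those factoring through a projective), a triangulated category with desuspension $\Omega M$ the kernel of a surjection from a projective onto $M$, and $\Sigma=\Omega^{-1}$; $\mathrm{stmod}(kG)$ is the full subcategory of modules stably isomorphic to finitely generated ones. A triangle $X\xrightarrow{\alpha}Y\xrightarrow{\beta}Z\xrightarrow{\gamma}\Sigma X$ is an Auslander-Reiten triangle if $\gamma\ne0$, any map $X\to Y'$ that is not split monic factors through $\alpha$, and any map $Y'\to Z$ that is not split epic factors through $\beta$. For each indecomposable non-projective $M\in\mathrm{stmod}(kG)$ there is an Auslander-Reiten triangle ending in $M$, unique up to non-canonical isomorphism; it has the form displayed in the claim, and $H(M)$ is called the heart of $M$. A (stable) projective class in a triangulated category $\mathbb{T}$ consists of a class $\mathcal{P}$ of objects and a class $\mathcal{I}$ of morphisms such that: (i)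 $\mathcal{P}$ consists of exactly the objects $P$ such that every composite $P\to X\to Y$ is zero for each $X\to Y$ in $\mathcal{I}$; (ii) $\mathcal{I}$ consists of exactly the maps $X\to Y$ such that every composite $P\to X\to Y$ is zero for each $P\in\mathcal{P}$; (iii) for each $X$ in $\mathbb{T}$ there is a cofibre sequence (distinguished triangle) $P\to X\to Y$ with $P\in\mathcal{P}$ and $X\to Y$ in $\mathcal{I}$; and $\mathcal{P}$ (equivalently $\mathcal{I}$) is closed under suspension and desuspension. $\mathcal{I}^n$ is the ideal of all $n$-fold composites of maps in $\mathcal{I}$, with $\mathcal{I}^0$ all maps. $\mathcal{P}_0$ consists of all zero objects, $\mathcal{P}_1=\mathcal{P}$, and $X\in\mathcal{P}_n$ iff $X$ is a retract of an object $N$ in a cofibre sequence $P\to N\to Q$ with $P\in\mathcal{P}$ and $Q\in\mathcal{P}_{n-1}$. The length $\mathrm{len}_{\mathcal{P}}(X)$ is the smallest $n$ with $X\in\mathcal{P}_n$, if it exists (equivalently, the smallest $n$ such that every map in $\mathcal{I}^n$ with domain $X$ is zero). *)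

theory Defs
  imports "HOL-Algebra.Module" "HOL-Algebra.AbelCoset" "HOL-Algebra.Multiplicative_Group" "HOL-Library.Extended_Nat"
begin

unbundle cardinal_syntax

section \<open>Projective classes, lengths and Auslander-Reiten triangles\<close>

text \<open>
  The data of a triangulated category, presented through the desuspension
  \<open>\<Omega> = \<Sigma>\<^sup>-\<^sup>1\<close> (\<open>Desusp\<close> on objects, \<open>DesuspA\<close> on arrows).  Accordingly a triangle is written
  \<open>\<Omega>Z \<rightarrow> X \<rightarrow> Y \<rightarrow> Z\<close>, as the triple \<open>(w, u, v)\<close> of its arrows; a triangle \<open>X \<rightarrow> Y \<rightarrow> Z \<rightarrow> \<Sigma>X\<close> is
  the triangle \<open>\<Omega>C \<rightarrow> Y \<rightarrow> Z \<rightarrow> C\<close> with \<open>C = \<Sigma>X\<close> and \<open>X = \<Omega>C\<close>.  In this form the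
  Auslander-Reiten triangle \<open>\<Omega>\<^sup>2M \<rightarrow> H(M) \<rightarrow> M \<rightarrow> \<Omega>M\<close> needs no identification
  of \<open>\<Sigma>\<Omega>\<^sup>2M\<close> with \<open>\<Omega>M\<close>.  Replacing \<open>w\<close> by \<open>-w\<close> throughout (the sign convention for
  rotations) changes none of the notions defined from the triangles below.
\<close>

record ('o, 'f) desusp_cat =
  Obj :: "'o set"
  Arr :: "'f set"
  Dom :: "'f \<Rightarrow> 'o"
  Cod :: "'f \<Rightarrow> 'o"
  Ide :: "'o \<Rightarrow> 'f"
  Cmp :: "'f \<Rightarrow> 'f \<Rightarrow> 'f"   (infixl \<open>\<cdot>\<index>\<close> 70)
  ZeroA :: "'o \<Rightarrow> 'o \<Rightarrow> 'f"
  Desusp :: "'o \<Rightarrow> 'o"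
  DesuspA :: "'f \<Rightarrow> 'f"

record ('o, 'f) triang_cat = "('o, 'f) desusp_cat" +
  Tri :: "('f \<times> 'f \<times> 'f) set"

definition Homs :: "('o, 'f, 'x) desusp_cat_scheme \<Rightarrow> 'o \<Rightarrow> 'o \<Rightarrow> 'f set" where
  "Homs T X Y = {f \<in> Arr T. Dom T f = X \<and> Cod T f = Y}"

definition split_mono :: "('o, 'f, 'x) desusp_cat_scheme \<Rightarrow> 'f \<Rightarrow> bool" where
  "split_mono T f \<longleftrightarrow>
     f \<in> Arr T \<and> (\<exists>r \<in> Homs T (Cod T f) (Dom T f). r \<cdot>\<^bsub>T\<^esub> f = Ide T (Dom T f))"

definition split_epi :: "('o, 'f, 'x) desusp_cat_scheme \<Rightarrow> 'f \<Rightarrow> bool" where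
  "split_epi T f \<longleftrightarrow>
     f \<in> Arr T \<and> (\<exists>s \<in> Homs T (Cod T f) (Dom T f). f \<cdot>\<^bsub>T\<^esub> s = Ide T (Cod T f))"

definition iso_arr :: "('o, 'f, 'x) desusp_cat_scheme \<Rightarrow> 'f \<Rightarrow> bool" where
  "iso_arr T f \<longleftrightarrow> f \<in> Arr T \<and>
     (\<exists>g \<in> Homs T (Cod T f) (Dom T f).
        g \<cdot>\<^bsub>T\<^esub> f = Ide T (Dom T f) \<and> f \<cdot>\<^bsub>T\<^esub> g = Ide T (Cod T f))"

definition isomorphic_in :: "('o, 'f, 'x) desusp_cat_scheme \<Rightarrow> 'o \<Rightarrow> 'o \<Rightarrow> bool" where
  "isomorphic_in T X Y \<longleftrightarrow> (\<exists>f \<in> Homs T X Y. iso_arr T f)"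

definition retract_of_obj :: "('o, 'f, 'x) desusp_cat_scheme \<Rightarrow> 'o \<Rightarrow> 'o \<Rightarrow> bool" where
  "retract_of_obj T X N \<longleftrightarrow> (\<exists>f \<in> Homs T X N. split_mono T f)"

definition zero_objs :: "('o, 'f, 'x) desusp_cat_scheme \<Rightarrow> 'o set" where
  "zero_objs T = {X \<in> Obj T. Ide T X = ZeroA T X X}"

definition triangle_shape :: "('o, 'f, 'x) desusp_cat_scheme \<Rightarrow> 'f \<times> 'f \<times> 'f \<Rightarrow> bool" where
  "triangle_shape T = (\<lambda>(w, u, v).
     w \<in> Arr T \<and> u \<in> Arr T \<and> v \<in> Arr T \<and>
     Dom T w = Desusp T (Cod T v) \<and> Cod T w = Dom T u \<and> Cod T u = Dom T v)"

definition triangle_iso ::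
  "('o, 'f, 'x) desusp_cat_scheme \<Rightarrow> 'f \<times> 'f \<times> 'f \<Rightarrow> 'f \<times> 'f \<times> 'f \<Rightarrow> bool" where
  "triangle_iso T = (\<lambda>(w, u, v) (w', u', v').
     \<exists>a \<in> Homs T (Dom T u) (Dom T u'). \<exists>b \<in> Homs T (Dom T v) (Dom T v').
     \<exists>c \<in> Homs T (Cod T v) (Cod T v').
       iso_arr T a \<and> iso_arr T b \<and> iso_arr T c \<and>
       a \<cdot>\<^bsub>T\<^esub> w = w' \<cdot>\<^bsub>T\<^esub> DesuspA T c \<and> b \<cdot>\<^bsub>T\<^esub> u = u' \<cdot>\<^bsub>T\<^esub> a \<and> c \<cdot>\<^bsub>T\<^esub> v = v' \<cdot>\<^bsub>T\<^esub> b)"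

definition cofibre_seq :: "('o, 'f, 'x) triang_cat_scheme \<Rightarrow> 'f \<Rightarrow> 'f \<Rightarrow> bool" where
  "cofibre_seq T u v \<longleftrightarrow> (\<exists>w. (w, u, v) \<in> Tri T)"

text \<open>In the last clause, \<open>Y\<close> is a suspension of \<open>X\<close> when \<open>\<Omega>Y \<cong> X\<close>.\<close>

definition projective_class ::
  "('o, 'f, 'x) triang_cat_scheme \<Rightarrow> 'o set \<Rightarrow> 'f set \<Rightarrow> bool" where
  "projective_class T \<P> \<I> \<longleftrightarrow>
     \<P> = {P \<in> Obj T. \<forall>f \<in> \<I>. \<forall>h \<in> Homs T P (Dom T f).
                f \<cdot>\<^bsub>T\<^esub> h = ZeroA T P (Cod T f)} \<and>
     \<I> = {f \<in> Arr T. \<forall>P \<in> \<P>. \<forall>h \<in> Homs T P (Dom T f).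
                f \<cdot>\<^bsub>T\<^esub> h = ZeroA T P (Cod T f)} \<and>
     (\<forall>X \<in> Obj T. \<exists>u v. cofibre_seq T u v \<and> Dom T u \<in> \<P> \<and> Cod T u = X \<and> v \<in> \<I>) \<and>
     (\<forall>X \<in> \<P>. Desusp T X \<in> \<P>) \<and>
     (\<forall>X \<in> \<P>. \<forall>Y \<in> Obj T. isomorphic_in T (Desusp T Y) X \<longrightarrow> Y \<in> \<P>)"

fun ideal_power :: "('o, 'f, 'x) triang_cat_scheme \<Rightarrow> 'f set \<Rightarrow> nat \<Rightarrow> 'f set" where
  "ideal_power T \<I> 0 = Arr T"
| "ideal_power T \<I> (Suc 0) = \<I>"
| "ideal_power T \<I> (Suc (Suc n)) =
     {g \<cdot>\<^bsub>T\<^esub> f | f g. f \<in> \<I> \<and> g \<in> ideal_power T \<I> (Suc n) \<and> Dom T g = Cod T f}"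

fun class_power :: "('o, 'f, 'x) triang_cat_scheme \<Rightarrow> 'o set \<Rightarrow> nat \<Rightarrow> 'o set" where
  "class_power T \<P> 0 = zero_objs T"
| "class_power T \<P> (Suc 0) = \<P>"
| "class_power T \<P> (Suc (Suc n)) =
     {X \<in> Obj T. \<exists>N u v. retract_of_obj T X N \<and> cofibre_seq T u v \<and> Cod T u = N \<and>
                    Dom T u \<in> \<P> \<and> Cod T v \<in> class_power T \<P> (Suc n)}"

text \<open>The length is \<open>\<infinity>\<close> if \<open>X\<close> lies in no \<open>\<P>\<^sub>n\<close>.\<close>

definition len :: "('o, 'f, 'x) triang_cat_scheme \<Rightarrow> 'o set \<Rightarrow> 'o \<Rightarrow> enat" where
  "len T \<P> X = Inf {enat n | n. X \<in> class_power T \<P> n}"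

definition AR_triangle :: "('o, 'f, 'x) triang_cat_scheme \<Rightarrow> 'f \<Rightarrow> 'f \<Rightarrow> 'f \<Rightarrow> bool" where
  "AR_triangle T \<alpha> \<beta> \<gamma> \<longleftrightarrow>
     (\<alpha>, \<beta>, \<gamma>) \<in> Tri T \<and>
     \<gamma> \<noteq> ZeroA T (Dom T \<gamma>) (Cod T \<gamma>) \<and>
     (\<forall>f \<in> Arr T. Dom T f = Dom T \<alpha> \<and> \<not> split_mono T f \<longrightarrow>
        (\<exists>h \<in> Homs T (Cod T \<alpha>) (Cod T f). f = h \<cdot>\<^bsub>T\<^esub> \<alpha>)) \<and>
     (\<forall>f \<in> Arr T. Cod T f = Cod T \<beta> \<and> \<not> split_epi T f \<longrightarrow>
        (\<exists>h \<in> Homs T (Dom T f) (Dom T \<beta>). f = \<beta> \<cdot>\<^bsub>T\<^esub> h))"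


section \<open>Group algebras and their modules\<close>

text \<open>The additive order of \<open>1\<close> (which is \<open>0\<close> when that order is infinite).\<close>

definition characteristic :: "('k, 'x) ring_scheme \<Rightarrow> nat" where
  "characteristic k = group.ord (add_monoid k) \<one>\<^bsub>k\<^esub>"

definition group_algebra ::
  "('k, 'x) ring_scheme \<Rightarrow> ('g, 'y) monoid_scheme \<Rightarrow> ('g \<Rightarrow> 'k) ring" where
  "group_algebra k G =
     \<lparr> carrier = carrier G \<rightarrow>\<^sub>E carrier k,
       mult = (\<lambda>x y. \<lambda>g \<in> carrier G.
                 \<Oplus>\<^bsub>k\<^esub>h \<in> carrier G. x h \<otimes>\<^bsub>k\<^esub> y (inv\<^bsub>G\<^esub> h \<otimes>\<^bsub>G\<^esub> g)),
       one = (\<lambda>g \<in> carrier G. if g = \<one>\<^bsub>G\<^esub> then \<one>\<^bsub>k\<^esub> else \<zero>\<^bsub>k\<^esub>),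
       zero = (\<lambda>g \<in> carrier G. \<zero>\<^bsub>k\<^esub>),
       add = (\<lambda>x y. \<lambda>g \<in> carrier G. x g \<oplus>\<^bsub>k\<^esub> y g) \<rparr>"

text \<open>Left modules over a not necessarily commutative ring; the axioms are those of
  the locale \<^locale>\<open>module\<close>, which is restricted to commutative rings.\<close>

locale left_module = R?: ring R + M?: abelian_group M
  for R :: "('r, 'x) ring_scheme" (structure) and M :: "('r, 'm, 'y) module_scheme" (structure) +
  assumes smult_closed:
      "\<lbrakk>a \<in> carrier R; x \<in> carrier M\<rbrakk> \<Longrightarrow> a \<odot>\<^bsub>M\<^esub> x \<in> carrier M"
    and smult_l_distr:
      "\<lbrakk>a \<in> carrier R; b \<in> carrier R; x \<in> carrier M\<rbrakk> \<Longrightarrow>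
       (a \<oplus>\<^bsub>R\<^esub> b) \<odot>\<^bsub>M\<^esub> x = a \<odot>\<^bsub>M\<^esub> x \<oplus>\<^bsub>M\<^esub> b \<odot>\<^bsub>M\<^esub> x"
    and smult_r_distr:
      "\<lbrakk>a \<in> carrier R; x \<in> carrier M; y \<in> carrier M\<rbrakk> \<Longrightarrow>
       a \<odot>\<^bsub>M\<^esub> (x \<oplus>\<^bsub>M\<^esub> y) = a \<odot>\<^bsub>M\<^esub> x \<oplus>\<^bsub>M\<^esub> a \<odot>\<^bsub>M\<^esub> y"
    and smult_assoc:
      "\<lbrakk>a \<in> carrier R; b \<in> carrier R; x \<in> carrier M\<rbrakk> \<Longrightarrow>
       (a \<otimes>\<^bsub>R\<^esub> b) \<odot>\<^bsub>M\<^esub> x = a \<odot>\<^bsub>M\<^esub> (b \<odot>\<^bsub>M\<^esub> x)"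
    and smult_one:
      "x \<in> carrier M \<Longrightarrow> \<one>\<^bsub>R\<^esub> \<odot>\<^bsub>M\<^esub> x = x"

text \<open>
  The type \<^typ>\<open>'m\<close> plays the role of the set-theoretic universe: the objects of the module
  category are the left modules whose underlying set is a subset of \<^typ>\<open>'m\<close> of strictly smaller
  cardinality than \<^typ>\<open>'m\<close>.  If the cardinality of \<^typ>\<open>'m\<close> is that of a Grothendieck universe these
  are, up to isomorphism, exactly the modules belonging to it.  For every infinite
  \<^typ>\<open>'m\<close> with more elements than the field, these modules are closed, up to isomorphism, under finite
  direct sums, subquotients and extensions, and over the group algebra of a finite group each is
  a quotient of a free module that is again of this kind; so there are enough projectives, and
  the lifting property below defines the usual projective modules.
\<close>

definition Mods :: "('r, 'x) ring_scheme \<Rightarrow> ('r, 'm) module set" where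
  "Mods R = {M. left_module R M \<and> |carrier M| <o |UNIV :: 'm set|}"

text \<open>Linear maps are made undefined outside the carrier, so that they are equal iff they agree
  on it.\<close>

definition lin_maps ::
  "('r, 'x) ring_scheme \<Rightarrow> ('r, 'm) module \<Rightarrow> ('r, 'm) module \<Rightarrow> ('m \<Rightarrow> 'm) set" where
  "lin_maps R M N = {f \<in> carrier M \<rightarrow>\<^sub>E carrier N.
     (\<forall>x \<in> carrier M. \<forall>y \<in> carrier M. f (x \<oplus>\<^bsub>M\<^esub> y) = f x \<oplus>\<^bsub>N\<^esub> f y) \<and>
     (\<forall>a \<in> carrier R. \<forall>x \<in> carrier M. f (a \<odot>\<^bsub>M\<^esub> x) = a \<odot>\<^bsub>N\<^esub> f x)}"

definition projective_module :: "('r, 'x) ring_scheme \<Rightarrow> ('r, 'm) module \<Rightarrow> bool" where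
  "projective_module R Q \<longleftrightarrow> Q \<in> Mods R \<and>
     (\<forall>B \<in> Mods R. \<forall>C \<in> Mods R. \<forall>g \<in> lin_maps R B C. g ` carrier B = carrier C \<longrightarrow>
        (\<forall>f \<in> lin_maps R Q C. \<exists>h \<in> lin_maps R Q B. f = compose (carrier Q) g h))"

definition finitely_generated_module :: "('r, 'x) ring_scheme \<Rightarrow> ('r, 'm) module \<Rightarrow> bool" where
  "finitely_generated_module R M \<longleftrightarrow>
     (\<exists>S. finite S \<and> S \<subseteq> carrier M \<and> (\<forall>U. submodule U R M \<and> S \<subseteq> U \<longrightarrow> U = carrier M))"

definition indecomposable_module :: "('r, 'x) ring_scheme \<Rightarrow> ('r, 'm) module \<Rightarrow> bool" where
  "indecomposable_module R M \<longleftrightarrow> carrier M \<noteq> {\<zero>\<^bsub>M\<^esub>} \<and>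
     (\<forall>U V. submodule U R M \<and> submodule V R M \<and>
        U <+>\<^bsub>M\<^esub> V = carrier M \<and> U \<inter> V = {\<zero>\<^bsub>M\<^esub>} \<longrightarrow> U = {\<zero>\<^bsub>M\<^esub>} \<or> V = {\<zero>\<^bsub>M\<^esub>})"


section \<open>The stable module category\<close>

definition factors_through_projective ::
  "('r, 'x) ring_scheme \<Rightarrow> ('r, 'm) module \<Rightarrow> ('r, 'm) module \<Rightarrow> ('m \<Rightarrow> 'm) \<Rightarrow> bool" where
  "factors_through_projective R X Y f \<longleftrightarrow>
     (\<exists>Q. projective_module R Q \<and>
        (\<exists>u \<in> lin_maps R X Q. \<exists>v \<in> lin_maps R Q Y. f = compose (carrier X) v u))"

text \<open>The residue class of a linear map \<open>f : X \<rightarrow> Y\<close> modulo maps factoring through a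
  projective.\<close>

definition stable_class ::
  "('r, 'x) ring_scheme \<Rightarrow> ('r, 'm) module \<Rightarrow> ('r, 'm) module \<Rightarrow> ('m \<Rightarrow> 'm) \<Rightarrow> ('m \<Rightarrow> 'm) set" where
  "stable_class R X Y f = {g \<in> lin_maps R X Y.
     factors_through_projective R X Y (\<lambda>x \<in> carrier X. g x \<ominus>\<^bsub>Y\<^esub> f x)}"

text \<open>Arrows of the stable category carry their domain and codomain.\<close>

type_synonym ('r, 'm) stable_arrow =
  "('r, 'm) module \<times> ('r, 'm) module \<times> ('m \<Rightarrow> 'm) set"

definition stable_arr ::
  "('r, 'x) ring_scheme \<Rightarrow> ('r, 'm) module \<Rightarrow> ('r, 'm) module \<Rightarrow> ('m \<Rightarrow> 'm) \<Rightarrow> ('r, 'm) stable_arrow"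
  where "stable_arr R X Y f = (X, Y, stable_class R X Y f)"

text \<open>A choice, for each module \<open>M\<close>, of a surjection onto \<open>M\<close> from a projective module.
  All constructions below are relative to such a choice; \<open>\<Omega>M\<close> is the kernel.\<close>

type_synonym ('r, 'm) presentation =
  "('r, 'm) module \<Rightarrow> ('r, 'm) module \<times> ('m \<Rightarrow> 'm)"

definition projective_presentation ::
  "('r, 'x) ring_scheme \<Rightarrow> ('r, 'm) presentation \<Rightarrow> bool" where
  "projective_presentation R \<pi> \<longleftrightarrow>
     (\<forall>M \<in> Mods R. case \<pi> M of (Q, p) \<Rightarrow>
        projective_module R Q \<and> p \<in> lin_maps R Q M \<and> p ` carrier Q = carrier M)"

definition Omega :: "('r, 'm) presentation \<Rightarrow> ('r, 'm) module \<Rightarrow> ('r, 'm) module" where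
  "Omega \<pi> M = (case \<pi> M of (Q, p) \<Rightarrow> Q\<lparr>carrier := a_kernel Q M p\<rparr>)"

text \<open>\<open>\<Omega>\<close> of the class of \<open>f : X \<rightarrow> Y\<close> is the class of the restriction to \<open>\<Omega>X\<close> of any lift
  of \<open>f\<close> to the chosen projectives.\<close>

definition Omega_arr ::
  "('r, 'x) ring_scheme \<Rightarrow> ('r, 'm) presentation \<Rightarrow> ('r, 'm) stable_arrow \<Rightarrow> ('r, 'm) stable_arrow"
  where
  "Omega_arr R \<pi> = (\<lambda>(X, Y, F).
     (Omega \<pi> X, Omega \<pi> Y,
      \<Union> {stable_class R (Omega \<pi> X) (Omega \<pi> Y) (restrict q (carrier (Omega \<pi> X))) | q.
            q \<in> lin_maps R (fst (\<pi> X)) (fst (\<pi> Y)) \<and>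
            (\<exists>f \<in> F. \<forall>x \<in> carrier (fst (\<pi> X)). snd (\<pi> Y) (q x) = f (snd (\<pi> X) x))}))"

definition stable_cat ::
  "('r, 'x) ring_scheme \<Rightarrow> ('r, 'm) presentation
     \<Rightarrow> (('r, 'm) module, ('r, 'm) stable_arrow) desusp_cat" where
  "stable_cat R \<pi> =
     \<lparr> Obj = Mods R,
       Arr = {stable_arr R X Y f | X Y f. X \<in> Mods R \<and> Y \<in> Mods R \<and> f \<in> lin_maps R X Y},
       Dom = fst,
       Cod = (\<lambda>a. fst (snd a)),
       Ide = (\<lambda>X. stable_arr R X X (\<lambda>x \<in> carrier X. x)),
       Cmp = (\<lambda>(Y', Z, K) (X, Y, F).
                (X, Z, \<Union>g \<in> K. \<Union>f \<in> F. stable_class R X Z (compose (carrier X) g f))),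
       ZeroA = (\<lambda>X Y. stable_arr R X Y (\<lambda>x \<in> carrier X. \<zero>\<^bsub>Y\<^esub>)),
       Desusp = Omega \<pi>,
       DesuspA = Omega_arr R \<pi> \<rparr>"

text \<open>
  A short exact sequence \<open>0 \<rightarrow> A \<rightarrow> B \<rightarrow> C \<rightarrow> 0\<close>, with maps \<open>f\<close> and \<open>g\<close>, gives the standard triangle
  \<open>\<Omega>C \<rightarrow> A \<rightarrow> B \<rightarrow> C\<close>, whose first map is obtained by lifting the chosen surjection
  \<open>p : Q \<rightarrow> C\<close> to \<open>l : Q \<rightarrow> B\<close> and restricting \<open>l\<close> to a map \<open>d\<close> from \<open>\<Omega>C = ker p\<close>
  to \<open>A = ker g\<close>.
\<close>

definition standard_triangles ::
  "('r, 'x) ring_scheme \<Rightarrow> ('r, 'm) presentation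
     \<Rightarrow> (('r, 'm) stable_arrow \<times> ('r, 'm) stable_arrow \<times> ('r, 'm) stable_arrow) set" where
  "standard_triangles R \<pi> =
     {(stable_arr R (Omega \<pi> C) A d, stable_arr R A B f, stable_arr R B C g) | A B C d f g.
        A \<in> Mods R \<and> B \<in> Mods R \<and> C \<in> Mods R \<and>
        f \<in> lin_maps R A B \<and> g \<in> lin_maps R B C \<and>
        inj_on f (carrier A) \<and> f ` carrier A = a_kernel B C g \<and> g ` carrier B = carrier C \<and>
        d \<in> lin_maps R (Omega \<pi> C) A \<and>
        (\<exists>l \<in> lin_maps R (fst (\<pi> C)) B.
           (\<forall>x \<in> carrier (fst (\<pi> C)). g (l x) = snd (\<pi> C) x) \<and>
           (\<forall>x \<in> carrier (Omega \<pi> C). f (d x) = l x))}"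

definition distinguished_triangles ::
  "('r, 'x) ring_scheme \<Rightarrow> ('r, 'm) presentation
     \<Rightarrow> (('r, 'm) stable_arrow \<times> ('r, 'm) stable_arrow \<times> ('r, 'm) stable_arrow) set" where
  "distinguished_triangles R \<pi> =
     {t. triangle_shape (stable_cat R \<pi>) t \<and>
         (\<exists>s \<in> standard_triangles R \<pi>. triangle_iso (stable_cat R \<pi>) s t)}"

definition StMod ::
  "('k, 'x) ring_scheme \<Rightarrow> ('g, 'y) monoid_scheme \<Rightarrow> ('g \<Rightarrow> 'k, 'm) presentation
     \<Rightarrow> (('g \<Rightarrow> 'k, 'm) module, ('g \<Rightarrow> 'k, 'm) stable_arrow) triang_cat" where
  "StMod k G \<pi> = desusp_cat.extend (stable_cat (group_algebra k G) \<pi>)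
     (triang_cat.fields (distinguished_triangles (group_algebra k G) \<pi>))"

text \<open>The objects of the full subcategory \<open>stmod(kG)\<close>.\<close>

definition stmod_objs ::
  "('k, 'x) ring_scheme \<Rightarrow> ('g, 'y) monoid_scheme \<Rightarrow> ('g \<Rightarrow> 'k, 'm) presentation
     \<Rightarrow> ('g \<Rightarrow> 'k, 'm) module set" where
  "stmod_objs k G \<pi> = {M \<in> Obj (StMod k G \<pi>).
     \<exists>N \<in> Obj (StMod k G \<pi>). finitely_generated_module (group_algebra k G) N \<and>
        isomorphic_in (StMod k G \<pi>) M N}"

end

theory Submission
  imports Defs
begin

text \<open>
  The argument is formal in the triangulated category. Two facts about a projective class carry it.
  First, for every object \<open>X\<close> and every \<open>n\<close> there are an object \<open>E\<close> of \<open>\<P>\<^sub>n\<close>, a map \<open>e : E \<rightarrow> X\<close> and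
  a map \<open>f : X \<rightarrow> Y\<close> in \<open>\<I>\<^sup>n\<close> such that every map into \<open>X\<close> killed by \<open>f\<close> factors through \<open>e\<close> and
  every map out of \<open>X\<close> killed by \<open>e\<close> factors through \<open>f\<close> (\<open>tower\<close>). Second, \<open>X\<close> lies in
  \<open>\<P>\<^sub>n\<close> iff all maps in \<open>\<I>\<^sup>n\<close> with domain \<open>X\<close> vanish (\<open>CP_iff_kills\<close>), and \<open>\<P>\<^sub>n\<close> is closed under \<open>\<Omega>\<close>.

  Let \<open>M\<close> have length \<open>l\<close> and take \<open>e : E \<rightarrow> M\<close> and \<open>f : M \<rightarrow> Y\<close> as above for \<open>n = l - 1\<close>. The map \<open>e\<close> is
  not split epic, for otherwise \<open>M\<close> would be a retract of \<open>E\<close> and have length at most \<open>l - 1\<close>. So \<open>e\<close>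
  lifts through \<open>\<beta>\<close>, hence \<open>\<gamma> e = 0\<close>, hence \<open>\<gamma>\<close> factors through \<open>f\<close> and lies in \<open>\<I>\<^bsup>l-1\<^esup>\<close>.

  Upper bound. A map in \<open>\<I>\<^bsup>l+1\<^esup>\<close> with domain \<open>H\<close> is \<open>r\<^sub>2 r\<^sub>1\<close> with \<open>r\<^sub>1\<close> in \<open>\<I>\<^sup>l\<close> and \<open>r\<^sub>2\<close> in \<open>\<I>\<close>. As
  \<open>\<Omega>\<^sup>2M\<close> has length at most \<open>l\<close>, \<open>r\<^sub>1 \<alpha> = 0\<close> and \<open>r\<^sub>1 = h \<beta>\<close>. Since \<open>e\<close> lifts to \<open>H\<close>, \<open>h e = 0\<close>, so \<open>h\<close>
  is in \<open>\<I>\<^bsup>l-1\<^esup>\<close> and \<open>r\<^sub>2 h\<close> is a map in \<open>\<I>\<^sup>l\<close> out of \<open>M\<close>, which is zero.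
  Lower bound. If \<open>H\<close> has length \<open>n\<close>, a map in \<open>\<I>\<^bsup>n+1\<^esup>\<close> out of \<open>M\<close> is likewise \<open>r\<^sub>2 r\<^sub>1\<close>, now with
  \<open>r\<^sub>1 \<beta> = 0\<close> and thus \<open>r\<^sub>1 = s \<gamma>\<close>. If \<open>r\<^sub>2 s \<gamma>\<close> were nonzero, the left lifting property of the triangle
  would make \<open>r\<^sub>2 s\<close> split monic; as it belongs to \<open>\<I>\<close>, the identity of \<open>\<Omega>M\<close> would lie in all \<open>\<I>\<^sup>j\<close>,
  and \<open>\<Omega>M\<close>, being of finite length, would be zero.

  It remains to see that the stable category supports this reasoning. The one special property of
  group algebras of finite groups that enters is that projective modules are injective
  (\<open>projective_injective\<close>): a linear map into a projective module is extended over the field and then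
  averaged over the group. It makes \<open>\<Omega>\<close> full and faithful on stable maps and makes each map of a triangle
  a weak cokernel of the preceding one. The towers are built from pullbacks of
  modules (\<open>base_change_standard\<close>), which play the part of the octahedral axiom.
\<close>

section \<open>Exact triangles in a category with desuspension\<close>

text \<open>The exactness properties of a triangle \<open>\<Omega>Z \<rightarrow> X \<rightarrow> Y \<rightarrow> Z\<close> on which lengths depend: two
  vanishing composites, exactness of \<open>Hom(S, -)\<close> at \<open>Y\<close>, and exactness of \<open>Hom(-, S)\<close> at \<open>X\<close>, at \<open>Y\<close>
  and at \<open>\<Omega>Y\<close>. The last of these concerns \<open>\<Omega>X \<rightarrow> \<Omega>Y \<rightarrow> \<Omega>Z\<close> and serves in place of the rotated
  triangles; it is insensitive to the signs that rotation introduces.\<close>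

definition exact_triangle :: "('o, 'f, 'x) desusp_cat_scheme \<Rightarrow> 'f \<Rightarrow> 'f \<Rightarrow> 'f \<Rightarrow> bool" where
  "exact_triangle T w u v \<longleftrightarrow>
     triangle_shape T (w, u, v) \<and>
     v \<cdot>\<^bsub>T\<^esub> u = ZeroA T (Dom T u) (Cod T v) \<and>
     w \<cdot>\<^bsub>T\<^esub> DesuspA T v = ZeroA T (Desusp T (Dom T v)) (Dom T u) \<and>
     (\<forall>S t. t \<in> Homs T S (Dom T v) \<and> v \<cdot>\<^bsub>T\<^esub> t = ZeroA T S (Cod T v) \<longrightarrow>
        (\<exists>r \<in> Homs T S (Dom T u). t = u \<cdot>\<^bsub>T\<^esub> r)) \<and>
     (\<forall>S h. h \<in> Homs T (Dom T u) S \<and> h \<cdot>\<^bsub>T\<^esub> w = ZeroA T (Desusp T (Cod T v)) S \<longrightarrow>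
        (\<exists>r \<in> Homs T (Dom T v) S. h = r \<cdot>\<^bsub>T\<^esub> u)) \<and>
     (\<forall>S h. h \<in> Homs T (Dom T v) S \<and> h \<cdot>\<^bsub>T\<^esub> u = ZeroA T (Dom T u) S \<longrightarrow>
        (\<exists>r \<in> Homs T (Cod T v) S. h = r \<cdot>\<^bsub>T\<^esub> v)) \<and>
     (\<forall>S h. h \<in> Homs T (Desusp T (Dom T v)) S \<and>
            h \<cdot>\<^bsub>T\<^esub> DesuspA T u = ZeroA T (Desusp T (Dom T u)) S \<longrightarrow>
        (\<exists>r \<in> Homs T (Desusp T (Cod T v)) S. h = r \<cdot>\<^bsub>T\<^esub> DesuspA T v))"

text \<open>A homotopy cartesian square over \<open>v : Y \<rightarrow> Z\<close> and \<open>s : S \<rightarrow> Z\<close> with corner \<open>E\<close>, together with the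
  triangle \<open>X \<rightarrow> E \<rightarrow> S\<close> that it induces; \<open>e : E \<rightarrow> Y\<close> is the side opposite to \<open>s\<close>. The first closing
  clause is the weak pullback property. The second is the weak pushout property, applied to the
  pairs \<open>(h, 0)\<close> of maps out of \<open>Y\<close> and \<open>S\<close>.\<close>

definition weak_base_change ::
  "('o, 'f, 'x) desusp_cat_scheme \<Rightarrow> 'f \<Rightarrow> 'f \<Rightarrow> 'f \<Rightarrow> 'f \<Rightarrow> 'f \<Rightarrow> 'f \<Rightarrow> bool" where
  "weak_base_change T u v s u' v' e \<longleftrightarrow>
     isomorphic_in T (Dom T u') (Dom T u) \<and> Cod T v' = Dom T s \<and>
     e \<in> Homs T (Cod T u') (Cod T u) \<and>
     (\<forall>S t r. t \<in> Homs T S (Cod T u) \<and> r \<in> Homs T S (Dom T s) \<and> v \<cdot>\<^bsub>T\<^esub> t = s \<cdot>\<^bsub>T\<^esub> r \<longrightarrow>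
        (\<exists>y \<in> Homs T S (Cod T u'). t = e \<cdot>\<^bsub>T\<^esub> y)) \<and>
     (\<forall>S h. h \<in> Homs T (Cod T u) S \<and> h \<cdot>\<^bsub>T\<^esub> e = ZeroA T (Cod T u') S \<longrightarrow>
        (\<exists>r \<in> Homs T (Cod T v) S. h = r \<cdot>\<^bsub>T\<^esub> v \<and> r \<cdot>\<^bsub>T\<^esub> s = ZeroA T (Dom T s) S))"

text \<open>Desuspension is full and faithful because it is an equivalence on the stable category. The
  zero object is only asked for in the presence of some object, from which it can be constructed
  as the chosen projective module covering it.\<close>

locale desusp_category =
  fixes T :: "('o, 'f, 'x) desusp_cat_scheme" (structure)
  assumes Homs_Obj: "f \<in> Homs T X Y \<Longrightarrow> X \<in> Obj T \<and> Y \<in> Obj T"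
    and Ide_in [intro, simp]: "X \<in> Obj T \<Longrightarrow> Ide T X \<in> Homs T X X"
    and Cmp_in [intro]: "\<lbrakk>g \<in> Homs T Y Z; f \<in> Homs T X Y\<rbrakk> \<Longrightarrow> g \<cdot> f \<in> Homs T X Z"
    and Cmp_assoc: "\<lbrakk>h \<in> Homs T Z W; g \<in> Homs T Y Z; f \<in> Homs T X Y\<rbrakk> \<Longrightarrow> h \<cdot> g \<cdot> f = h \<cdot> (g \<cdot> f)"
    and Ide_left [simp]: "f \<in> Homs T X Y \<Longrightarrow> Ide T Y \<cdot> f = f"
    and Ide_right [simp]: "f \<in> Homs T X Y \<Longrightarrow> f \<cdot> Ide T X = f"
    and Zero_in [intro, simp]: "\<lbrakk>X \<in> Obj T; Y \<in> Obj T\<rbrakk> \<Longrightarrow> ZeroA T X Y \<in> Homs T X Y"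
    and Zero_left: "\<lbrakk>f \<in> Homs T X Y; Z \<in> Obj T\<rbrakk> \<Longrightarrow> ZeroA T Y Z \<cdot> f = ZeroA T X Z"
    and Zero_right: "\<lbrakk>f \<in> Homs T Y Z; X \<in> Obj T\<rbrakk> \<Longrightarrow> f \<cdot> ZeroA T X Y = ZeroA T X Z"
    and zero_obj_exists: "X \<in> Obj T \<Longrightarrow> zero_objs T \<noteq> {}"
    and Desusp_Obj [simp]: "X \<in> Obj T \<Longrightarrow> Desusp T X \<in> Obj T"
    and DesuspA_in [intro]: "f \<in> Homs T X Y \<Longrightarrow> DesuspA T f \<in> Homs T (Desusp T X) (Desusp T Y)"
    and DesuspA_Cmp: "\<lbrakk>g \<in> Homs T Y Z; f \<in> Homs T X Y\<rbrakk> \<Longrightarrow>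
           DesuspA T (g \<cdot> f) = DesuspA T g \<cdot> DesuspA T f"
    and DesuspA_Ide: "X \<in> Obj T \<Longrightarrow> DesuspA T (Ide T X) = Ide T (Desusp T X)"
    and DesuspA_Zero: "\<lbrakk>X \<in> Obj T; Y \<in> Obj T\<rbrakk> \<Longrightarrow>
           DesuspA T (ZeroA T X Y) = ZeroA T (Desusp T X) (Desusp T Y)"
    and DesuspA_full: "\<lbrakk>X \<in> Obj T; Y \<in> Obj T; g \<in> Homs T (Desusp T X) (Desusp T Y)\<rbrakk> \<Longrightarrow>
           \<exists>f \<in> Homs T X Y. DesuspA T f = g"
    and DesuspA_faithful: "\<lbrakk>f \<in> Homs T X Y; g \<in> Homs T X Y; DesuspA T f = DesuspA T g\<rbrakk> \<Longrightarrow> f = g"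
begin

lemma Homs_Dom: "f \<in> Homs T X Y \<Longrightarrow> Dom T f = X"
  and Homs_Cod: "f \<in> Homs T X Y \<Longrightarrow> Cod T f = Y"
  and Homs_Arr: "f \<in> Homs T X Y \<Longrightarrow> f \<in> Arr T"
  and Arr_Homs: "f \<in> Arr T \<Longrightarrow> f \<in> Homs T (Dom T f) (Cod T f)"
  by (auto simp: Homs_def)

lemma split_monoE:
  assumes "split_mono T f" "f \<in> Homs T X Y"
  obtains r where "r \<in> Homs T Y X" "r \<cdot> f = Ide T X"
  using assms unfolding split_mono_def by (auto simp: Homs_def)

lemma split_epiE:
  assumes "split_epi T f" "f \<in> Homs T X Y"
  obtains r where "r \<in> Homs T Y X" "f \<cdot> r = Ide T Y"
  using assms unfolding split_epi_def by (auto simp: Homs_def)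

lemma iso_arrE:
  assumes "iso_arr T f" "f \<in> Homs T X Y"
  obtains g where "g \<in> Homs T Y X" "g \<cdot> f = Ide T X" "f \<cdot> g = Ide T Y"
  using assms unfolding iso_arr_def by (auto simp: Homs_def)

lemma retractE:
  assumes "retract_of_obj T X N"
  obtains f r where "f \<in> Homs T X N" "r \<in> Homs T N X" "r \<cdot> f = Ide T X"
proof -
  obtain f where f: "f \<in> Homs T X N" "split_mono T f"
    using assms unfolding retract_of_obj_def by blast
  with split_monoE show thesis using that by metis
qed

lemma retractI: "\<lbrakk>f \<in> Homs T X N; r \<in> Homs T N X; r \<cdot> f = Ide T X\<rbrakk> \<Longrightarrow> retract_of_obj T X N"
  unfolding retract_of_obj_def split_mono_def Homs_def by auto

lemma retract_refl: "X \<in> Obj T \<Longrightarrow> retract_of_obj T X X"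
  by (rule retractI[of "Ide T X" _ _ "Ide T X"]) (auto simp: Ide_left[OF Ide_in])

lemma retract_trans:
  assumes "retract_of_obj T X Y" "retract_of_obj T Y Z"
  shows "retract_of_obj T X Z"
proof -
  obtain f r where 1: "f \<in> Homs T X Y" "r \<in> Homs T Y X" "r \<cdot> f = Ide T X"
    using retractE[OF assms(1)] .
  obtain g s where 2: "g \<in> Homs T Y Z" "s \<in> Homs T Z Y" "s \<cdot> g = Ide T Y"
    using retractE[OF assms(2)] .
  have "(r \<cdot> s) \<cdot> (g \<cdot> f) = r \<cdot> ((s \<cdot> g) \<cdot> f)"
    using Cmp_assoc[OF 1(2) 2(2) Cmp_in[OF 2(1) 1(1)]] Cmp_assoc[OF 2(2,1) 1(1)] by simp
  also have "\<dots> = Ide T X" using 1 2 by simp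
  finally show ?thesis using 1 2 by (intro retractI[of "g \<cdot> f" _ _ "r \<cdot> s"]) auto
qed

lemma isomorphic_retract: "isomorphic_in T X Y \<Longrightarrow> retract_of_obj T X Y"
  unfolding isomorphic_in_def iso_arr_def retract_of_obj_def split_mono_def by blast

lemma zero_objs_iff:
  assumes "X \<in> Obj T"
  shows "X \<in> zero_objs T \<longleftrightarrow> (\<forall>f \<in> Arr T. Dom T f = X \<longrightarrow> f = ZeroA T X (Cod T f))"
proof
  assume "X \<in> zero_objs T"
  then have "Ide T X = ZeroA T X X" by (simp add: zero_objs_def)
  then show "\<forall>f \<in> Arr T. Dom T f = X \<longrightarrow> f = ZeroA T X (Cod T f)"
    using Arr_Homs Ide_right Zero_right assms by metis
next
  assume "\<forall>f \<in> Arr T. Dom T f = X \<longrightarrow> f = ZeroA T X (Cod T f)"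
  then show "X \<in> zero_objs T"
    using assms Homs_Dom[OF Ide_in] Homs_Cod[OF Ide_in] Homs_Arr[OF Ide_in]
    by (simp add: zero_objs_def) metis
qed

end

locale exact_triangles = desusp_category T
  for T :: "('o, 'f, 'x) triang_cat_scheme" (structure) +
  assumes exact_Tri: "(w, u, v) \<in> Tri T \<Longrightarrow> exact_triangle T w u v"
    and base_change: "\<lbrakk>(w, u, v) \<in> Tri T; s \<in> Arr T; Cod T s = Cod T v\<rbrakk> \<Longrightarrow>
      \<exists>u' v' e. cofibre_seq T u' v' \<and> weak_base_change T u v s u' v' e"
begin

lemma Tri_Homs:
  assumes "(w, u, v) \<in> Tri T"
  shows "w \<in> Homs T (Desusp T (Cod T v)) (Dom T u)" "u \<in> Homs T (Dom T u) (Dom T v)"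
    "v \<in> Homs T (Dom T v) (Cod T v)" "Cod T u = Dom T v"
  using exact_Tri[OF assms] by (auto simp: exact_triangle_def triangle_shape_def Homs_def)

lemma cofibre_Homs:
  assumes "cofibre_seq T u v"
  shows "u \<in> Homs T (Dom T u) (Dom T v)" "v \<in> Homs T (Dom T v) (Cod T v)" "Cod T u = Dom T v"
  using assms Tri_Homs unfolding cofibre_seq_def by blast+

lemma cofibre_zero:
  assumes "cofibre_seq T u v"
  shows "v \<cdot> u = ZeroA T (Dom T u) (Cod T v)"
  using assms exact_Tri unfolding cofibre_seq_def exact_triangle_def by blast

lemma cofibre_weak_kernel:
  assumes "cofibre_seq T u v" "t \<in> Homs T S (Dom T v)" "v \<cdot> t = ZeroA T S (Cod T v)"
  obtains r where "r \<in> Homs T S (Dom T u)" "t = u \<cdot> r"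
  using assms exact_Tri unfolding cofibre_seq_def exact_triangle_def by blast

lemma cofibre_weak_cokernel:
  assumes "cofibre_seq T u v" "h \<in> Homs T (Dom T v) S" "h \<cdot> u = ZeroA T (Dom T u) S"
  obtains r where "r \<in> Homs T (Cod T v) S" "h = r \<cdot> v"
  using assms exact_Tri unfolding cofibre_seq_def exact_triangle_def by blast

lemma cofibre_Desusp_weak_cokernel:
  assumes "cofibre_seq T u v" "h \<in> Homs T (Desusp T (Dom T v)) S"
    and "h \<cdot> DesuspA T u = ZeroA T (Desusp T (Dom T u)) S"
  obtains r where "r \<in> Homs T (Desusp T (Cod T v)) S" "h = r \<cdot> DesuspA T v"
  using assms exact_Tri unfolding cofibre_seq_def exact_triangle_def by blast

lemma Tri_weak_cokernel:
  assumes "(w, u, v) \<in> Tri T" "h \<in> Homs T (Dom T u) S" "h \<cdot> w = ZeroA T (Desusp T (Cod T v)) S"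
  obtains r where "r \<in> Homs T (Dom T v) S" "h = r \<cdot> u"
  using assms exact_Tri unfolding exact_triangle_def by blast

end

section \<open>Length with respect to a projective class\<close>

locale length_theory = exact_triangles T
  for T :: "('o, 'f, 'x) triang_cat_scheme" (structure) +
  fixes P :: "'o set" and I :: "'f set"
  assumes proj_class: "projective_class T P I"
begin

lemma P_iff: "X \<in> P \<longleftrightarrow> X \<in> Obj T \<and> (\<forall>f \<in> I. \<forall>h \<in> Homs T X (Dom T f). f \<cdot> h = ZeroA T X (Cod T f))"
  using proj_class unfolding projective_class_def by blast

lemma I_iff: "f \<in> I \<longleftrightarrow> f \<in> Arr T \<and> (\<forall>X \<in> P. \<forall>h \<in> Homs T X (Dom T f). f \<cdot> h = ZeroA T X (Cod T f))"
  using proj_class unfolding projective_class_def by blast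

lemma enough:
  assumes "X \<in> Obj T"
  obtains u v where "cofibre_seq T u v" "Dom T u \<in> P" "Dom T v = X" "v \<in> I"
  using assms proj_class cofibre_Homs unfolding projective_class_def by metis

lemma P_Desusp: "X \<in> P \<Longrightarrow> Desusp T X \<in> P"
  using proj_class unfolding projective_class_def by blast

lemma P_I_zero: "\<lbrakk>X \<in> P; f \<in> I; f \<in> Homs T Y Z; h \<in> Homs T X Y\<rbrakk> \<Longrightarrow> f \<cdot> h = ZeroA T X Z"
  using P_iff Homs_Dom Homs_Cod by metis

lemma I_Arr: "f \<in> I \<Longrightarrow> f \<in> Arr T"
  using I_iff by blast

lemma I_ideal:
  assumes "f \<in> I" "f \<in> Homs T X Y"
  shows I_left: "g \<in> Homs T Y Z \<Longrightarrow> g \<cdot> f \<in> I" and I_right: "g \<in> Homs T W X \<Longrightarrow> f \<cdot> g \<in> I"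
proof -
  assume g: "g \<in> Homs T Y Z"
  have gf: "g \<cdot> f \<in> Homs T X Z" using g assms by blast
  have "(g \<cdot> f) \<cdot> h = ZeroA T A Z" if "A \<in> P" "h \<in> Homs T A X" for A h
    using Cmp_assoc[OF g assms(2) that(2)] P_I_zero[OF that(1) assms that(2)]
      Zero_right[OF g] Homs_Obj[OF that(2)] by simp
  then show "g \<cdot> f \<in> I" using gf I_iff Homs_Arr Homs_Dom Homs_Cod by metis
next
  assume g: "g \<in> Homs T W X"
  have fg: "f \<cdot> g \<in> Homs T W Y" using g assms by blast
  have "(f \<cdot> g) \<cdot> h = ZeroA T A Y" if "A \<in> P" "h \<in> Homs T A W" for A h
    using Cmp_assoc[OF assms(2) g that(2)] P_I_zero[OF that(1) assms Cmp_in[OF g that(2)]]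
    by simp
  then show "f \<cdot> g \<in> I" using fg I_iff Homs_Arr Homs_Dom Homs_Cod by metis
qed

lemma P_retract:
  assumes "X \<in> P" "retract_of_obj T Y X"
  shows "Y \<in> P"
proof -
  obtain f r where fr: "f \<in> Homs T Y X" "r \<in> Homs T X Y" "r \<cdot> f = Ide T Y"
    using retractE[OF assms(2)] .
  have "g \<cdot> h = ZeroA T Y (Cod T g)" if "g \<in> I" "h \<in> Homs T Y (Dom T g)" for g h
  proof -
    have g: "g \<in> Homs T (Dom T g) (Cod T g)" using that I_Arr Arr_Homs by blast
    have hr: "h \<cdot> r \<in> Homs T X (Dom T g)" using that fr by blast
    have "g \<cdot> h = g \<cdot> ((h \<cdot> r) \<cdot> f)" using that fr Cmp_assoc by (metis Ide_right)
    also have "\<dots> = (g \<cdot> (h \<cdot> r)) \<cdot> f" using Cmp_assoc[OF g hr fr(1)] by simp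
    also have "\<dots> = ZeroA T Y (Cod T g)"
      using P_I_zero[OF assms(1) that(1) g hr] Zero_left[OF fr(1)] Homs_Obj[OF g] by simp
    finally show ?thesis .
  qed
  then show ?thesis using P_iff Homs_Obj[OF fr(1)] by blast
qed

abbreviation "IP n \<equiv> ideal_power T I n"
abbreviation "CP n \<equiv> class_power T P n"

lemma IP_Arr: "f \<in> IP n \<Longrightarrow> f \<in> Arr T"
proof (induction n arbitrary: f rule: induct_nat_012)
  case (ge2 n)
  then obtain a g where ag: "f = g \<cdot> a" "a \<in> I" "g \<in> IP (Suc n)" "Dom T g = Cod T a" by auto
  then have "g \<in> Homs T (Cod T a) (Cod T g)" "a \<in> Homs T (Dom T a) (Cod T a)"
    using ge2 I_Arr Arr_Homs by metis+
  then show ?case using ag Homs_Arr by blast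
qed (auto simp: I_Arr)

lemma IP_right:
  assumes "f \<in> IP n" "f \<in> Homs T X Y" "g \<in> Homs T W X"
  shows "f \<cdot> g \<in> IP n"
  using assms(1)
proof (induction n rule: induct_nat_012)
  case 0
  then show ?case using Homs_Arr[OF Cmp_in[OF assms(2,3)]] by simp
next
  case 1
  then show ?case using I_right[OF _ assms(2,3)] by simp
next
  case (ge2 m)
  then obtain x y where xy: "f = y \<cdot> x" "x \<in> I" "y \<in> IP (Suc m)" "Dom T y = Cod T x" by auto
  have hx: "x \<in> Homs T (Dom T x) (Cod T x)" and hy: "y \<in> Homs T (Cod T x) (Cod T y)"
    using xy I_Arr IP_Arr Arr_Homs by metis+
  have dx: "Dom T x = X" using Homs_Dom[OF Cmp_in[OF hy hx]] Homs_Dom[OF assms(2)] xy(1) by simp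
  with hx have hx: "x \<in> Homs T X (Cod T x)" by simp
  have "f \<cdot> g = y \<cdot> (x \<cdot> g)" using xy Cmp_assoc[OF hy hx assms(3)] by simp
  moreover have "x \<cdot> g \<in> I" "Dom T y = Cod T (x \<cdot> g)"
    using I_right[OF xy(2) hx assms(3)] xy(4) Homs_Cod[OF Cmp_in[OF hx assms(3)]] by auto
  ultimately show ?case using xy by auto
qed

lemma IP_left:
  assumes "f \<in> IP n" "f \<in> Homs T X Y" "g \<in> Homs T Y Z"
  shows "g \<cdot> f \<in> IP n"
  using assms
proof (induction n arbitrary: f X rule: induct_nat_012)
  case 0
  then show ?case using Homs_Arr[OF Cmp_in] by simp
next
  case 1
  then show ?case using I_left by auto
next
  case (ge2 m)
  then obtain x y where xy: "f = y \<cdot> x" "x \<in> I" "y \<in> IP (Suc m)" "Dom T y = Cod T x" by auto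
  have hx: "x \<in> Homs T (Dom T x) (Cod T x)" and hy: "y \<in> Homs T (Cod T x) (Cod T y)"
    using xy I_Arr IP_Arr Arr_Homs by metis+
  have "Cod T y = Y" using hx hy xy ge2.prems(2) Cmp_in Homs_Cod by metis
  with hy have hy: "y \<in> Homs T (Cod T x) Y" by simp
  have "g \<cdot> f = (g \<cdot> y) \<cdot> x" using xy Cmp_assoc[OF ge2.prems(3) hy hx] by simp
  moreover have "g \<cdot> y \<in> IP (Suc m)" using ge2 xy hy by blast
  moreover have "Dom T (g \<cdot> y) = Cod T x" using Homs_Dom hy ge2.prems(3) by blast
  ultimately show ?case using xy by auto
qed

lemma IP_SucI_first:
  assumes "f \<in> I" "g \<in> IP n" "f \<in> Homs T X Y" "g \<in> Homs T Y Z"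
  shows "g \<cdot> f \<in> IP (Suc n)"
proof (cases n)
  case 0
  then show ?thesis using I_left[OF assms(1,3,4)] by simp
next
  case (Suc m)
  then have "\<exists>a b. g \<cdot> f = b \<cdot> a \<and> a \<in> I \<and> b \<in> IP (Suc m) \<and> Dom T b = Cod T a"
    using assms(1,2) Homs_Dom[OF assms(4)] Homs_Cod[OF assms(3)] by metis
  then show ?thesis using Suc by simp
qed

lemma IP_SucE_first:
  assumes "f \<in> IP (Suc n)" "f \<in> Homs T X Z"
  obtains a b Y where "f = b \<cdot> a" "a \<in> I" "a \<in> Homs T X Y" "b \<in> IP n" "b \<in> Homs T Y Z"
proof (cases n)
  case 0
  show thesis
    using that[of "Ide T Z" f Z] assms 0 Homs_Obj[OF assms(2)] Homs_Arr[OF Ide_in] by simp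
next
  case (Suc m)
  then obtain x y where xy: "f = y \<cdot> x" "x \<in> I" "y \<in> IP n" "Dom T y = Cod T x"
    using assms(1) by auto
  have hx: "x \<in> Homs T (Dom T x) (Cod T x)" and hy: "y \<in> Homs T (Cod T x) (Cod T y)"
    using xy I_Arr IP_Arr Arr_Homs by metis+
  have "Cod T y = Z" "Dom T x = X" using hx hy xy assms(2) Cmp_in Homs_Cod Homs_Dom by metis+
  with hx hy xy that show thesis by blast
qed

lemma IP_SucI_last:
  assumes "f \<in> IP n" "g \<in> I" "f \<in> Homs T X Y" "g \<in> Homs T Y Z"
  shows "g \<cdot> f \<in> IP (Suc n)"
  using assms
proof (induction n arbitrary: f X)
  case 0
  then show ?case using I_right by simp
next
  case (Suc n)
  obtain a b W where ab: "f = b \<cdot> a" "a \<in> I" "a \<in> Homs T X W" "b \<in> IP n" "b \<in> Homs T W Y"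
    using IP_SucE_first[OF Suc.prems(1,3)] .
  have "g \<cdot> f = (g \<cdot> b) \<cdot> a" using ab Suc.prems Cmp_assoc by metis
  then show ?case
    using IP_SucI_first[OF ab(2) Suc.IH[OF ab(4) Suc.prems(2) ab(5) Suc.prems(4)] ab(3)
        Cmp_in[OF Suc.prems(4) ab(5)]] by (simp del: ideal_power.simps)
qed

text \<open>The recursion defining \<open>\<I>\<^sup>n\<close> splits off the factor applied first; the arguments on
  Auslander-Reiten triangles need the factor applied last.\<close>

lemma IP_SucE_last:
  assumes "f \<in> IP (Suc n)" "f \<in> Homs T X Z"
  obtains a b Y where "f = b \<cdot> a" "a \<in> IP n" "a \<in> Homs T X Y" "b \<in> I" "b \<in> Homs T Y Z"
  using assms
proof (induction n arbitrary: f X thesis)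
  case 0
  then show ?case
    using 0(1)[of f "Ide T X" X] Homs_Obj[OF 0(3)] Homs_Arr[OF Ide_in] by simp
next
  case (Suc n)
  obtain a b W where ab: "f = b \<cdot> a" "a \<in> I" "a \<in> Homs T X W" "b \<in> IP (Suc n)" "b \<in> Homs T W Z"
    using IP_SucE_first[OF Suc.prems(2,3)] .
  obtain c d V where cd: "b = d \<cdot> c" "c \<in> IP n" "c \<in> Homs T W V" "d \<in> I" "d \<in> Homs T V Z"
    using Suc.IH[OF _ ab(4,5)] by metis
  have "f = d \<cdot> (c \<cdot> a)" using ab cd Cmp_assoc by simp
  then show ?case using Suc.prems(1) IP_SucI_first[OF ab(2) cd(2) ab(3) cd(3)] ab cd by blast
qed

lemma IP_Suc_subset: "f \<in> IP (Suc n) \<Longrightarrow> f \<in> IP n"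
  using IP_SucE_last IP_left IP_Arr Arr_Homs by metis

lemma CP_Obj: "X \<in> CP n \<Longrightarrow> X \<in> Obj T"
  using P_iff by (induction n rule: induct_nat_012) (auto simp: zero_objs_def)

lemma CP_retract:
  assumes "X \<in> CP n" "retract_of_obj T Y X"
  shows "Y \<in> CP n"
proof -
  obtain f r where fr: "f \<in> Homs T Y X" "r \<in> Homs T X Y" "r \<cdot> f = Ide T Y"
    using retractE[OF assms(2)] .
  show ?thesis
    using assms(1)
  proof (induction n rule: induct_nat_012)
    case 0
    then have "Ide T X = ZeroA T X X" by (simp add: zero_objs_def)
    then have "f = ZeroA T Y X"
      using Ide_left[OF fr(1)] Zero_left[OF fr(1)] Homs_Obj[OF fr(1)] by simp
    then show ?case using fr Zero_right[OF fr(2)] Homs_Obj[OF fr(1)] by (simp add: zero_objs_def)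
  next
    case 1
    then show ?case using assms(2) P_retract by simp
  next
    case (ge2 m)
    then obtain N u v where "retract_of_obj T X N" "cofibre_seq T u v" "Cod T u = N"
      "Dom T u \<in> P" "Cod T v \<in> CP (Suc m)" by auto
    then show ?case using retract_trans[OF assms(2)] Homs_Obj[OF fr(1)] by auto
  qed
qed

definition kills :: "nat \<Rightarrow> 'o \<Rightarrow> bool" where
  "kills n X \<longleftrightarrow> (\<forall>Y. \<forall>f \<in> IP n. f \<in> Homs T X Y \<longrightarrow> f = ZeroA T X Y)"

lemma kills_0: "X \<in> Obj T \<Longrightarrow> kills 0 X \<longleftrightarrow> X \<in> zero_objs T"
  using zero_objs_iff[of X] unfolding kills_def by (auto simp: Homs_def)

lemma kills_1: "X \<in> P \<Longrightarrow> kills 1 X"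
  unfolding kills_def using P_I_zero[OF _ _ _ Ide_in, of X] P_iff[of X] by simp

lemma kills_retract:
  assumes "kills n X" "f \<in> Homs T Y X" "r \<in> Homs T X Y" "r \<cdot> f = Ide T Y"
  shows "kills n Y"
  unfolding kills_def
proof (intro allI ballI impI)
  fix Z g assume g: "g \<in> IP n" "g \<in> Homs T Y Z"
  then have "g \<cdot> r = ZeroA T X Z" using assms IP_right unfolding kills_def by blast
  then have "(g \<cdot> r) \<cdot> f = ZeroA T Y Z" using Zero_left assms g Homs_Obj by metis
  then show "g = ZeroA T Y Z" using Cmp_assoc assms g by simp
qed

text \<open>In a composite of a map \<open>a\<close> in \<open>\<I>\<close> followed by one in \<open>\<I>\<^sup>n\<close>, \<open>a\<close> vanishes on \<open>A\<close> and so descends to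
  \<open>B\<close>, where the remaining factor kills it. The middle hypothesis is stated by itself, and not
  through a triangle, so that it also covers desuspended triangles.\<close>

lemma kills_extension:
  assumes u: "u \<in> Homs T A N" and v: "v \<in> Homs T N B" and A: "A \<in> P" and B: "kills n B"
    and wc: "\<And>S h. \<lbrakk>h \<in> Homs T N S; h \<cdot> u = ZeroA T A S\<rbrakk> \<Longrightarrow> \<exists>r \<in> Homs T B S. h = r \<cdot> v"
  shows "kills (Suc n) N"
  unfolding kills_def
proof (intro allI ballI impI)
  fix Z g assume g: "g \<in> IP (Suc n)" "g \<in> Homs T N Z"
  obtain a b Y where ab: "g = b \<cdot> a" "a \<in> I" "a \<in> Homs T N Y" "b \<in> IP n" "b \<in> Homs T Y Z"
    using IP_SucE_first[OF g] .
  have "a \<cdot> u = ZeroA T A Y" using P_I_zero[OF A ab(2,3) u] .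
  then obtain r where r: "r \<in> Homs T B Y" "a = r \<cdot> v" using wc ab(3) by blast
  have "b \<cdot> r = ZeroA T B Z" using B IP_right[OF ab(4,5) r(1)] ab r unfolding kills_def by blast
  then have "(b \<cdot> r) \<cdot> v = ZeroA T N Z" using Zero_left[OF v] Homs_Obj ab by simp
  then show "g = ZeroA T N Z" using ab r v Cmp_assoc by simp
qed

text \<open>The ghost lemma, for an object of \<open>\<P>\<^sub>n\<close> and for its desuspension at the same time.\<close>

lemma CP_kills_Desusp: "X \<in> CP n \<Longrightarrow> kills n X \<and> kills n (Desusp T X)"
proof (induction n arbitrary: X rule: induct_nat_012)
  case 0
  then have X: "X \<in> Obj T" "Ide T X = ZeroA T X X" by (auto simp: zero_objs_def)
  then have "Ide T (Desusp T X) = ZeroA T (Desusp T X) (Desusp T X)"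
    using DesuspA_Ide DesuspA_Zero by metis
  then show ?case using X kills_0 by (simp add: zero_objs_def)
next
  case 1
  then show ?case using kills_1 P_Desusp by simp
next
  case (ge2 n)
  then obtain N u v where N: "retract_of_obj T X N" "cofibre_seq T u v" "Cod T u = N"
    "Dom T u \<in> P" "Cod T v \<in> CP (Suc n)" by auto
  obtain f r where fr: "f \<in> Homs T X N" "r \<in> Homs T N X" "r \<cdot> f = Ide T X"
    using retractE[OF N(1)] .
  note c = cofibre_Homs[OF N(2)]
  have v: "Dom T v = N" using c N by simp
  have "kills (Suc (Suc n)) N"
    using kills_extension[OF c(1)[unfolded v] c(2)[unfolded v] N(4)] ge2 N(5)
      cofibre_weak_cokernel[OF N(2)] v by metis
  moreover have "kills (Suc (Suc n)) (Desusp T N)"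
    using kills_extension[OF DesuspA_in[OF c(1)[unfolded v]] DesuspA_in[OF c(2)[unfolded v]]
        P_Desusp[OF N(4)]] ge2 N(5)
      cofibre_Desusp_weak_cokernel[OF N(2)] v by metis
  moreover have "DesuspA T r \<cdot> DesuspA T f = Ide T (Desusp T X)"
    using fr DesuspA_Cmp[OF fr(2,1)] DesuspA_Ide Homs_Obj[OF fr(1)] by simp
  ultimately show ?case
    using kills_retract[OF _ fr] kills_retract[OF _ DesuspA_in[OF fr(1)] DesuspA_in[OF fr(2)]]
    by blast
qed

text \<open>One glues: if \<open>P \<rightarrow> X \<rightarrow> X'\<close> is a triangle with \<open>P\<close> in \<open>\<P>\<close> and \<open>X \<rightarrow> X'\<close> in \<open>\<I>\<close>, and \<open>E' \<rightarrow> X' \<rightarrow> Y\<close>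
  is a sequence as required for \<open>n\<close>, then base change of the triangle along \<open>E' \<rightarrow> X'\<close> gives an
  extension \<open>E\<close> of \<open>E'\<close> by \<open>P\<close>, which is in \<open>\<P>\<^bsub>n+1\<^esub>\<close> and is the fibre of the composite \<open>X \<rightarrow> Y\<close>.\<close>

lemma tower:
  assumes "X \<in> Obj T"
  shows "\<exists>E Y e f. E \<in> CP n \<and> e \<in> Homs T E X \<and> f \<in> Homs T X Y \<and> f \<in> IP n \<and>
    (\<forall>S t. t \<in> Homs T S X \<and> f \<cdot> t = ZeroA T S Y \<longrightarrow> (\<exists>r \<in> Homs T S E. t = e \<cdot> r)) \<and>
    (\<forall>S h. h \<in> Homs T X S \<and> h \<cdot> e = ZeroA T E S \<longrightarrow> (\<exists>r \<in> Homs T Y S. h = r \<cdot> f))"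
  using assms
proof (induction n arbitrary: X rule: induct_nat_012)
  case 0
  obtain Z where Z: "Z \<in> zero_objs T" using zero_obj_exists 0 by blast
  then have "Z \<in> Obj T" by (simp add: zero_objs_def)
  have "\<exists>r \<in> Homs T S Z. t = ZeroA T Z X \<cdot> r"
    if "t \<in> Homs T S X" "Ide T X \<cdot> t = ZeroA T S X" for S t
  proof (rule bexI[of _ "ZeroA T S Z"])
    show "ZeroA T S Z \<in> Homs T S Z" using Homs_Obj[OF that(1)] \<open>Z \<in> Obj T\<close> by simp
    then show "t = ZeroA T Z X \<cdot> ZeroA T S Z" using that Zero_left 0 by simp
  qed
  then show ?case
    using Z \<open>Z \<in> Obj T\<close> 0 Homs_Arr[OF Ide_in[OF 0]]
    by (intro exI[of _ Z] exI[of _ X] exI[of _ "ZeroA T Z X"] exI[of _ "Ide T X"]) auto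
next
  case 1
  obtain u v where uv: "cofibre_seq T u v" "Dom T u \<in> P" "Dom T v = X" "v \<in> I"
    using enough[OF 1] .
  note c = cofibre_Homs[OF uv(1), unfolded uv(3)]
  have "\<exists>r \<in> Homs T S (Dom T u). t = u \<cdot> r"
    if "t \<in> Homs T S X" "v \<cdot> t = ZeroA T S (Cod T v)" for S t
    using cofibre_weak_kernel[OF uv(1), unfolded uv(3), OF that] by blast
  moreover have "\<exists>r \<in> Homs T (Cod T v) S. h = r \<cdot> v"
    if "h \<in> Homs T X S" "h \<cdot> u = ZeroA T (Dom T u) S" for S h
    using cofibre_weak_cokernel[OF uv(1), unfolded uv(3), OF that] by blast
  ultimately show ?case
    using uv c by (intro exI[of _ "Dom T u"] exI[of _ "Cod T v"] exI[of _ u] exI[of _ v]) simp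
next
  case (ge2 n)
  obtain u v where uv: "cofibre_seq T u v" "Dom T u \<in> P" "Dom T v = X" "v \<in> I"
    using enough[OF ge2(3)] .
  note c = cofibre_Homs[OF uv(1), unfolded uv(3)]
  define X' where "X' = Cod T v"
  have v: "v \<in> Homs T X X'" using c X'_def by simp
  have "X' \<in> Obj T" using Homs_Obj[OF v] by simp
  from ge2(2)[OF this] obtain E' Y e' f where ih: "E' \<in> CP (Suc n)" "e' \<in> Homs T E' X'"
    "f \<in> Homs T X' Y" "f \<in> IP (Suc n)"
    and wk: "\<And>S t. \<lbrakk>t \<in> Homs T S X'; f \<cdot> t = ZeroA T S Y\<rbrakk> \<Longrightarrow> \<exists>r \<in> Homs T S E'. t = e' \<cdot> r"
    and wc: "\<And>S h. \<lbrakk>h \<in> Homs T X' S; h \<cdot> e' = ZeroA T E' S\<rbrakk> \<Longrightarrow> \<exists>r \<in> Homs T Y S. h = r \<cdot> f"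
    by metis
  obtain w where w: "(w, u, v) \<in> Tri T" using uv(1) unfolding cofibre_seq_def by blast
  have "e' \<in> Arr T" "Cod T e' = Cod T v" "Dom T e' = E'" using ih X'_def by (auto simp: Homs_def)
  from base_change[OF w this(1,2)] this(3) obtain u' v' e where bc: "cofibre_seq T u' v'"
    "isomorphic_in T (Dom T u') (Dom T u)" "Cod T v' = E'"
    "e \<in> Homs T (Cod T u') (Cod T u)"
    and bwk: "\<And>S t r. \<lbrakk>t \<in> Homs T S (Cod T u); r \<in> Homs T S E'; v \<cdot> t = e' \<cdot> r\<rbrakk> \<Longrightarrow>
        \<exists>y \<in> Homs T S (Cod T u'). t = e \<cdot> y"
    and bwc: "\<And>S h. \<lbrakk>h \<in> Homs T (Cod T u) S; h \<cdot> e = ZeroA T (Cod T u') S\<rbrakk> \<Longrightarrow>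
        \<exists>r \<in> Homs T (Cod T v) S. h = r \<cdot> v \<and> r \<cdot> e' = ZeroA T E' S"
    unfolding weak_base_change_def by metis
  have cu: "Cod T u = X" using c by simp
  define E where "E = Cod T u'"
  have e: "e \<in> Homs T E X" using bc cu E_def by simp
  have "E \<in> Obj T" using Homs_Obj[OF e] by simp
  moreover have "Dom T u' \<in> P" using P_retract uv(2) isomorphic_retract[OF bc(2)] by blast
  ultimately have "E \<in> CP (Suc (Suc n))"
    using retract_refl bc(1,3) ih(1) E_def by auto
  moreover have "f \<cdot> v \<in> Homs T X Y" using v ih by blast
  moreover have "f \<cdot> v \<in> IP (Suc (Suc n))" using IP_SucI_first[OF uv(4) ih(4) v ih(3)] .
  moreover have "\<exists>r \<in> Homs T S E. t = e \<cdot> r"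
    if t: "t \<in> Homs T S X" "(f \<cdot> v) \<cdot> t = ZeroA T S Y" for S t
  proof -
    have "f \<cdot> (v \<cdot> t) = ZeroA T S Y" using t Cmp_assoc[OF ih(3) v t(1)] by simp
    then obtain r where "r \<in> Homs T S E'" "v \<cdot> t = e' \<cdot> r" using wk v t by blast
    then show ?thesis using bwk t cu E_def by simp
  qed
  moreover have "\<exists>r \<in> Homs T Y S. h = r \<cdot> (f \<cdot> v)"
    if h: "h \<in> Homs T X S" "h \<cdot> e = ZeroA T E S" for S h
  proof -
    obtain r where r: "r \<in> Homs T X' S" "h = r \<cdot> v" "r \<cdot> e' = ZeroA T E' S"
      using bwc h cu E_def X'_def by blast
    then obtain q where "q \<in> Homs T Y S" "r = q \<cdot> f" using wc by blast
    then show ?thesis using r v ih Cmp_assoc by blast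
  qed
  ultimately show ?case using e by (intro exI conjI) blast+
qed

text \<open>If \<open>\<I>\<^sup>n\<close> kills \<open>X\<close>, the universal map \<open>X \<rightarrow> Y\<close> in \<open>\<I>\<^sup>n\<close> is zero, so the identity of \<open>X\<close> factors through
  its fibre and \<open>X\<close> is a retract of an object of \<open>\<P>\<^sub>n\<close>.\<close>

theorem CP_iff_kills: "X \<in> CP n \<longleftrightarrow> X \<in> Obj T \<and> kills n X"
proof
  assume "X \<in> CP n"
  then show "X \<in> Obj T \<and> kills n X" using CP_Obj CP_kills_Desusp by blast
next
  assume X: "X \<in> Obj T \<and> kills n X"
  obtain E Y e f where E: "E \<in> CP n" "e \<in> Homs T E X" "f \<in> Homs T X Y" "f \<in> IP n"
    and wk: "\<And>S t. \<lbrakk>t \<in> Homs T S X; f \<cdot> t = ZeroA T S Y\<rbrakk> \<Longrightarrow> \<exists>r \<in> Homs T S E. t = e \<cdot> r"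
    using tower X by metis
  have "f = ZeroA T X Y" using X E unfolding kills_def by blast
  then have "f \<cdot> Ide T X = ZeroA T X Y" using E by simp
  then obtain r where "r \<in> Homs T X E" "e \<cdot> r = Ide T X" using wk X by (metis Ide_in)
  then show "X \<in> CP n" using CP_retract E retractI by blast
qed

lemma CP_Desusp: "X \<in> CP n \<Longrightarrow> Desusp T X \<in> CP n"
  using CP_iff_kills CP_kills_Desusp by simp

lemma len_enat_CP:
  assumes "len T P X = enat n"
  shows "X \<in> CP n"
proof -
  let ?S = "{enat n | n. X \<in> CP n}"
  have "?S \<noteq> {}"
  proof
    assume "?S = {}"
    then have "len T P X = \<infinity>" unfolding len_def by (metis Inf_enat_def)
    then show False using assms by simp
  qed
  then have "Inf ?S \<in> ?S" unfolding Inf_enat_def by (auto intro: LeastI)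
  then show ?thesis using assms unfolding len_def by auto
qed

lemma CP_len_le: "X \<in> CP n \<Longrightarrow> len T P X \<le> enat n"
  unfolding len_def by (rule Inf_lower) auto

text \<open>Everything is read off from the universal map \<open>f : M \<rightarrow> Y\<close> in \<open>\<I>\<^bsup>l-1\<^esup>\<close>: by minimality of \<open>l\<close> its
  fibre \<open>e\<close> is not split epic, and so \<open>e\<close> lifts to \<open>H\<close>.\<close>

lemma AR_length:
  assumes AR: "AR_triangle T \<alpha> \<beta> \<gamma>"
    and a: "\<alpha> \<in> Homs T (Desusp T (Desusp T M)) H"
    and b: "\<beta> \<in> Homs T H M"
    and c: "\<gamma> \<in> Homs T M (Desusp T M)"
    and l: "len T P M = enat l"
  shows "len T P M - 1 \<le> len T P H" "len T P H \<le> len T P M + 1" "\<gamma> \<in> IP (l - 1)"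
    "\<gamma> \<noteq> ZeroA T M (Desusp T M)"
proof -
  have M: "M \<in> Obj T" "Desusp T M \<in> Obj T" and H: "H \<in> Obj T" using Homs_Obj b c by blast+
  have D: "Dom T \<alpha> = Desusp T (Desusp T M)" "Cod T \<alpha> = H" "Dom T \<beta> = H" "Cod T \<beta> = M"
    "Dom T \<gamma> = M" "Cod T \<gamma> = Desusp T M" using a b c Homs_Dom Homs_Cod by blast+
  have tri: "(\<alpha>, \<beta>, \<gamma>) \<in> Tri T" and g0: "\<gamma> \<noteq> ZeroA T M (Desusp T M)"
    using AR D unfolding AR_triangle_def by metis+
  have AR1: "\<And>f. \<lbrakk>f \<in> Arr T; Dom T f = Dom T \<alpha>; \<not> split_mono T f\<rbrakk> \<Longrightarrow>
        \<exists>h \<in> Homs T (Cod T \<alpha>) (Cod T f). f = h \<cdot> \<alpha>"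
    and AR2: "\<And>f. \<lbrakk>f \<in> Arr T; Cod T f = Cod T \<beta>; \<not> split_epi T f\<rbrakk> \<Longrightarrow>
        \<exists>h \<in> Homs T (Dom T f) (Dom T \<beta>). f = \<beta> \<cdot> h"
    using AR unfolding AR_triangle_def by simp_all
  have left: "\<exists>h \<in> Homs T H Y. f = h \<cdot> \<alpha>"
    if f: "f \<in> Homs T (Desusp T (Desusp T M)) Y" "\<not> split_mono T f" for f Y
    using AR1[OF Homs_Arr[OF f(1)] _ f(2)] unfolding Homs_Dom[OF f(1)] Homs_Cod[OF f(1)] D(1,2) by blast
  have right: "\<exists>h \<in> Homs T Y H. f = \<beta> \<cdot> h"
    if f: "f \<in> Homs T Y M" "\<not> split_epi T f" for f Y
    using AR2[OF Homs_Arr[OF f(1)] _ f(2)] unfolding Homs_Dom[OF f(1)] Homs_Cod[OF f(1)] D(3,4) by blast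
  show "\<gamma> \<noteq> ZeroA T M (Desusp T M)" by (fact g0)
  have cs: "cofibre_seq T \<beta> \<gamma>" using tri unfolding cofibre_seq_def by blast
  have Ml: "M \<in> CP l" using len_enat_CP[OF l] .
  have l_le: "l \<le> n" if "M \<in> CP n" for n using CP_len_le[OF that] l by simp
  have id0: "Ide T M \<noteq> ZeroA T M M"
    using g0 Ide_right[OF c] Zero_right[OF c M(1)] by metis
  have idO0: "Ide T (Desusp T M) \<noteq> ZeroA T (Desusp T M) (Desusp T M)"
    using g0 Ide_left[OF c] Zero_left[OF c M(2)] by metis
  have "l \<noteq> 0" using Ml id0 by (cases l) (auto simp: zero_objs_def)
  then obtain m where m: "l = Suc m" by (cases l) auto
  then have nM: "M \<notin> CP m" using l_le by force
  obtain E Y e f where E: "E \<in> CP m" "e \<in> Homs T E M" "f \<in> Homs T M Y" "f \<in> IP m"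
    and wc: "\<And>S h. \<lbrakk>h \<in> Homs T M S; h \<cdot> e = ZeroA T E S\<rbrakk> \<Longrightarrow> \<exists>r \<in> Homs T Y S. h = r \<cdot> f"
    using tower[OF M(1)] by metis
  \<comment> \<open>A section of e would exhibit M as a retract of an object of length at most l - 1.\<close>
  have "\<not> split_epi T e"
  proof
    assume "split_epi T e"
    then obtain r where "r \<in> Homs T M E" "e \<cdot> r = Ide T M" using split_epiE E(2) by blast
    then show False using nM CP_retract[OF E(1)] retractI E(2) by blast
  qed
  then obtain e' where e': "e' \<in> Homs T E H" "e = \<beta> \<cdot> e'" using right E(2) by blast
  have ge: "\<gamma> \<cdot> e = ZeroA T E (Desusp T M)"
    using Cmp_assoc[OF c b e'(1)] cofibre_zero[OF cs] D Zero_left[OF e'(1) M(2)] e' by simp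
  then obtain g where g: "g \<in> Homs T Y (Desusp T M)" "\<gamma> = g \<cdot> f" using wc[OF c] by blast
  then show "\<gamma> \<in> IP (l - 1)" using IP_left[OF E(4,3)] m by simp

  have "kills (Suc l) H" unfolding kills_def
  proof (intro allI ballI impI)
    fix Z r assume r: "r \<in> IP (Suc l)" "r \<in> Homs T H Z"
    obtain r1 r2 X where r12: "r = r2 \<cdot> r1" "r1 \<in> IP l" "r1 \<in> Homs T H X" "r2 \<in> I"
      "r2 \<in> Homs T X Z" using IP_SucE_last[OF r] .
    have "r1 \<cdot> \<alpha> = ZeroA T (Desusp T (Desusp T M)) X"
      using CP_Desusp[OF CP_Desusp[OF Ml]] IP_right[OF r12(2,3) a] r12(3) a
      unfolding CP_iff_kills kills_def by blast
    then obtain h where h: "h \<in> Homs T M X" "r1 = h \<cdot> \<beta>"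
      using Tri_weak_cokernel[OF tri, unfolded D] r12(3) by metis
    \<comment> \<open>Since e = \<beta> e', the map h vanishes on E, where r1, a map in \<open>\<I>\<^sup>l\<close>, is zero.\<close>
    have "h \<cdot> e = r1 \<cdot> e'" using e' h b Cmp_assoc by simp
    also have "\<dots> = ZeroA T E X"
      using CP_iff_kills[of E m] E(1) IP_right[OF IP_Suc_subset r12(3) e'(1)] r12(2,3) m e'(1)
      unfolding kills_def by blast
    finally obtain q where q: "q \<in> Homs T Y X" "h = q \<cdot> f" using wc[OF h(1)] by blast
    then have "h \<in> IP m" using IP_left[OF E(4,3)] by simp
    then have "r2 \<cdot> h \<in> IP l" using IP_SucI_last r12 h m by simp
    then have "r2 \<cdot> h = ZeroA T M Z"
      using Ml r12(5) h(1) unfolding CP_iff_kills kills_def by blast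
    then show "r = ZeroA T H Z"
      using r12(1) h(2) Cmp_assoc[OF r12(5) h(1) b] Zero_left[OF b] Homs_Obj[OF r(2)] by simp
  qed
  then have "len T P H \<le> enat (Suc l)" using CP_len_le CP_iff_kills H by blast
  then show "len T P H \<le> len T P M + 1" using l by (simp add: one_enat_def)

  show "len T P M - 1 \<le> len T P H"
  proof (cases "len T P H")
    case infinity
    then show ?thesis by simp
  next
    case (enat n)
    then have Hn: "kills n H" using len_enat_CP CP_iff_kills by blast
    have "kills (Suc n) M" unfolding kills_def
    proof (intro allI ballI impI, rule ccontr)
      fix Z r assume r: "r \<in> IP (Suc n)" "r \<in> Homs T M Z" "r \<noteq> ZeroA T M Z"
      obtain r1 r2 X where r12: "r = r2 \<cdot> r1" "r1 \<in> IP n" "r1 \<in> Homs T M X" "r2 \<in> I"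
        "r2 \<in> Homs T X Z" using IP_SucE_last[OF r(1,2)] .
      have "r1 \<cdot> \<beta> = ZeroA T H X" using Hn IP_right[OF r12(2,3) b] r12(3) b
        unfolding kills_def by blast
      then obtain s where s: "s \<in> Homs T (Desusp T M) X" "r1 = s \<cdot> \<gamma>"
        using cofibre_weak_cokernel[OF cs, unfolded D] r12(3) by metis
      define t where "t = r2 \<cdot> s"
      have t: "t \<in> Homs T (Desusp T M) Z" "r = t \<cdot> \<gamma>" "t \<in> I"
        using r12 s c Cmp_assoc I_right[OF r12(4,5) s(1)] unfolding t_def by auto
      have Z: "Z \<in> Obj T" using Homs_Obj[OF t(1)] by blast
      \<comment> \<open>The lifting property of the triangle speaks of maps out of \<open>\<Omega>\<^sup>2M\<close>, so it is applied to \<open>\<Omega>t\<close>: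
        if \<open>\<Omega>t\<close> factored through \<open>\<alpha>\<close>, then \<open>\<Omega>(t \<gamma>) = 0\<close> and \<open>t \<gamma> = 0\<close>.\<close>
      have "split_mono T (DesuspA T t)"
      proof (rule ccontr)
        assume "\<not> split_mono T (DesuspA T t)"
        then obtain h where h: "h \<in> Homs T H (Desusp T Z)" "DesuspA T t = h \<cdot> \<alpha>"
          using left DesuspA_in[OF t(1)] by blast
        have "\<alpha> \<cdot> DesuspA T \<gamma> = ZeroA T (Desusp T M) H"
          using exact_Tri[OF tri] D unfolding exact_triangle_def by simp
        then have "DesuspA T r = ZeroA T (Desusp T M) (Desusp T Z)"
          using t DesuspA_Cmp[OF t(1) c] h Cmp_assoc[OF h(1) a DesuspA_in[OF c]]
            Zero_right[OF h(1) M(2)] by simp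
        then show False
          using DesuspA_faithful[OF r(2) Zero_in[OF M(1) Z]] DesuspA_Zero[OF M(1) Z] r(3) by simp
      qed
      then obtain p where p: "p \<in> Homs T (Desusp T Z) (Desusp T (Desusp T M))"
        "p \<cdot> DesuspA T t = Ide T (Desusp T (Desusp T M))"
        using split_monoE DesuspA_in[OF t(1)] by blast
      obtain q where q: "q \<in> Homs T Z (Desusp T M)" "DesuspA T q = p"
        using DesuspA_full[OF Z M(2) p(1)] by blast
      \<comment> \<open>The retraction of \<open>\<Omega>t\<close> is itself a desuspension, so t is split monic too.\<close>
      have "q \<cdot> t = Ide T (Desusp T M)"
        using DesuspA_faithful[OF Cmp_in[OF q(1) t(1)] Ide_in[OF M(2)]]
          DesuspA_Cmp[OF q(1) t(1)] DesuspA_Ide[OF M(2)] p q by simp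
      then have idI: "Ide T (Desusp T M) \<in> I" using I_left[OF t(3,1) q(1)] by simp
      have "Ide T (Desusp T M) \<in> IP j" for j
      proof (induction j)
        case 0
        then show ?case using Homs_Arr[OF Ide_in[OF M(2)]] by simp
      next
        case (Suc j)
        then show ?case
          using IP_SucI_first[OF idI Suc Ide_in Ide_in] Ide_left[OF Ide_in] M(2) by metis
      qed
      then show False
        using CP_Desusp[OF Ml] Ide_in[OF M(2)] idO0 unfolding CP_iff_kills kills_def by blast
    qed
    then have "l \<le> Suc n" using l_le CP_iff_kills M by blast
    then show ?thesis using l enat by (simp add: one_enat_def)
  qed
qed

end

section \<open>Invariance of exactness under isomorphism\<close>

context desusp_category
begin

lemma triangle_isoE:
  assumes "triangle_iso T (w, u, v) (w', u', v')"
    and "triangle_shape T (w, u, v)" "triangle_shape T (w', u', v')"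
  obtains X Y Z X' Y' Z' a b c a' b' c' where
    "w \<in> Homs T (Desusp T Z) X" "u \<in> Homs T X Y" "v \<in> Homs T Y Z"
    "w' \<in> Homs T (Desusp T Z') X'" "u' \<in> Homs T X' Y'" "v' \<in> Homs T Y' Z'"
    "a \<in> Homs T X X'" "b \<in> Homs T Y Y'" "c \<in> Homs T Z Z'"
    "a' \<in> Homs T X' X" "b' \<in> Homs T Y' Y" "c' \<in> Homs T Z' Z"
    "a' \<cdot> a = Ide T X" "b' \<cdot> b = Ide T Y" "c' \<cdot> c = Ide T Z"
    "a \<cdot> a' = Ide T X'" "b \<cdot> b' = Ide T Y'" "c \<cdot> c' = Ide T Z'"
    "a \<cdot> w = w' \<cdot> DesuspA T c" "b \<cdot> u = u' \<cdot> a" "c \<cdot> v = v' \<cdot> b"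
proof -
  obtain a b c where abc: "a \<in> Homs T (Dom T u) (Dom T u')" "b \<in> Homs T (Dom T v) (Dom T v')"
    "c \<in> Homs T (Cod T v) (Cod T v')" "iso_arr T a" "iso_arr T b" "iso_arr T c"
    and eqs: "a \<cdot> w = w' \<cdot> DesuspA T c" "b \<cdot> u = u' \<cdot> a" "c \<cdot> v = v' \<cdot> b"
    using assms(1) unfolding triangle_iso_def by auto
  obtain a' where a': "a' \<in> Homs T (Dom T u') (Dom T u)" "a' \<cdot> a = Ide T (Dom T u)"
    "a \<cdot> a' = Ide T (Dom T u')" using iso_arrE[OF abc(4,1)] .
  obtain b' where b': "b' \<in> Homs T (Dom T v') (Dom T v)" "b' \<cdot> b = Ide T (Dom T v)"
    "b \<cdot> b' = Ide T (Dom T v')" using iso_arrE[OF abc(5,2)] .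
  obtain c' where c': "c' \<in> Homs T (Cod T v') (Cod T v)" "c' \<cdot> c = Ide T (Cod T v)"
    "c \<cdot> c' = Ide T (Cod T v')" using iso_arrE[OF abc(6,3)] .
  have h: "w \<in> Homs T (Desusp T (Cod T v)) (Dom T u)" "u \<in> Homs T (Dom T u) (Dom T v)"
    "v \<in> Homs T (Dom T v) (Cod T v)" "w' \<in> Homs T (Desusp T (Cod T v')) (Dom T u')"
    "u' \<in> Homs T (Dom T u') (Dom T v')" "v' \<in> Homs T (Dom T v') (Cod T v')"
    using assms(2,3) by (auto simp: triangle_shape_def Homs_def)
  show thesis by (rule that[OF h abc(1-3) a'(1) b'(1) c'(1) a'(2) b'(2) c'(2) a'(3) b'(3) c'(3) eqs])
qed

text \<open>Exactness at one place involves two consecutive arrows only, so it is transported along an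
  isomorphism of two-step diagrams. The next lemmas are stated for such diagrams in order to apply
  both to the arrows of a triangle and to their images under \<open>\<Omega>\<close>.\<close>

lemma iso_square:
  assumes "u \<in> Homs T X Y" "u' \<in> Homs T X' Y'" "a \<in> Homs T X X'" "b \<in> Homs T Y Y'"
    and "a' \<in> Homs T X' X" "b' \<in> Homs T Y' Y" "a \<cdot> a' = Ide T X'" "b' \<cdot> b = Ide T Y"
    and "b \<cdot> u = u' \<cdot> a"
  shows "u \<cdot> a' = b' \<cdot> u'"
proof -
  have "b' \<cdot> u' = b' \<cdot> (u' \<cdot> (a \<cdot> a'))" using assms by simp
  also have "\<dots> = b' \<cdot> ((u' \<cdot> a) \<cdot> a')" using Cmp_assoc[OF assms(2,3,5)] by simp
  also have "\<dots> = b' \<cdot> (b \<cdot> (u \<cdot> a'))" using assms(9) Cmp_assoc[OF assms(4,1,5)] by simp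
  also have "\<dots> = (b' \<cdot> b) \<cdot> (u \<cdot> a')" using Cmp_assoc[OF assms(6,4) Cmp_in[OF assms(1,5)]] by simp
  also have "\<dots> = u \<cdot> a'" using assms(8) Cmp_in[OF assms(1,5)] by simp
  finally show ?thesis by simp
qed

lemma weak_kernel_iso:
  assumes u: "u \<in> Homs T X Y" "u' \<in> Homs T X' Y'" and v: "v \<in> Homs T Y Z" "v' \<in> Homs T Y' Z'"
    and a: "a \<in> Homs T X X'" and b: "b \<in> Homs T Y Y'" "b' \<in> Homs T Y' Y" "b \<cdot> b' = Ide T Y'"
    and c': "c' \<in> Homs T Z' Z" and sq: "b \<cdot> u = u' \<cdot> a" "v \<cdot> b' = c' \<cdot> v'"
    and wk: "\<And>t. \<lbrakk>t \<in> Homs T S Y; v \<cdot> t = ZeroA T S Z\<rbrakk> \<Longrightarrow> \<exists>r \<in> Homs T S X. t = u \<cdot> r"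
    and t: "t \<in> Homs T S Y'" "v' \<cdot> t = ZeroA T S Z'"
  shows "\<exists>r \<in> Homs T S X'. t = u' \<cdot> r"
proof -
  have "v \<cdot> (b' \<cdot> t) = c' \<cdot> (v' \<cdot> t)"
    using Cmp_assoc[OF v(1) b(2) t(1)] Cmp_assoc[OF c' v(2) t(1)] sq(2) by simp
  also have "\<dots> = ZeroA T S Z" using t Zero_right[OF c'] Homs_Obj by metis
  finally obtain r where r: "r \<in> Homs T S X" "b' \<cdot> t = u \<cdot> r" using wk[OF Cmp_in[OF b(2) t(1)]] by blast
  have "t = b \<cdot> (b' \<cdot> t)" using Cmp_assoc[OF b(1,2) t(1)] b(3) t by simp
  also have "\<dots> = (u' \<cdot> a) \<cdot> r" using r(2) Cmp_assoc[OF b(1) u(1) r(1)] sq(1) by simp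
  also have "\<dots> = u' \<cdot> (a \<cdot> r)" using Cmp_assoc[OF u(2) a r(1)] .
  finally show ?thesis using Cmp_in[OF a r(1)] by blast
qed

lemma weak_cokernel_iso:
  assumes u: "u \<in> Homs T X Y" "u' \<in> Homs T X' Y'" and v: "v \<in> Homs T Y Z" "v' \<in> Homs T Y' Z'"
    and a: "a \<in> Homs T X X'" and b: "b \<in> Homs T Y Y'" "b' \<in> Homs T Y' Y" "b \<cdot> b' = Ide T Y'"
    and c': "c' \<in> Homs T Z' Z" and sq: "b \<cdot> u = u' \<cdot> a" "v \<cdot> b' = c' \<cdot> v'"
    and wc: "\<And>h. \<lbrakk>h \<in> Homs T Y S; h \<cdot> u = ZeroA T X S\<rbrakk> \<Longrightarrow> \<exists>r \<in> Homs T Z S. h = r \<cdot> v"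
    and h: "h \<in> Homs T Y' S" "h \<cdot> u' = ZeroA T X' S"
  shows "\<exists>r \<in> Homs T Z' S. h = r \<cdot> v'"
proof -
  have "(h \<cdot> b) \<cdot> u = (h \<cdot> u') \<cdot> a"
    using Cmp_assoc[OF h(1) b(1) u(1)] Cmp_assoc[OF h(1) u(2) a] sq(1) by simp
  also have "\<dots> = ZeroA T X S" using h Zero_left[OF a] Homs_Obj by metis
  finally obtain r where r: "r \<in> Homs T Z S" "h \<cdot> b = r \<cdot> v" using wc[OF Cmp_in[OF h(1) b(1)]] by blast
  have "h = (h \<cdot> b) \<cdot> b'" using Cmp_assoc[OF h(1) b(1,2)] b(3) h by simp
  also have "\<dots> = r \<cdot> (c' \<cdot> v')" using r(2) Cmp_assoc[OF r(1) v(1) b(2)] sq(2) by simp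
  also have "\<dots> = (r \<cdot> c') \<cdot> v'" using Cmp_assoc[OF r(1) c' v(2)] by simp
  finally show ?thesis using Cmp_in[OF r(1) c'] by blast
qed

lemma zero_composite_iso:
  assumes u: "u \<in> Homs T X Y" "u' \<in> Homs T X' Y'" and v: "v \<in> Homs T Y Z" "v' \<in> Homs T Y' Z'"
    and a': "a' \<in> Homs T X' X" and b: "b \<in> Homs T Y Y'" and b': "b' \<in> Homs T Y' Y" "b \<cdot> b' = Ide T Y'"
    and c: "c \<in> Homs T Z Z'" and sq: "u \<cdot> a' = b' \<cdot> u'" "c \<cdot> v = v' \<cdot> b"
    and z: "v \<cdot> u = ZeroA T X Z"
  shows "v' \<cdot> u' = ZeroA T X' Z'"
proof -
  have "v' \<cdot> u' = v' \<cdot> (b \<cdot> (b' \<cdot> u'))" using Cmp_assoc[OF b b'(1) u(2)] b' u(2) by simp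
  also have "\<dots> = (c \<cdot> v) \<cdot> (u \<cdot> a')"
    using Cmp_assoc[OF v(2) b Cmp_in[OF b'(1) u(2)]] sq by simp
  also have "\<dots> = c \<cdot> ((v \<cdot> u) \<cdot> a')"
    using Cmp_assoc[OF c v(1) Cmp_in[OF u(1) a']] Cmp_assoc[OF v(1) u(1) a'] by simp
  also have "\<dots> = ZeroA T X' Z'" using z Zero_left[OF a'] Zero_right[OF c] Homs_Obj[OF a'] Homs_Obj[OF c] by simp
  finally show ?thesis .
qed

lemma exact_triangle_iso:
  assumes ex: "exact_triangle T w u v" and iso: "triangle_iso T (w, u, v) (w', u', v')"
    and shape: "triangle_shape T (w', u', v')"
  shows "exact_triangle T w' u' v'"
proof -
  have sh: "triangle_shape T (w, u, v)" using ex unfolding exact_triangle_def by blast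
  obtain X Y Z X' Y' Z' a b c a' b' c' where
    h: "w \<in> Homs T (Desusp T Z) X" "u \<in> Homs T X Y" "v \<in> Homs T Y Z"
    "w' \<in> Homs T (Desusp T Z') X'" "u' \<in> Homs T X' Y'" "v' \<in> Homs T Y' Z'" and
    m: "a \<in> Homs T X X'" "b \<in> Homs T Y Y'" "c \<in> Homs T Z Z'"
    "a' \<in> Homs T X' X" "b' \<in> Homs T Y' Y" "c' \<in> Homs T Z' Z" and
    i: "a' \<cdot> a = Ide T X" "b' \<cdot> b = Ide T Y" "c' \<cdot> c = Ide T Z"
    "a \<cdot> a' = Ide T X'" "b \<cdot> b' = Ide T Y'" "c \<cdot> c' = Ide T Z'" and
    e: "a \<cdot> w = w' \<cdot> DesuspA T c" "b \<cdot> u = u' \<cdot> a" "c \<cdot> v = v' \<cdot> b"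
    using triangle_isoE[OF iso sh shape] .
  note D = Homs_Dom[OF h(2)] Homs_Dom[OF h(3)] Homs_Cod[OF h(3)]
    Homs_Dom[OF h(5)] Homs_Dom[OF h(6)] Homs_Cod[OF h(6)]
  have eu: "u \<cdot> a' = b' \<cdot> u'" by (rule iso_square[OF h(2,5) m(1,2,4,5) i(4,2) e(2)])
  have ev: "v \<cdot> b' = c' \<cdot> v'" by (rule iso_square[OF h(3,6) m(2,3,5,6) i(5,3) e(3)])
  let ?D = "DesuspA T"
  note O = Homs_Obj[OF h(2)] Homs_Obj[OF h(3)] Homs_Obj[OF h(5)] Homs_Obj[OF h(6)]
  have Di: "?D b \<cdot> ?D b' = Ide T (Desusp T Y')" "?D c \<cdot> ?D c' = Ide T (Desusp T Z')"
    "?D c' \<cdot> ?D c = Ide T (Desusp T Z)"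
    using DesuspA_Cmp[OF m(2,5)] DesuspA_Cmp[OF m(3,6)] DesuspA_Cmp[OF m(6,3)] i O DesuspA_Ide by simp_all
  have De: "?D b \<cdot> ?D u = ?D u' \<cdot> ?D a" "?D c \<cdot> ?D v = ?D v' \<cdot> ?D b" "?D v \<cdot> ?D b' = ?D c' \<cdot> ?D v'"
    using DesuspA_Cmp[OF m(2) h(2)] DesuspA_Cmp[OF h(5) m(1)] DesuspA_Cmp[OF m(3) h(3)]
      DesuspA_Cmp[OF h(6) m(2)] DesuspA_Cmp[OF h(3) m(5)] DesuspA_Cmp[OF m(6) h(6)] e ev by simp_all
  note Dh = DesuspA_in[OF h(2)] DesuspA_in[OF h(3)] DesuspA_in[OF h(5)] DesuspA_in[OF h(6)]
  note Dm = DesuspA_in[OF m(1)] DesuspA_in[OF m(2)] DesuspA_in[OF m(3)]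
    DesuspA_in[OF m(4)] DesuspA_in[OF m(5)] DesuspA_in[OF m(6)]
  note E = ex[unfolded exact_triangle_def D]
  show ?thesis unfolding exact_triangle_def D
  proof (intro conjI allI impI)
    show "triangle_shape T (w', u', v')" by fact
    show "v' \<cdot> u' = ZeroA T X' Z'"
      using zero_composite_iso[OF h(2,5,3,6) m(4,2,5) i(5) m(3) eu e(3)] E by blast
    show "w' \<cdot> ?D v' = ZeroA T (Desusp T Y') X'"
      using zero_composite_iso[OF Dh(2,4) h(1,4) Dm(5,3,6) Di(2) m(1) De(3) e(1)] E by blast
  next
    fix S t assume "t \<in> Homs T S Y' \<and> v' \<cdot> t = ZeroA T S Z'"
    then show "\<exists>r\<in>Homs T S X'. t = u' \<cdot> r"
      using weak_kernel_iso[OF h(2,5,3,6) m(1,2,5) i(5) m(6) e(2) ev, of S t] E by blast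
  next
    fix S r assume r: "r \<in> Homs T X' S \<and> r \<cdot> w' = ZeroA T (Desusp T Z') S"
    show "\<exists>q\<in>Homs T Y' S. r = q \<cdot> u'"
      by (rule weak_cokernel_iso[OF h(1,4,2,5) Dm(3) m(1,4) i(4) m(5) e(1) eu]) (use E r in blast)+
  next
    fix S r assume r: "r \<in> Homs T Y' S \<and> r \<cdot> u' = ZeroA T X' S"
    show "\<exists>q\<in>Homs T Z' S. r = q \<cdot> v'"
      by (rule weak_cokernel_iso[OF h(2,5,3,6) m(1,2,5) i(5) m(6) e(2) ev]) (use E r in blast)+
  next
    fix S r assume r: "r \<in> Homs T (Desusp T Y') S \<and> r \<cdot> ?D u' = ZeroA T (Desusp T X') S"
    show "\<exists>q\<in>Homs T (Desusp T Z') S. r = q \<cdot> ?D v'"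
      by (rule weak_cokernel_iso[OF Dh(1,3,2,4) Dm(1,2,5) Di(1) Dm(6) De(1,3)]) (use E r in blast)+
  qed
qed

text \<open>The parameter \<open>C\<close> stands for any further property of the two arrows of the new triangle.\<close>

lemma weak_base_change_iso:
  assumes iso: "triangle_iso T (w, u, v) (w', u', v')"
    and sh: "triangle_shape T (w, u, v)" "triangle_shape T (w', u', v')"
    and s: "s \<in> Homs T S (Cod T v')"
    and bc: "\<And>s. s \<in> Homs T S (Cod T v) \<Longrightarrow> \<exists>u1 v1 e. C u1 v1 \<and> weak_base_change T u v s u1 v1 e"
  shows "\<exists>u1 v1 e. C u1 v1 \<and> weak_base_change T u' v' s u1 v1 e"
proof -
  obtain X Y Z X' Y' Z' a b c a' b' c' where
    h: "w \<in> Homs T (Desusp T Z) X" "u \<in> Homs T X Y" "v \<in> Homs T Y Z"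
    "w' \<in> Homs T (Desusp T Z') X'" "u' \<in> Homs T X' Y'" "v' \<in> Homs T Y' Z'" and
    m: "a \<in> Homs T X X'" "b \<in> Homs T Y Y'" "c \<in> Homs T Z Z'"
    "a' \<in> Homs T X' X" "b' \<in> Homs T Y' Y" "c' \<in> Homs T Z' Z" and
    i: "a' \<cdot> a = Ide T X" "b' \<cdot> b = Ide T Y" "c' \<cdot> c = Ide T Z"
    "a \<cdot> a' = Ide T X'" "b \<cdot> b' = Ide T Y'" "c \<cdot> c' = Ide T Z'" and
    e: "a \<cdot> w = w' \<cdot> DesuspA T c" "b \<cdot> u = u' \<cdot> a" "c \<cdot> v = v' \<cdot> b"
    using triangle_isoE[OF iso sh] .
  note D = Homs_Dom[OF h(2)] Homs_Cod[OF h(2)] Homs_Cod[OF h(3)]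
    Homs_Dom[OF h(5)] Homs_Cod[OF h(5)] Homs_Cod[OF h(6)]
  have s: "s \<in> Homs T S Z'" using s D by simp
  define s0 where "s0 = c' \<cdot> s"
  have s0: "s0 \<in> Homs T S Z" unfolding s0_def using Cmp_in[OF m(6) s] .
  have ev: "v \<cdot> b' = c' \<cdot> v'" by (rule iso_square[OF h(3,6) m(2,3,5,6) i(5,3) e(3)])
  obtain u1 v1 f where C: "C u1 v1" and w: "weak_base_change T u v s0 u1 v1 f"
    using bc s0 D by metis
  define E where "E = Cod T u1"
  note w = w[unfolded weak_base_change_def D Homs_Dom[OF s0] E_def[symmetric]]
  have f: "f \<in> Homs T E Y" using w by blast
  have bf: "b \<cdot> f \<in> Homs T E Y'" using Cmp_in[OF m(2) f] .
  have "isomorphic_in T (Dom T u1) X'"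
  proof -
    obtain p where p: "p \<in> Homs T (Dom T u1) X" "iso_arr T p"
      using w unfolding isomorphic_in_def by blast
    obtain q where q: "q \<in> Homs T X (Dom T u1)" "q \<cdot> p = Ide T (Dom T u1)" "p \<cdot> q = Ide T X"
      using iso_arrE[OF p(2,1)] .
    have "(q \<cdot> a') \<cdot> (a \<cdot> p) = q \<cdot> ((a' \<cdot> a) \<cdot> p)"
      using Cmp_assoc[OF q(1) m(4) Cmp_in[OF m(1) p(1)]] Cmp_assoc[OF m(4,1) p(1)] by simp
    then have 1: "(q \<cdot> a') \<cdot> (a \<cdot> p) = Ide T (Dom T u1)" using i p q by simp
    have "(a \<cdot> p) \<cdot> (q \<cdot> a') = a \<cdot> ((p \<cdot> q) \<cdot> a')"
      using Cmp_assoc[OF m(1) p(1) Cmp_in[OF q(1) m(4)]] Cmp_assoc[OF p(1) q(1) m(4)] by simp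
    then have 2: "(a \<cdot> p) \<cdot> (q \<cdot> a') = Ide T X'" using i m q by simp
    have ap: "a \<cdot> p \<in> Homs T (Dom T u1) X'" and qa: "q \<cdot> a' \<in> Homs T X' (Dom T u1)"
      using Cmp_in m p q by blast+
    then have "iso_arr T (a \<cdot> p)"
      unfolding iso_arr_def Homs_Dom[OF ap] Homs_Cod[OF ap] using 1 2 Homs_Arr by blast
    then show ?thesis unfolding isomorphic_in_def using ap by blast
  qed
  moreover have "\<exists>y \<in> Homs T Q E. t = (b \<cdot> f) \<cdot> y"
    if t: "t \<in> Homs T Q Y'" "r \<in> Homs T Q S" "v' \<cdot> t = s \<cdot> r" for Q t r
  proof -
    have "v \<cdot> (b' \<cdot> t) = c' \<cdot> (v' \<cdot> t)"
      using Cmp_assoc[OF h(3) m(5) t(1)] Cmp_assoc[OF m(6) h(6) t(1)] ev by simp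
    also have "\<dots> = s0 \<cdot> r" unfolding s0_def using t(3) Cmp_assoc[OF m(6) s t(2)] by simp
    finally obtain y where y: "y \<in> Homs T Q E" "b' \<cdot> t = f \<cdot> y"
      using w Cmp_in[OF m(5) t(1)] t(2) by blast
    have "t = b \<cdot> (b' \<cdot> t)" using Cmp_assoc[OF m(2,5) t(1)] i t by simp
    then have "t = (b \<cdot> f) \<cdot> y" using y(2) Cmp_assoc[OF m(2) f y(1)] by simp
    then show ?thesis using y(1) by blast
  qed
  moreover have "\<exists>r \<in> Homs T Z' Q. k = r \<cdot> v' \<and> r \<cdot> s = ZeroA T S Q"
    if k: "k \<in> Homs T Y' Q" "k \<cdot> (b \<cdot> f) = ZeroA T E Q" for Q k
  proof -
    have "(k \<cdot> b) \<cdot> f = ZeroA T E Q" using Cmp_assoc[OF k(1) m(2) f] k(2) by simp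
    then obtain r where r: "r \<in> Homs T Z Q" "k \<cdot> b = r \<cdot> v" "r \<cdot> s0 = ZeroA T S Q"
      using w Cmp_in[OF k(1) m(2)] by blast
    have "k = (k \<cdot> b) \<cdot> b'" using Cmp_assoc[OF k(1) m(2,5)] i k by simp
    also have "\<dots> = r \<cdot> (c' \<cdot> v')" using r(2) Cmp_assoc[OF r(1) h(3) m(5)] ev by simp
    also have "\<dots> = (r \<cdot> c') \<cdot> v'" using Cmp_assoc[OF r(1) m(6) h(6)] by simp
    finally have "k = (r \<cdot> c') \<cdot> v'" .
    moreover have "(r \<cdot> c') \<cdot> s = ZeroA T S Q" using Cmp_assoc[OF r(1) m(6) s] r(3) s0_def by simp
    ultimately show ?thesis using Cmp_in[OF r(1) m(6)] by blast
  qed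
  moreover have "Cod T v1 = S" using w by blast
  ultimately have "weak_base_change T u' v' s u1 v1 (b \<cdot> f)"
    unfolding weak_base_change_def D Homs_Dom[OF s] E_def[symmetric] using bf by blast
  then show ?thesis using C by blast
qed

end

section \<open>Left modules and linear relations\<close>

text \<open>The linear maps of the stable category are confined to one carrier type. This variant allows
  two types, so that products and spaces of maps can be handled before they are transported.\<close>

definition lin :: "('r, 'x) ring_scheme \<Rightarrow> ('r, 'a, 'y) module_scheme \<Rightarrow> ('r, 'b, 'z) module_scheme
    \<Rightarrow> ('a \<Rightarrow> 'b) set" where
  "lin R M N = {f \<in> carrier M \<rightarrow>\<^sub>E carrier N.
     (\<forall>x \<in> carrier M. \<forall>y \<in> carrier M. f (x \<oplus>\<^bsub>M\<^esub> y) = f x \<oplus>\<^bsub>N\<^esub> f y) \<and>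
     (\<forall>a \<in> carrier R. \<forall>x \<in> carrier M. f (a \<odot>\<^bsub>M\<^esub> x) = a \<odot>\<^bsub>N\<^esub> f x)}"

lemma lin_maps_eq_lin: "lin_maps R M N = lin R M N"
  by (simp add: lin_maps_def lin_def)

lemma linI:
  assumes "\<And>x. x \<in> carrier M \<Longrightarrow> f x \<in> carrier N"
    and "\<And>x y. \<lbrakk>x \<in> carrier M; y \<in> carrier M\<rbrakk> \<Longrightarrow> f (x \<oplus>\<^bsub>M\<^esub> y) = f x \<oplus>\<^bsub>N\<^esub> f y"
    and "\<And>a x. \<lbrakk>a \<in> carrier R; x \<in> carrier M\<rbrakk> \<Longrightarrow> f (a \<odot>\<^bsub>M\<^esub> x) = a \<odot>\<^bsub>N\<^esub> f x"
    and "f \<in> extensional (carrier M)"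
  shows "f \<in> lin R M N"
  using assms by (auto simp: lin_def PiE_def)

lemma lin_closed: "\<lbrakk>f \<in> lin R M N; x \<in> carrier M\<rbrakk> \<Longrightarrow> f x \<in> carrier N"
  and lin_add: "\<lbrakk>f \<in> lin R M N; x \<in> carrier M; y \<in> carrier M\<rbrakk> \<Longrightarrow>
        f (x \<oplus>\<^bsub>M\<^esub> y) = f x \<oplus>\<^bsub>N\<^esub> f y"
  and lin_smult: "\<lbrakk>f \<in> lin R M N; a \<in> carrier R; x \<in> carrier M\<rbrakk> \<Longrightarrow>
        f (a \<odot>\<^bsub>M\<^esub> x) = a \<odot>\<^bsub>N\<^esub> f x"
  and lin_extensional: "f \<in> lin R M N \<Longrightarrow> f \<in> extensional (carrier M)"
  by (auto simp: lin_def PiE_def)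

lemmas lin_simps = lin_closed lin_add lin_smult

lemma lin_eqI:
  assumes "f \<in> lin R M N" "g \<in> lin R M N'" "\<And>x. x \<in> carrier M \<Longrightarrow> f x = g x"
  shows "f = g"
  using assms lin_extensional extensionalityI by metis

context left_module
begin

lemma smult_zero_left: "x \<in> carrier M \<Longrightarrow> \<zero> \<odot>\<^bsub>M\<^esub> x = \<zero>\<^bsub>M\<^esub>"
  using smult_l_distr[of "\<zero>" "\<zero>" x] smult_closed[of "\<zero>" x]
  by (metis R.l_zero R.zero_closed M.add.r_cancel_one')

lemma smult_neg_one: "x \<in> carrier M \<Longrightarrow> (\<ominus> \<one>) \<odot>\<^bsub>M\<^esub> x = \<ominus>\<^bsub>M\<^esub> x"
  using smult_l_distr[of "\<ominus> \<one>" "\<one>" x] smult_closed[of "\<ominus> \<one>" x] smult_zero_left[of x]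
    smult_one[of x] by (simp add: R.l_neg M.minus_equality)

lemma smult_zero_right: "a \<in> carrier R \<Longrightarrow> a \<odot>\<^bsub>M\<^esub> \<zero>\<^bsub>M\<^esub> = \<zero>\<^bsub>M\<^esub>"
  using smult_r_distr[of a "\<zero>\<^bsub>M\<^esub>" "\<zero>\<^bsub>M\<^esub>"] smult_closed[of a "\<zero>\<^bsub>M\<^esub>"]
  by (metis M.l_zero M.zero_closed M.add.r_cancel_one')

lemma smult_minus: "\<lbrakk>a \<in> carrier R; x \<in> carrier M\<rbrakk> \<Longrightarrow> a \<odot>\<^bsub>M\<^esub> (\<ominus>\<^bsub>M\<^esub> x) = \<ominus>\<^bsub>M\<^esub> (a \<odot>\<^bsub>M\<^esub> x)"
  using smult_r_distr[of a "\<ominus>\<^bsub>M\<^esub> x" x] smult_closed smult_zero_right[of a]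
  by (simp add: M.l_neg M.minus_equality)

lemma diff_zero_iff: "\<lbrakk>x \<in> carrier M; y \<in> carrier M\<rbrakk> \<Longrightarrow> x \<ominus>\<^bsub>M\<^esub> y = \<zero>\<^bsub>M\<^esub> \<longleftrightarrow> x = y"
  by (metis a_minus_def M.add.inv_closed M.minus_equality M.minus_minus M.r_neg)

lemma diff_add_cancel: "\<lbrakk>x \<in> carrier M; y \<in> carrier M\<rbrakk> \<Longrightarrow> (x \<ominus>\<^bsub>M\<^esub> y) \<oplus>\<^bsub>M\<^esub> y = x"
  by (simp add: a_minus_def M.a_assoc M.l_neg)

lemma add_diff_cancel: "\<lbrakk>x \<in> carrier M; y \<in> carrier M\<rbrakk> \<Longrightarrow> (x \<oplus>\<^bsub>M\<^esub> y) \<ominus>\<^bsub>M\<^esub> y = x"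
  by (simp add: a_minus_def M.a_assoc M.r_neg)

lemma add_diff_add:
  "\<lbrakk>a \<in> carrier M; b \<in> carrier M; c \<in> carrier M; d \<in> carrier M\<rbrakk> \<Longrightarrow>
   (a \<oplus>\<^bsub>M\<^esub> b) \<ominus>\<^bsub>M\<^esub> (c \<oplus>\<^bsub>M\<^esub> d) = (a \<ominus>\<^bsub>M\<^esub> c) \<oplus>\<^bsub>M\<^esub> (b \<ominus>\<^bsub>M\<^esub> d)"
  by (simp add: a_minus_def M.minus_add M.a_ac)

lemma add_add_add:
  "\<lbrakk>a \<in> carrier M; b \<in> carrier M; c \<in> carrier M; d \<in> carrier M\<rbrakk> \<Longrightarrow>
   (a \<oplus>\<^bsub>M\<^esub> b) \<oplus>\<^bsub>M\<^esub> (c \<oplus>\<^bsub>M\<^esub> d) = (a \<oplus>\<^bsub>M\<^esub> c) \<oplus>\<^bsub>M\<^esub> (b \<oplus>\<^bsub>M\<^esub> d)"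
  by (simp add: M.a_ac)

lemma smult_diff:
  "\<lbrakk>a \<in> carrier R; x \<in> carrier M; y \<in> carrier M\<rbrakk> \<Longrightarrow>
   a \<odot>\<^bsub>M\<^esub> (x \<ominus>\<^bsub>M\<^esub> y) = (a \<odot>\<^bsub>M\<^esub> x) \<ominus>\<^bsub>M\<^esub> (a \<odot>\<^bsub>M\<^esub> y)"
  by (simp add: a_minus_def smult_r_distr smult_minus smult_closed)

lemma submodule_left_module:
  assumes S: "S \<subseteq> carrier M" "\<zero>\<^bsub>M\<^esub> \<in> S"
    and add: "\<And>x y. \<lbrakk>x \<in> S; y \<in> S\<rbrakk> \<Longrightarrow> x \<oplus>\<^bsub>M\<^esub> y \<in> S"
    and smult: "\<And>a x. \<lbrakk>a \<in> carrier R; x \<in> S\<rbrakk> \<Longrightarrow> a \<odot>\<^bsub>M\<^esub> x \<in> S"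
  shows "left_module R (M\<lparr>carrier := S\<rparr>)"
proof -
  have neg: "\<exists>y\<in>S. y \<oplus>\<^bsub>M\<^esub> x = \<zero>\<^bsub>M\<^esub>" if "x \<in> S" for x
  proof -
    have "x \<in> carrier M" using that S by blast
    then show ?thesis
      using smult[of "\<ominus> \<one>" x] that smult_neg_one[of x] M.l_neg[of x] by auto
  qed
  have "abelian_group (M\<lparr>carrier := S\<rparr>)"
    using S add neg by (intro abelian_groupI) (auto simp: M.a_assoc subset_iff intro: M.a_comm)
  then show ?thesis
    using S add smult
    by (intro left_module.intro left_module_axioms.intro R.ring_axioms)
      (auto simp: smult_l_distr smult_r_distr smult_assoc smult_one subset_iff)
qed

end

lemma left_moduleI:
  assumes "ring R"
    and "\<And>x y. \<lbrakk>x \<in> carrier M; y \<in> carrier M\<rbrakk> \<Longrightarrow> x \<oplus>\<^bsub>M\<^esub> y \<in> carrier M"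
    and "\<zero>\<^bsub>M\<^esub> \<in> carrier M"
    and "\<And>x y z. \<lbrakk>x \<in> carrier M; y \<in> carrier M; z \<in> carrier M\<rbrakk> \<Longrightarrow>
           (x \<oplus>\<^bsub>M\<^esub> y) \<oplus>\<^bsub>M\<^esub> z = x \<oplus>\<^bsub>M\<^esub> (y \<oplus>\<^bsub>M\<^esub> z)"
    and "\<And>x y. \<lbrakk>x \<in> carrier M; y \<in> carrier M\<rbrakk> \<Longrightarrow> x \<oplus>\<^bsub>M\<^esub> y = y \<oplus>\<^bsub>M\<^esub> x"
    and "\<And>x. x \<in> carrier M \<Longrightarrow> \<zero>\<^bsub>M\<^esub> \<oplus>\<^bsub>M\<^esub> x = x"
    and "\<And>x. x \<in> carrier M \<Longrightarrow> \<exists>y \<in> carrier M. y \<oplus>\<^bsub>M\<^esub> x = \<zero>\<^bsub>M\<^esub>"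
    and "\<And>a x. \<lbrakk>a \<in> carrier R; x \<in> carrier M\<rbrakk> \<Longrightarrow> a \<odot>\<^bsub>M\<^esub> x \<in> carrier M"
    and "\<And>a b x. \<lbrakk>a \<in> carrier R; b \<in> carrier R; x \<in> carrier M\<rbrakk> \<Longrightarrow>
           (a \<oplus>\<^bsub>R\<^esub> b) \<odot>\<^bsub>M\<^esub> x = a \<odot>\<^bsub>M\<^esub> x \<oplus>\<^bsub>M\<^esub> b \<odot>\<^bsub>M\<^esub> x"
    and "\<And>a x y. \<lbrakk>a \<in> carrier R; x \<in> carrier M; y \<in> carrier M\<rbrakk> \<Longrightarrow>
           a \<odot>\<^bsub>M\<^esub> (x \<oplus>\<^bsub>M\<^esub> y) = a \<odot>\<^bsub>M\<^esub> x \<oplus>\<^bsub>M\<^esub> a \<odot>\<^bsub>M\<^esub> y"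
    and "\<And>a b x. \<lbrakk>a \<in> carrier R; b \<in> carrier R; x \<in> carrier M\<rbrakk> \<Longrightarrow>
           (a \<otimes>\<^bsub>R\<^esub> b) \<odot>\<^bsub>M\<^esub> x = a \<odot>\<^bsub>M\<^esub> (b \<odot>\<^bsub>M\<^esub> x)"
    and "\<And>x. x \<in> carrier M \<Longrightarrow> \<one>\<^bsub>R\<^esub> \<odot>\<^bsub>M\<^esub> x = x"
  shows "left_module R M"
proof (intro left_module.intro left_module_axioms.intro)
  show "abelian_group M" using assms(2-7) by (rule abelian_groupI)
qed (use assms in simp_all)

lemma lin_zero:
  assumes "left_module R M" "left_module R N" "f \<in> lin R M N"
  shows "f \<zero>\<^bsub>M\<^esub> = \<zero>\<^bsub>N\<^esub>"
proof -
  interpret M: left_module R M by fact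
  interpret N: left_module R N by fact
  show ?thesis
    using lin_add[OF assms(3), of "\<zero>\<^bsub>M\<^esub>" "\<zero>\<^bsub>M\<^esub>"] lin_closed[OF assms(3), of "\<zero>\<^bsub>M\<^esub>"]
    by (metis M.l_zero M.zero_closed N.add.r_cancel_one')
qed

lemma lin_neg:
  assumes "left_module R M" "left_module R N" "f \<in> lin R M N" "x \<in> carrier M"
  shows "f (\<ominus>\<^bsub>M\<^esub> x) = \<ominus>\<^bsub>N\<^esub> f x"
proof -
  interpret M: left_module R M by fact
  interpret N: left_module R N by fact
  show ?thesis
    using lin_smult[OF assms(3), of "\<ominus>\<^bsub>R\<^esub> \<one>\<^bsub>R\<^esub>" x] M.smult_neg_one N.smult_neg_one
      lin_closed[OF assms(3)] assms(4) by simp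
qed

lemma lin_diff:
  assumes "left_module R M" "left_module R N" "f \<in> lin R M N" "x \<in> carrier M" "y \<in> carrier M"
  shows "f (x \<ominus>\<^bsub>M\<^esub> y) = f x \<ominus>\<^bsub>N\<^esub> f y"
proof -
  interpret M: left_module R M by fact
  show ?thesis using assms lin_add[OF assms(3)] lin_neg[OF assms(1-3)] by (simp add: a_minus_def)
qed

lemma lin_compose:
  assumes "left_module R L" "f \<in> lin R L M" "g \<in> lin R M N"
  shows "compose (carrier L) g f \<in> lin R L N"
proof -
  interpret left_module R L by fact
  show ?thesis
    using lin_simps[OF assms(2)] lin_simps[OF assms(3)]
    by (intro linI) (auto simp: compose_def smult_closed)
qed

lemma lin_id:
  assumes "left_module R M"
  shows "(\<lambda>x \<in> carrier M. x) \<in> lin R M M"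
proof -
  interpret left_module R M by fact
  show ?thesis by (intro linI) (auto simp: smult_closed)
qed

lemma lin_inclusion:
  assumes "left_module R (M\<lparr>carrier := S\<rparr>)" "S \<subseteq> carrier M"
  shows "(\<lambda>x \<in> S. x) \<in> lin R (M\<lparr>carrier := S\<rparr>) M"
proof -
  interpret M': left_module R "M\<lparr>carrier := S\<rparr>" by fact
  show ?thesis using M'.a_closed M'.smult_closed assms(2) by (intro linI) auto
qed

lemma lin_const_zero:
  assumes "left_module R M" "left_module R N"
  shows "(\<lambda>x \<in> carrier M. \<zero>\<^bsub>N\<^esub>) \<in> lin R M N"
proof -
  interpret M: left_module R M by fact
  interpret N: left_module R N by fact
  show ?thesis by (intro linI) (auto simp: M.smult_closed N.smult_zero_right)
qed

lemma lin_plus: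
  assumes "left_module R M" "left_module R N" "f \<in> lin R M N" "g \<in> lin R M N"
  shows "(\<lambda>x \<in> carrier M. f x \<oplus>\<^bsub>N\<^esub> g x) \<in> lin R M N"
proof -
  interpret M: left_module R M by fact
  interpret N: left_module R N by fact
  show ?thesis
    using lin_simps[OF assms(3)] lin_simps[OF assms(4)]
    by (intro linI) (auto simp: M.smult_closed N.smult_r_distr N.add_add_add)
qed

lemma lin_minus:
  assumes "left_module R M" "left_module R N" "f \<in> lin R M N" "g \<in> lin R M N"
  shows "(\<lambda>x \<in> carrier M. f x \<ominus>\<^bsub>N\<^esub> g x) \<in> lin R M N"
proof -
  interpret M: left_module R M by fact
  interpret N: left_module R N by fact
  show ?thesis
    using lin_simps[OF assms(3)] lin_simps[OF assms(4)]
    by (intro linI) (auto simp: M.smult_closed N.smult_diff N.add_diff_add)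
qed

text \<open>Maps are mostly constructed from an additive relation: a submodule of \<open>C \<times> Z\<close> that projects onto
  \<open>C\<close> is the graph of a linear map as soon as its fibre over zero is trivial. This replaces choosing
  representatives and proving independence of the choice.\<close>

lemma lin_of_relation:
  assumes C: "left_module R C" and Z: "left_module R Z"
    and D: "\<And>c z. D c z \<Longrightarrow> c \<in> carrier C \<and> z \<in> carrier Z"
    and total: "\<And>c. c \<in> carrier C \<Longrightarrow> \<exists>z. D c z"
    and add: "\<And>c z c' z'. \<lbrakk>D c z; D c' z'\<rbrakk> \<Longrightarrow> D (c \<oplus>\<^bsub>C\<^esub> c') (z \<oplus>\<^bsub>Z\<^esub> z')"
    and smult: "\<And>a c z. \<lbrakk>a \<in> carrier R; D c z\<rbrakk> \<Longrightarrow> D (a \<odot>\<^bsub>C\<^esub> c) (a \<odot>\<^bsub>Z\<^esub> z)"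
    and zero: "\<And>z. D \<zero>\<^bsub>C\<^esub> z \<Longrightarrow> z = \<zero>\<^bsub>Z\<^esub>"
  obtains f where "f \<in> lin R C Z" "\<And>c z. D c z \<Longrightarrow> f c = z" "\<And>c. c \<in> carrier C \<Longrightarrow> D c (f c)"
proof -
  interpret C: left_module R C by fact
  interpret Z: left_module R Z by fact
  have uniq: "z = z'" if "D c z" "D c z'" for c z z'
  proof -
    have "D (\<ominus>\<^bsub>C\<^esub> c) (\<ominus>\<^bsub>Z\<^esub> z')"
      using smult[OF _ that(2), of "\<ominus>\<^bsub>R\<^esub> \<one>\<^bsub>R\<^esub>"] D[OF that(2)] C.smult_neg_one Z.smult_neg_one by simp
    then have "D \<zero>\<^bsub>C\<^esub> (z \<ominus>\<^bsub>Z\<^esub> z')"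
      using add[OF that(1), of "\<ominus>\<^bsub>C\<^esub> c"] D[OF that(1)] C.r_neg by (simp add: a_minus_def)
    then show ?thesis using zero Z.diff_zero_iff D that by blast
  qed
  define f where "f = (\<lambda>c \<in> carrier C. THE z. D c z)"
  have f: "D c (f c)" if "c \<in> carrier C" for c
  proof -
    have "\<exists>!z. D c z" using total[OF that] uniq by blast
    then show ?thesis unfolding f_def using that by (simp add: theI')
  qed
  then have fz: "f c = z" if "D c z" for c z using uniq that D by blast
  have "f \<in> lin R C Z"
    using D[OF f] fz[OF add[OF f f]] fz[OF smult[OF _ f]] by (intro linI) (auto simp: f_def)
  then show thesis using that f fz by blast
qed

lemma lin_descend:
  assumes B: "left_module R B" and C: "left_module R C" and Z: "left_module R Z"
    and g: "g \<in> lin R B C" "g ` carrier B = carrier C" and h: "h \<in> lin R B Z"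
    and ker: "\<And>b. \<lbrakk>b \<in> carrier B; g b = \<zero>\<^bsub>C\<^esub>\<rbrakk> \<Longrightarrow> h b = \<zero>\<^bsub>Z\<^esub>"
  shows "\<exists>f \<in> lin R C Z. \<forall>b \<in> carrier B. f (g b) = h b"
proof -
  interpret B: left_module R B by fact
  have add: "\<exists>b\<in>carrier B. c = g b \<and> z = h b" if "c = g b1 \<oplus>\<^bsub>C\<^esub> g b2 \<and> z = h b1 \<oplus>\<^bsub>Z\<^esub> h b2"
    "b1 \<in> carrier B" "b2 \<in> carrier B" for c z b1 b2
    using that by (intro bexI[of _ "b1 \<oplus>\<^bsub>B\<^esub> b2"]) (auto simp: lin_simps[OF g(1)] lin_simps[OF h])
  have sm: "\<exists>b\<in>carrier B. c = g b \<and> z = h b" if "c = a \<odot>\<^bsub>C\<^esub> g b1 \<and> z = a \<odot>\<^bsub>Z\<^esub> h b1"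
    "b1 \<in> carrier B" "a \<in> carrier R" for c z b1 a
    using that by (intro bexI[of _ "a \<odot>\<^bsub>B\<^esub> b1"])
      (auto simp: lin_simps[OF g(1)] lin_simps[OF h] B.smult_closed)
  show ?thesis
  proof (rule lin_of_relation[OF C Z, where D="\<lambda>c z. \<exists>b\<in>carrier B. c = g b \<and> z = h b"], goal_cases)
    case (1 c z) then show ?case using lin_closed[OF g(1)] lin_closed[OF h] by blast
  next
    case (2 c) then show ?case using g(2) by blast
  next
    case (3 c z c' z') then show ?case using add by blast
  next
    case (4 a c z) then show ?case using sm by blast
  next
    case (5 z) then show ?case using ker by metis
  next
    case (6 f) then show ?case by (intro bexI[of _ f]) auto
  qed
qed

lemma lin_corestrict:
  assumes A: "left_module R A" and B: "left_module R B" and X: "left_module R X"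
    and i: "i \<in> lin R A B" "inj_on i (carrier A)" and t: "t \<in> lin R X B"
    and im: "\<And>x. x \<in> carrier X \<Longrightarrow> t x \<in> i ` carrier A"
  shows "\<exists>s \<in> lin R X A. \<forall>x \<in> carrier X. i (s x) = t x"
proof -
  interpret A: left_module R A by fact
  interpret B: left_module R B by fact
  interpret X: left_module R X by fact
  show ?thesis
  proof (rule lin_of_relation[OF X A, where D="\<lambda>x a. x \<in> carrier X \<and> a \<in> carrier A \<and> i a = t x"], goal_cases)
    case (2 x) then show ?case using im[of x] by auto
  next
    case (5 a)
    then have "i a = i \<zero>\<^bsub>A\<^esub>" using lin_zero[OF X B t] lin_zero[OF A B i(1)] by simp
    then show ?case using 5 i(2) by (meson A.zero_closed inj_onD)
  next
    case (6 f) then show ?case by (intro bexI[of _ f]) auto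
  qed (auto simp: lin_simps[OF i(1)] lin_simps[OF t] A.smult_closed X.smult_closed)
qed

definition prod_module ::
  "('r, 'a, 'y) module_scheme \<Rightarrow> ('r, 'b, 'z) module_scheme \<Rightarrow> ('r, 'a \<times> 'b) module" where
  "prod_module M N =
     \<lparr> carrier = carrier M \<times> carrier N, mult = undefined, one = undefined,
       zero = (\<zero>\<^bsub>M\<^esub>, \<zero>\<^bsub>N\<^esub>), add = (\<lambda>(x, y) (x', y'). (x \<oplus>\<^bsub>M\<^esub> x', y \<oplus>\<^bsub>N\<^esub> y')),
       smult = (\<lambda>a (x, y). (a \<odot>\<^bsub>M\<^esub> x, a \<odot>\<^bsub>N\<^esub> y)) \<rparr>"

lemma prod_module_simps [simp]:
  "carrier (prod_module M N) = carrier M \<times> carrier N"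
  "\<zero>\<^bsub>prod_module M N\<^esub> = (\<zero>\<^bsub>M\<^esub>, \<zero>\<^bsub>N\<^esub>)"
  "(x, y) \<oplus>\<^bsub>prod_module M N\<^esub> (x', y') = (x \<oplus>\<^bsub>M\<^esub> x', y \<oplus>\<^bsub>N\<^esub> y')"
  "a \<odot>\<^bsub>prod_module M N\<^esub> (x, y) = (a \<odot>\<^bsub>M\<^esub> x, a \<odot>\<^bsub>N\<^esub> y)"
  by (auto simp: prod_module_def)

lemma prod_left_module:
  assumes "left_module R M" "left_module R N"
  shows "left_module R (prod_module M N)"
proof -
  interpret M: left_module R M by fact
  interpret N: left_module R N by fact
  show ?thesis
  proof (rule left_moduleI, goal_cases)
    case 1 then show ?case by (rule M.R.ring_axioms)
  next
    case (5 x y) then show ?case using M.a_comm N.a_comm by auto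
  next
    case (7 x)
    then show ?case
      by (intro bexI[of _ "(\<ominus>\<^bsub>M\<^esub> fst x, \<ominus>\<^bsub>N\<^esub> snd x)"]) (auto simp: M.l_neg N.l_neg)
  qed (auto simp: M.a_assoc N.a_assoc M.smult_closed N.smult_closed M.smult_l_distr N.smult_l_distr
      M.smult_r_distr N.smult_r_distr M.smult_assoc N.smult_assoc M.smult_one N.smult_one)
qed

text \<open>Products and coinduced modules live on new types; a module small enough is isomorphic to one
  carried by a subset of the universe type.\<close>

lemma transport_left_module:
  fixes N :: "('r, 'n, 'y) module_scheme"
  assumes N: "left_module R N" and small: "|carrier N| <o |UNIV :: 'm set|"
  obtains N' :: "('r, 'm) module" and i j where
    "N' \<in> Mods R" "i \<in> lin R N' N" "j \<in> lin R N N'"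
    "\<And>x. x \<in> carrier N \<Longrightarrow> i (j x) = x" "\<And>y. y \<in> carrier N' \<Longrightarrow> j (i y) = y"
proof -
  interpret N: left_module R N by fact
  obtain e :: "'n \<Rightarrow> 'm" where e: "inj_on e (carrier N)"
    using ordLess_imp_ordLeq[OF small] card_of_ordLeq[of "carrier N" "UNIV :: 'm set"] by blast
  define d where "d = inv_into (carrier N) e"
  have de [simp]: "d (e x) = x" if "x \<in> carrier N" for x using e that by (simp add: d_def)
  define N' :: "('r, 'm) module" where "N' =
     \<lparr> carrier = e ` carrier N, mult = undefined, one = undefined, zero = e \<zero>\<^bsub>N\<^esub>,
       add = (\<lambda>x y. e (d x \<oplus>\<^bsub>N\<^esub> d y)), smult = (\<lambda>a x. e (a \<odot>\<^bsub>N\<^esub> d x)) \<rparr>"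
  have s: "carrier N' = e ` carrier N" "\<zero>\<^bsub>N'\<^esub> = e \<zero>\<^bsub>N\<^esub>" "\<And>x y. x \<oplus>\<^bsub>N'\<^esub> y = e (d x \<oplus>\<^bsub>N\<^esub> d y)"
    "\<And>a x. a \<odot>\<^bsub>N'\<^esub> x = e (a \<odot>\<^bsub>N\<^esub> d x)" by (auto simp: N'_def)
  have "left_module R N'"
  proof (rule left_moduleI, goal_cases)
    case 1 then show ?case by (rule N.R.ring_axioms)
  next
    case (5 x y) then show ?case using N.a_comm by (auto simp: s)
  next
    case (7 x)
    then show ?case by (intro bexI[of _ "e (\<ominus>\<^bsub>N\<^esub> d x)"]) (auto simp: s N.l_neg)
  qed (auto simp: s N.a_assoc N.smult_closed N.smult_l_distr N.smult_r_distr N.smult_assoc N.smult_one)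
  moreover have "|carrier N'| <o |UNIV :: 'm set|"
    unfolding s using ordLeq_ordLess_trans[OF card_of_image small] .
  ultimately have "N' \<in> Mods R" by (simp add: Mods_def)
  moreover have d: "restrict d (carrier N') \<in> lin R N' N"
    by (intro linI) (auto simp: s N.smult_closed inj_on_eq_iff[OF e])
  moreover have "restrict e (carrier N) \<in> lin R N N'"
    by (intro linI) (auto simp: s N.smult_closed)
  moreover have "restrict d (carrier N') (restrict e (carrier N) x) = x" if "x \<in> carrier N" for x
    using that by (simp add: s)
  moreover have "restrict e (carrier N) (restrict d (carrier N') y) = y" if "y \<in> carrier N'" for y
    using that by (auto simp: s)
  ultimately show thesis using that by blast
qed

section \<open>Projective modules over a group algebra are injective\<close>

text \<open>By Zorn's lemma there is a subspace \<open>C\<close> of \<open>B\<close> maximal among those meeting \<open>i(A)\<close> trivially.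
  It is a complement: a vector \<open>b\<close> outside \<open>i(A) + C\<close> could be added to \<open>C\<close>. The retraction is the
  projection along \<open>C\<close>.\<close>

lemma vector_space_retraction:
  assumes k: "field k" and A: "left_module k A" and B: "left_module k B"
    and i: "i \<in> lin k A B" "inj_on i (carrier A)"
  obtains r where "r \<in> lin k B A" "\<And>a. a \<in> carrier A \<Longrightarrow> r (i a) = a"
proof -
  interpret k: field k by fact
  interpret A: left_module k A by fact
  interpret B: left_module k B by fact
  define sub where "sub C \<longleftrightarrow> C \<subseteq> carrier B \<and> \<zero>\<^bsub>B\<^esub> \<in> C \<and> (\<forall>x\<in>C. \<forall>y\<in>C. x \<oplus>\<^bsub>B\<^esub> y \<in> C) \<and>
    (\<forall>a\<in>carrier k. \<forall>x\<in>C. a \<odot>\<^bsub>B\<^esub> x \<in> C)" for C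
  define \<A> where "\<A> = {C. sub C \<and> i ` carrier A \<inter> C \<subseteq> {\<zero>\<^bsub>B\<^esub>}}"
  have "{\<zero>\<^bsub>B\<^esub>} \<in> \<A>" by (auto simp: \<A>_def sub_def B.smult_zero_right)
  then have "\<A> \<noteq> {}" by blast
  moreover have "\<Union>\<C> \<in> \<A>" if "\<C> \<noteq> {}" "subset.chain \<A> \<C>" for \<C>
  proof -
    have mem: "\<And>C. C \<in> \<C> \<Longrightarrow> C \<in> \<A>" and lin: "\<And>C D. \<lbrakk>C \<in> \<C>; D \<in> \<C>\<rbrakk> \<Longrightarrow> C \<subseteq> D \<or> D \<subseteq> C"
      using that(2) unfolding subset.chain_def by (blast, force)
    have "x \<oplus>\<^bsub>B\<^esub> y \<in> \<Union>\<C>" if xy: "x \<in> \<Union>\<C>" "y \<in> \<Union>\<C>" for x y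
    proof -
      obtain C D where "C \<in> \<C>" "D \<in> \<C>" "x \<in> C" "y \<in> D" using xy by blast
      then obtain E where "E \<in> \<C>" "x \<in> E" "y \<in> E" using lin by blast
      then show ?thesis using mem unfolding \<A>_def sub_def by blast
    qed
    moreover have sub: "sub C" "i ` carrier A \<inter> C \<subseteq> {\<zero>\<^bsub>B\<^esub>}" if "C \<in> \<C>" for C
      using mem[OF that] by (auto simp: \<A>_def)
    moreover have "\<zero>\<^bsub>B\<^esub> \<in> \<Union>\<C>" using that(1) sub(1) unfolding sub_def by blast
    moreover have "\<Union>\<C> \<subseteq> carrier B" using sub(1) unfolding sub_def by blast
    moreover have "a \<odot>\<^bsub>B\<^esub> x \<in> \<Union>\<C>" if "a \<in> carrier k" "x \<in> \<Union>\<C>" for a x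
      using that sub(1) unfolding sub_def by blast
    moreover have "i ` carrier A \<inter> \<Union>\<C> \<subseteq> {\<zero>\<^bsub>B\<^esub>}" using sub(2) by blast
    ultimately show ?thesis unfolding \<A>_def sub_def by simp
  qed
  ultimately obtain C where C: "C \<in> \<A>" and max: "\<And>D. \<lbrakk>D \<in> \<A>; C \<subseteq> D\<rbrakk> \<Longrightarrow> D = C"
    using subset_Zorn_nonempty[of \<A>] by metis
  have Cs: "C \<subseteq> carrier B" "\<zero>\<^bsub>B\<^esub> \<in> C" "\<And>x y. \<lbrakk>x \<in> C; y \<in> C\<rbrakk> \<Longrightarrow> x \<oplus>\<^bsub>B\<^esub> y \<in> C"
    "\<And>a x. \<lbrakk>a \<in> carrier k; x \<in> C\<rbrakk> \<Longrightarrow> a \<odot>\<^bsub>B\<^esub> x \<in> C"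
    "\<And>a. \<lbrakk>a \<in> carrier A; i a \<in> C\<rbrakk> \<Longrightarrow> i a = \<zero>\<^bsub>B\<^esub>"
    using C unfolding \<A>_def sub_def by blast+
  have Cneg: "\<ominus>\<^bsub>B\<^esub> c \<in> C" if "c \<in> C" for c
    using Cs(4)[of "\<ominus>\<^bsub>k\<^esub> \<one>\<^bsub>k\<^esub>" c] B.smult_neg_one[of c] that Cs(1) by auto
  have decomp: "\<exists>a\<in>carrier A. \<exists>c\<in>C. b = i a \<oplus>\<^bsub>B\<^esub> c" if b: "b \<in> carrier B" for b
  proof (rule ccontr)
    assume neg: "\<not> ?thesis"
    \<comment> \<open>The span of C and b contradicts the maximality of C.\<close>
    define D where "D = {c \<oplus>\<^bsub>B\<^esub> l \<odot>\<^bsub>B\<^esub> b | c l. c \<in> C \<and> l \<in> carrier k}"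
    have DI: "c \<oplus>\<^bsub>B\<^esub> l \<odot>\<^bsub>B\<^esub> b \<in> D" if "c \<in> C" "l \<in> carrier k" for c l using that D_def by blast
    have CD: "C \<subseteq> D"
    proof
      fix c assume "c \<in> C"
      then show "c \<in> D" using DI[of c "\<zero>\<^bsub>k\<^esub>"] B.smult_zero_left[OF b] Cs(1) by auto
    qed
    have bD: "b \<in> D" using DI[OF Cs(2), of "\<one>\<^bsub>k\<^esub>"] b B.smult_one by simp
    have "sub D" unfolding sub_def
    proof (intro conjI ballI)
      show "D \<subseteq> carrier B" using Cs(1) b unfolding D_def by (auto simp: B.smult_closed)
      show "\<zero>\<^bsub>B\<^esub> \<in> D" using CD Cs by blast
      show "x \<oplus>\<^bsub>B\<^esub> y \<in> D" if xy: "x \<in> D" "y \<in> D" for x y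
      proof -
        obtain c l c' l' where e: "x = c \<oplus>\<^bsub>B\<^esub> l \<odot>\<^bsub>B\<^esub> b" "y = c' \<oplus>\<^bsub>B\<^esub> l' \<odot>\<^bsub>B\<^esub> b" and
          m: "c \<in> C" "l \<in> carrier k" "c' \<in> C" "l' \<in> carrier k" using xy unfolding D_def by blast
        then have "x \<oplus>\<^bsub>B\<^esub> y = (c \<oplus>\<^bsub>B\<^esub> c') \<oplus>\<^bsub>B\<^esub> (l \<oplus>\<^bsub>k\<^esub> l') \<odot>\<^bsub>B\<^esub> b"
          using Cs(1) b by (simp add: B.smult_l_distr B.add_add_add B.smult_closed subset_iff)
        then show ?thesis using DI Cs(3) m by simp
      qed
      show "a \<odot>\<^bsub>B\<^esub> x \<in> D" if a: "a \<in> carrier k" and x: "x \<in> D" for a x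
      proof -
        obtain c l where e: "x = c \<oplus>\<^bsub>B\<^esub> l \<odot>\<^bsub>B\<^esub> b" and m: "c \<in> C" "l \<in> carrier k"
          using x unfolding D_def by blast
        then have "a \<odot>\<^bsub>B\<^esub> x = a \<odot>\<^bsub>B\<^esub> c \<oplus>\<^bsub>B\<^esub> (a \<otimes>\<^bsub>k\<^esub> l) \<odot>\<^bsub>B\<^esub> b"
          using Cs(1) b a by (simp add: B.smult_r_distr B.smult_assoc B.smult_closed subset_iff)
        then show ?thesis using DI Cs(4) m a by simp
      qed
    qed
    moreover have "i ` carrier A \<inter> D \<subseteq> {\<zero>\<^bsub>B\<^esub>}"
    proof
      fix x assume "x \<in> i ` carrier A \<inter> D"
      then obtain a c l where x: "a \<in> carrier A" "x = i a" "i a = c \<oplus>\<^bsub>B\<^esub> l \<odot>\<^bsub>B\<^esub> b"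
        and m: "c \<in> C" "l \<in> carrier k" unfolding D_def by blast
      have "l = \<zero>\<^bsub>k\<^esub>"
      proof (rule ccontr)
        assume "l \<noteq> \<zero>\<^bsub>k\<^esub>"
        then have u: "l \<in> Units k" using m k.field_Units by blast
        let ?j = "inv\<^bsub>k\<^esub> l"
        have j: "?j \<in> carrier k" "?j \<otimes>\<^bsub>k\<^esub> l = \<one>\<^bsub>k\<^esub>" using u by auto
        have c: "c \<in> carrier B" using m Cs by blast
        have "l \<odot>\<^bsub>B\<^esub> b = i a \<oplus>\<^bsub>B\<^esub> (\<ominus>\<^bsub>B\<^esub> c)"
          using x(3) c b m B.add_diff_cancel[of "l \<odot>\<^bsub>B\<^esub> b" c]
          by (simp add: B.smult_closed B.a_comm[of c] a_minus_def)
        then have "?j \<odot>\<^bsub>B\<^esub> (l \<odot>\<^bsub>B\<^esub> b) = i (?j \<odot>\<^bsub>A\<^esub> a) \<oplus>\<^bsub>B\<^esub> ?j \<odot>\<^bsub>B\<^esub> (\<ominus>\<^bsub>B\<^esub> c)"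
          using j c x(1) by (simp add: B.smult_r_distr lin_simps[OF i(1)])
        moreover have "?j \<odot>\<^bsub>B\<^esub> (l \<odot>\<^bsub>B\<^esub> b) = b"
          using j m b B.smult_assoc[of ?j l b] B.smult_one by simp
        ultimately show False
          using neg Cs(4)[OF j(1) Cneg[OF m(1)]] A.smult_closed[OF j(1) x(1)] by auto
      qed
      then have "i a = c" using x(3) B.smult_zero_left[OF b] m Cs(1) by auto
      then show "x \<in> {\<zero>\<^bsub>B\<^esub>}" using Cs(5) x m by blast
    qed
    ultimately have "D = C" using max CD unfolding \<A>_def by blast
    then have "b \<in> C" using bD by simp
    then show False
      using neg lin_zero[OF A B i(1)] b by (metis A.zero_closed B.l_zero)
  qed
  show thesis
  proof (rule lin_of_relation[OF B A,
        where D="\<lambda>b a. b \<in> carrier B \<and> a \<in> carrier A \<and> b \<ominus>\<^bsub>B\<^esub> i a \<in> C"], goal_cases)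
    case (2 b)
    then obtain a c where ac: "a \<in> carrier A" "c \<in> C" "b = i a \<oplus>\<^bsub>B\<^esub> c" using decomp by blast
    moreover have "c \<in> carrier B" using ac Cs by blast
    ultimately have "b \<ominus>\<^bsub>B\<^esub> i a = c"
      using B.add_diff_cancel[of c "i a"] B.a_comm lin_closed[OF i(1)] by simp
    then show ?case using ac 2 by blast
  next
    case (3 b a b' a')
    then show ?case
      using Cs(3)[of "b \<ominus>\<^bsub>B\<^esub> i a" "b' \<ominus>\<^bsub>B\<^esub> i a'"] by (simp add: lin_simps[OF i(1)] B.add_diff_add)
  next
    case (4 l b a)
    then show ?case
      using Cs(4)[of l "b \<ominus>\<^bsub>B\<^esub> i a"]
      by (simp add: lin_simps[OF i(1)] B.smult_diff A.smult_closed B.smult_closed)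
  next
    case (5 a)
    have "i a = \<ominus>\<^bsub>B\<^esub> (\<zero>\<^bsub>B\<^esub> \<ominus>\<^bsub>B\<^esub> i a)" using 5 lin_closed[OF i(1)] by (simp add: a_minus_def)
    then have "i a \<in> C" using Cneg 5 by metis
    then have "i a = i \<zero>\<^bsub>A\<^esub>" using Cs(5) 5 lin_zero[OF A B i(1)] by simp
    then show ?case using 5 i(2) by (meson A.zero_closed inj_onD)
  next
    case (6 f)
    have "f (i a) = a" if "a \<in> carrier A" for a
      using that lin_closed[OF i(1)] B.diff_zero_iff[of "i a" "i a"] Cs(2) by (intro 6(2)) auto
    then show ?case using that 6(1) by blast
  qed auto
qed

lemma (in left_module) finsum_smult:
  assumes "finite A" "f \<in> A \<rightarrow> carrier M" "a \<in> carrier R"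
  shows "a \<odot>\<^bsub>M\<^esub> (\<Oplus>\<^bsub>M\<^esub>i\<in>A. f i) = (\<Oplus>\<^bsub>M\<^esub>i\<in>A. a \<odot>\<^bsub>M\<^esub> f i)"
  using assms(1,2)
proof (induction A rule: finite_induct)
  case empty
  then show ?case using smult_zero_right assms(3) by simp
next
  case (insert x F)
  then show ?case
    using assms(3) by (simp add: M.finsum_insert smult_r_distr Pi_def smult_closed)
qed

lemma card_of_Times_less:
  fixes A :: "'a set" and B :: "'b set"
  assumes "infinite (UNIV :: 'm set)" "|A| <o |UNIV :: 'm set|" "|B| <o |UNIV :: 'm set|"
  shows "|A \<times> B| <o |UNIV :: 'm set|"
proof (cases "finite A \<and> finite B")
  case True
  then show ?thesis
    using finite_ordLess_infinite[OF card_of_Well_order card_of_Well_order, of "A \<times> B" "UNIV :: 'm set"]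
      assms(1) by (simp add: Field_card_of)
next
  case False
  consider "|A| \<le>o |B|" | "|B| \<le>o |A|" 
    using ordLeq_total[OF card_of_Well_order[of A] card_of_Well_order[of B]] by blast
  then show ?thesis
  proof cases
    case 1
    then have "infinite B" using False card_of_ordLeq_finite by blast
    then have "|B \<times> B| =o |B|" by (rule card_of_Times_same_infinite)
    from ordLeq_ordLess_trans[OF card_of_Times_mono1[OF 1] ordIso_ordLess_trans[OF this assms(3)]]
    show ?thesis .
  next
    case 2
    then have "infinite A" using False card_of_ordLeq_finite by blast
    then have "|A \<times> A| =o |A|" by (rule card_of_Times_same_infinite)
    from ordLeq_ordLess_trans[OF card_of_Times_mono2[OF 2] ordIso_ordLess_trans[OF this assms(2)]]
    show ?thesis .
  qed
qed

lemma card_of_PiE_less: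
  assumes "infinite (UNIV :: 'm set)" "finite A" "|B| <o |UNIV :: 'm set|"
  shows "|A \<rightarrow>\<^sub>E B| <o |UNIV :: 'm set|"
  using assms(2)
proof (induction A rule: finite_induct)
  case empty
  show ?case
    using finite_ordLess_infinite[OF card_of_Well_order card_of_Well_order, of "{} \<rightarrow>\<^sub>E B" "UNIV :: 'm set"]
      assms(1) by (simp add: Field_card_of)
next
  case (insert x F)
  then show ?case
    unfolding PiE_insert_eq
    using ordLeq_ordLess_trans[OF card_of_image card_of_Times_less[OF assms(1,3) insert.IH]] by blast
qed

locale finite_group_algebra = G: group G + k: field k
  for G :: "('g, 'y) monoid_scheme" and k :: "('k, 'x) ring_scheme" +
  assumes finite_G: "finite (carrier G)"
begin

abbreviation "kG \<equiv> group_algebra k G"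

text \<open>The monomial \<open>c g\<close> of the group algebra.\<close>

definition mono :: "'k \<Rightarrow> 'g \<Rightarrow> ('g \<Rightarrow> 'k)" where
  "mono c g = (\<lambda>x \<in> carrier G. if x = g then c else \<zero>\<^bsub>k\<^esub>)"

abbreviation "grp \<equiv> mono \<one>\<^bsub>k\<^esub>"
abbreviation "scl c \<equiv> mono c \<one>\<^bsub>G\<^esub>"

lemma kG_simps:
  "carrier kG = carrier G \<rightarrow>\<^sub>E carrier k"
  "\<zero>\<^bsub>kG\<^esub> = (\<lambda>g \<in> carrier G. \<zero>\<^bsub>k\<^esub>)"
  "\<one>\<^bsub>kG\<^esub> = mono \<one>\<^bsub>k\<^esub> \<one>\<^bsub>G\<^esub>"
  "x \<oplus>\<^bsub>kG\<^esub> y = (\<lambda>g \<in> carrier G. x g \<oplus>\<^bsub>k\<^esub> y g)"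
  "x \<otimes>\<^bsub>kG\<^esub> y = (\<lambda>g \<in> carrier G. \<Oplus>\<^bsub>k\<^esub>h \<in> carrier G. x h \<otimes>\<^bsub>k\<^esub> y (inv\<^bsub>G\<^esub> h \<otimes>\<^bsub>G\<^esub> g))"
  by (simp_all add: group_algebra_def mono_def)

lemma mono_closed [simp]: "c \<in> carrier k \<Longrightarrow> mono c g \<in> carrier kG"
  by (auto simp: kG_simps mono_def)

lemma mono_mult_left:
  assumes "c \<in> carrier k" "g \<in> carrier G" "y \<in> carrier kG" "x \<in> carrier G"
  shows "(mono c g \<otimes>\<^bsub>kG\<^esub> y) x = c \<otimes>\<^bsub>k\<^esub> y (inv\<^bsub>G\<^esub> g \<otimes>\<^bsub>G\<^esub> x)"
proof -
  have y: "y z \<in> carrier k" if "z \<in> carrier G" for z using assms(3) that by (auto simp: kG_simps)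
  have "(mono c g \<otimes>\<^bsub>kG\<^esub> y) x = (\<Oplus>\<^bsub>k\<^esub>h \<in> carrier G. mono c g h \<otimes>\<^bsub>k\<^esub> y (inv\<^bsub>G\<^esub> h \<otimes>\<^bsub>G\<^esub> x))"
    using assms by (simp add: kG_simps)
  also have "\<dots> = (\<Oplus>\<^bsub>k\<^esub>h \<in> carrier G. if h = g then c \<otimes>\<^bsub>k\<^esub> y (inv\<^bsub>G\<^esub> h \<otimes>\<^bsub>G\<^esub> x) else \<zero>\<^bsub>k\<^esub>)"
    using assms y by (intro k.finsum_cong') (auto simp: mono_def)
  also have "\<dots> = c \<otimes>\<^bsub>k\<^esub> y (inv\<^bsub>G\<^esub> g \<otimes>\<^bsub>G\<^esub> x)"
    using assms y finite_G by (intro k.add.finprod_singleton_swap) auto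
  finally show ?thesis .
qed

lemma mono_mult_mono:
  assumes "c \<in> carrier k" "d \<in> carrier k" "g \<in> carrier G" "h \<in> carrier G"
  shows "mono c g \<otimes>\<^bsub>kG\<^esub> mono d h = mono (c \<otimes>\<^bsub>k\<^esub> d) (g \<otimes>\<^bsub>G\<^esub> h)"
proof (rule extensionalityI[of _ "carrier G"])
  fix x assume x: "x \<in> carrier G"
  have "inv\<^bsub>G\<^esub> g \<otimes>\<^bsub>G\<^esub> x = h \<longleftrightarrow> x = g \<otimes>\<^bsub>G\<^esub> h"
    using x assms G.inv_solve_left' by auto
  then show "(mono c g \<otimes>\<^bsub>kG\<^esub> mono d h) x = mono (c \<otimes>\<^bsub>k\<^esub> d) (g \<otimes>\<^bsub>G\<^esub> h) x"
    using mono_mult_left[OF assms(1,3) mono_closed[OF assms(2)] x] x assms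
    by (simp add: mono_def)
qed (auto simp: kG_simps mono_def)

lemma mono_factor: "\<lbrakk>c \<in> carrier k; g \<in> carrier G\<rbrakk> \<Longrightarrow>
    mono c g = scl c \<otimes>\<^bsub>kG\<^esub> grp g"
  and mono_commute: "\<lbrakk>c \<in> carrier k; g \<in> carrier G\<rbrakk> \<Longrightarrow>
    grp g \<otimes>\<^bsub>kG\<^esub> scl c = scl c \<otimes>\<^bsub>kG\<^esub> grp g"
  by (simp_all add: mono_mult_mono)

lemma mono_add: "\<lbrakk>c \<in> carrier k; d \<in> carrier k\<rbrakk> \<Longrightarrow>
    mono (c \<oplus>\<^bsub>k\<^esub> d) g = mono c g \<oplus>\<^bsub>kG\<^esub> mono d g"
  by (auto simp: kG_simps mono_def)

text \<open>The group algebra is additively generated by monomials. Together with additivity this reduces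
  linearity over the group algebra to linearity over the field and equivariance.\<close>

lemma kG_induct [consumes 1, case_names zero mono add]:
  assumes "a \<in> carrier kG" and zero: "Q \<zero>\<^bsub>kG\<^esub>"
    and mono: "\<And>c g. \<lbrakk>c \<in> carrier k; g \<in> carrier G\<rbrakk> \<Longrightarrow> Q (mono c g)"
    and add: "\<And>a b. \<lbrakk>a \<in> carrier kG; b \<in> carrier kG; Q a; Q b\<rbrakk> \<Longrightarrow> Q (a \<oplus>\<^bsub>kG\<^esub> b)"
  shows "Q a"
proof -
  have "Q a" if "finite S" "S \<subseteq> carrier G" "a \<in> carrier kG" "\<And>x. x \<in> carrier G - S \<Longrightarrow> a x = \<zero>\<^bsub>k\<^esub>"
    for S a
    using that
  proof (induction S arbitrary: a rule: finite_induct)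
    case empty
    then have "a = \<zero>\<^bsub>kG\<^esub>"
      by (intro extensionalityI[of a "carrier G"]) (auto simp: kG_simps PiE_def)
    then show ?case using zero by simp
  next
    case (insert x F)
    define b where "b = a(x := \<zero>\<^bsub>k\<^esub>)"
    have b: "b \<in> carrier kG" using insert.prems by (auto simp: b_def kG_simps PiE_def extensional_def)
    have ax: "a x \<in> carrier k" using insert.prems by (auto simp: kG_simps)
    have av: "\<And>y. y \<in> carrier G \<Longrightarrow> a y \<in> carrier k" using insert.prems by (auto simp: kG_simps)
    have "Q b" using insert.prems insert.hyps b by (intro insert.IH) (auto simp: b_def simp del: fun_upd_apply, auto)
    moreover have "Q (mono (a x) x)" using mono ax insert.prems by simp
    moreover have "a = b \<oplus>\<^bsub>kG\<^esub> mono (a x) x"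
      using insert.prems av
      by (intro extensionalityI[of a "carrier G"]) (auto simp: b_def kG_simps mono_def PiE_def)
    ultimately show ?case using add b ax by (metis mono_closed)
  qed
  from this[of "carrier G" a] assms(1) finite_G show ?thesis by auto
qed

definition scalars :: "('g \<Rightarrow> 'k, 'a, 'z) module_scheme \<Rightarrow> ('k, 'a) module" where
  "scalars V = \<lparr> carrier = carrier V, mult = undefined, one = undefined, zero = \<zero>\<^bsub>V\<^esub>,
     add = add V, smult = (\<lambda>c v. scl c \<odot>\<^bsub>V\<^esub> v) \<rparr>"

lemma scalars_simps [simp]:
  "carrier (scalars V) = carrier V" "\<zero>\<^bsub>scalars V\<^esub> = \<zero>\<^bsub>V\<^esub>" "add (scalars V) = add V"
  "c \<odot>\<^bsub>scalars V\<^esub> v = scl c \<odot>\<^bsub>V\<^esub> v"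
  by (simp_all add: scalars_def)

lemma scalars_left_module:
  assumes "left_module kG V"
  shows "left_module k (scalars V)"
proof -
  interpret V: left_module kG V by fact
  show ?thesis
  proof (rule left_moduleI, goal_cases)
    case 1 then show ?case by (rule k.ring_axioms)
  next
    case (5 x y) then show ?case using V.a_comm by auto
  next
    case (7 x)
    then show ?case by (intro bexI[of _ "\<ominus>\<^bsub>V\<^esub> x"]) (auto simp: V.l_neg)
  next
    case (11 a b x)
    then show ?case
      using V.smult_assoc[of "scl a" "scl b" x] by (simp add: mono_mult_mono)
  next
    case (12 x)
    then show ?case using V.smult_one by (simp add: kG_simps)
  qed (auto simp: V.a_assoc V.smult_closed V.smult_l_distr V.smult_r_distr mono_add)
qed

lemma lin_scalars: "f \<in> lin kG V W \<Longrightarrow> f \<in> lin k (scalars V) (scalars W)"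
  by (auto simp: lin_def)

text \<open>The sum of the conjugates \<open>g f g\<^sup>-\<^sup>1\<close> of a linear map over the field.\<close>

definition average :: "('g \<Rightarrow> 'k, 'a, 'z) module_scheme \<Rightarrow> ('g \<Rightarrow> 'k, 'b, 'w) module_scheme
    \<Rightarrow> ('a \<Rightarrow> 'b) \<Rightarrow> 'a \<Rightarrow> 'b" where
  "average V W f = (\<lambda>v \<in> carrier V. \<Oplus>\<^bsub>W\<^esub>g \<in> carrier G.
     grp g \<odot>\<^bsub>W\<^esub> f (grp (inv\<^bsub>G\<^esub> g) \<odot>\<^bsub>V\<^esub> v))"

lemma average_lin:
  assumes V: "left_module kG V" and W: "left_module kG W" and f: "f \<in> lin k (scalars V) (scalars W)"
  shows "average V W f \<in> lin kG V W"
proof -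
  interpret V: left_module kG V by fact
  interpret W: left_module kG W by fact
  note f_simps = lin_simps[OF f, simplified]
  let ?F = "average V W f"
  let ?t = "\<lambda>v g. grp g \<odot>\<^bsub>W\<^esub> f (grp (inv\<^bsub>G\<^esub> g) \<odot>\<^bsub>V\<^esub> v)"
  have t: "?t v g \<in> carrier W" if "v \<in> carrier V" for v g
    using that by (simp add: W.smult_closed V.smult_closed f_simps)
  have closed: "?F v \<in> carrier W" if "v \<in> carrier V" for v
    using that t by (auto simp: average_def intro!: W.M.finsum_closed)
  have add: "?F (v \<oplus>\<^bsub>V\<^esub> v') = ?F v \<oplus>\<^bsub>W\<^esub> ?F v'" if v: "v \<in> carrier V" "v' \<in> carrier V" for v v'
  proof -
    have "?F v \<oplus>\<^bsub>W\<^esub> ?F v' = (\<Oplus>\<^bsub>W\<^esub>g \<in> carrier G. ?t v g \<oplus>\<^bsub>W\<^esub> ?t v' g)"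
      using v t by (simp add: average_def W.M.finsum_addf Pi_def)
    also have "\<dots> = ?F (v \<oplus>\<^bsub>V\<^esub> v')"
      using v t by (simp add: average_def V.smult_r_distr W.smult_r_distr V.smult_closed f_simps)
    finally show ?thesis by simp
  qed
  have scal: "?F (scl c \<odot>\<^bsub>V\<^esub> v) = scl c \<odot>\<^bsub>W\<^esub> ?F v"
    if v: "v \<in> carrier V" and c: "c \<in> carrier k" for c v
  proof -
    have "?t (scl c \<odot>\<^bsub>V\<^esub> v) g = scl c \<odot>\<^bsub>W\<^esub> ?t v g" if g: "g \<in> carrier G" for g
    proof -
      have "grp (inv\<^bsub>G\<^esub> g) \<odot>\<^bsub>V\<^esub> (scl c \<odot>\<^bsub>V\<^esub> v)
          = scl c \<odot>\<^bsub>V\<^esub> (grp (inv\<^bsub>G\<^esub> g) \<odot>\<^bsub>V\<^esub> v)"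
        using v c g by (simp flip: V.smult_assoc add: mono_commute)
      then have "?t (scl c \<odot>\<^bsub>V\<^esub> v) g = grp g \<odot>\<^bsub>W\<^esub> (scl c \<odot>\<^bsub>W\<^esub>
          f (grp (inv\<^bsub>G\<^esub> g) \<odot>\<^bsub>V\<^esub> v))"
        using v c g by (simp add: f_simps V.smult_closed)
      also have "\<dots> = scl c \<odot>\<^bsub>W\<^esub> ?t v g"
        using v c g by (simp flip: W.smult_assoc add: mono_commute f_simps V.smult_closed)
      finally show ?thesis .
    qed
    then have "(\<Oplus>\<^bsub>W\<^esub>g \<in> carrier G. ?t (scl c \<odot>\<^bsub>V\<^esub> v) g)
        = (\<Oplus>\<^bsub>W\<^esub>g \<in> carrier G. scl c \<odot>\<^bsub>W\<^esub> ?t v g)"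
      using v c t by (intro W.M.finsum_cong') (auto simp: W.smult_closed)
    also have "\<dots> = scl c \<odot>\<^bsub>W\<^esub> (\<Oplus>\<^bsub>W\<^esub>g \<in> carrier G. ?t v g)"
      using v c t finite_G by (intro W.finsum_smult[symmetric]) auto
    finally show ?thesis using v c by (simp add: average_def V.smult_closed)
  qed
  have grp: "?F (grp h \<odot>\<^bsub>V\<^esub> v) = grp h \<odot>\<^bsub>W\<^esub> ?F v"
    if v: "v \<in> carrier V" and h: "h \<in> carrier G" for h v
  proof -
    \<comment> \<open>Acting by h on a summand of the average at v gives the summand with index hg at hv.\<close>
    have "grp h \<odot>\<^bsub>W\<^esub> ?t v g = ?t (grp h \<odot>\<^bsub>V\<^esub> v) (h \<otimes>\<^bsub>G\<^esub> g)"
      if g: "g \<in> carrier G" for g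
    proof -
      have "grp (inv\<^bsub>G\<^esub> (h \<otimes>\<^bsub>G\<^esub> g)) \<odot>\<^bsub>V\<^esub> (grp h \<odot>\<^bsub>V\<^esub> v)
          = grp (inv\<^bsub>G\<^esub> g) \<odot>\<^bsub>V\<^esub> v"
        using v g h by (simp flip: V.smult_assoc add: mono_mult_mono G.inv_mult_group G.m_assoc)
      moreover have "grp h \<odot>\<^bsub>W\<^esub> ?t v g = grp (h \<otimes>\<^bsub>G\<^esub> g) \<odot>\<^bsub>W\<^esub>
          f (grp (inv\<^bsub>G\<^esub> g) \<odot>\<^bsub>V\<^esub> v)"
        using v g h by (simp flip: W.smult_assoc add: mono_mult_mono V.smult_closed f_simps)
      ultimately show ?thesis by simp
    qed
    moreover have "grp h \<odot>\<^bsub>W\<^esub> (\<Oplus>\<^bsub>W\<^esub>g \<in> carrier G. ?t v g)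
        = (\<Oplus>\<^bsub>W\<^esub>g \<in> carrier G. grp h \<odot>\<^bsub>W\<^esub> ?t v g)"
      using v t finite_G by (intro W.finsum_smult) auto
    moreover have "(\<Oplus>\<^bsub>W\<^esub>g \<in> (\<lambda>g. h \<otimes>\<^bsub>G\<^esub> g) ` carrier G. ?t (grp h \<odot>\<^bsub>V\<^esub> v) g)
        = (\<Oplus>\<^bsub>W\<^esub>g \<in> carrier G. ?t (grp h \<odot>\<^bsub>V\<^esub> v) (h \<otimes>\<^bsub>G\<^esub> g))"
      using v t h by (intro W.M.finsum_reindex G.inj_on_cmult) (auto simp: V.smult_closed)
    moreover have "(\<Oplus>\<^bsub>W\<^esub>g \<in> carrier G. grp h \<odot>\<^bsub>W\<^esub> ?t v g)
        = (\<Oplus>\<^bsub>W\<^esub>g \<in> carrier G. ?t (grp h \<odot>\<^bsub>V\<^esub> v) (h \<otimes>\<^bsub>G\<^esub> g))"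
      using calculation(1) v t by (intro W.M.finsum_cong') (auto simp: V.smult_closed)
    ultimately show ?thesis
      using v h by (simp add: average_def V.smult_closed G.surj_const_mult)
  qed
  show ?thesis
  proof (rule linI)
    fix a v assume "a \<in> carrier kG" and v: "v \<in> carrier V"
    then show "?F (a \<odot>\<^bsub>V\<^esub> v) = a \<odot>\<^bsub>W\<^esub> ?F v"
    proof (induction a rule: kG_induct)
      case zero
      have "?F \<zero>\<^bsub>V\<^esub> = \<zero>\<^bsub>W\<^esub>"
        using add[of "\<zero>\<^bsub>V\<^esub>" "\<zero>\<^bsub>V\<^esub>"] closed[of "\<zero>\<^bsub>V\<^esub>"]
        by (metis V.M.l_zero V.M.zero_closed W.M.add.r_cancel_one')
      then show ?case using v closed by (simp add: V.smult_zero_left W.smult_zero_left)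
    next
      case (mono c g)
      then show ?case
        using v closed scal[of "grp g \<odot>\<^bsub>V\<^esub> v" c] grp[of v g]
        by (simp add: mono_factor[of c g] V.smult_assoc W.smult_assoc V.smult_closed)
    next
      case (add a b)
      then show ?case
        using v closed \<open>\<And>v' v. v \<in> carrier V \<Longrightarrow> v' \<in> carrier V \<Longrightarrow> ?F (v \<oplus>\<^bsub>V\<^esub> v') = ?F v \<oplus>\<^bsub>W\<^esub> ?F v'\<close>
        by (simp add: V.smult_l_distr W.smult_l_distr V.smult_closed)
    qed
  qed (use closed add in \<open>auto simp: average_def\<close>)
qed

text \<open>The group algebra as a vector space over the field.\<close>

definition regular :: "('k, 'g \<Rightarrow> 'k) module" where
  "regular = \<lparr> carrier = carrier kG, mult = undefined, one = undefined, zero = \<zero>\<^bsub>kG\<^esub>,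
     add = add kG, smult = (\<lambda>c b. scl c \<otimes>\<^bsub>kG\<^esub> b) \<rparr>"

lemma regular_simps [simp]:
  "carrier regular = carrier kG" "\<zero>\<^bsub>regular\<^esub> = \<zero>\<^bsub>kG\<^esub>" "add regular = add kG"
  "c \<odot>\<^bsub>regular\<^esub> b = scl c \<otimes>\<^bsub>kG\<^esub> b"
  by (simp_all add: regular_def)

text \<open>The coinduced module \<open>Hom\<^sub>k(kG, V)\<close>. Right multiplication on the argument gives a left action.\<close>

definition coinduced :: "('g \<Rightarrow> 'k, 'a, 'z) module_scheme \<Rightarrow> ('g \<Rightarrow> 'k, ('g \<Rightarrow> 'k) \<Rightarrow> 'a) module" where
  "coinduced V = \<lparr> carrier = lin k regular (scalars V), mult = undefined, one = undefined,
     zero = (\<lambda>b \<in> carrier kG. \<zero>\<^bsub>V\<^esub>),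
     add = (\<lambda>f h. \<lambda>b \<in> carrier kG. f b \<oplus>\<^bsub>V\<^esub> h b),
     smult = (\<lambda>a f. \<lambda>b \<in> carrier kG. f (b \<otimes>\<^bsub>kG\<^esub> a)) \<rparr>"

lemma coinduced_simps [simp]:
  "carrier (coinduced V) = lin k regular (scalars V)"
  "\<zero>\<^bsub>coinduced V\<^esub> = (\<lambda>b \<in> carrier kG. \<zero>\<^bsub>V\<^esub>)"
  "f \<oplus>\<^bsub>coinduced V\<^esub> h = (\<lambda>b \<in> carrier kG. f b \<oplus>\<^bsub>V\<^esub> h b)"
  "a \<odot>\<^bsub>coinduced V\<^esub> f = (\<lambda>b \<in> carrier kG. f (b \<otimes>\<^bsub>kG\<^esub> a))"
  by (simp_all add: coinduced_def)

lemma regular_left_module: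
  assumes "ring kG"
  shows "left_module k regular"
proof -
  interpret kG: ring kG by fact
  show ?thesis
  proof (rule left_moduleI, goal_cases)
    case 1 then show ?case by (rule k.ring_axioms)
  next
    case (5 x y) then show ?case using kG.a_comm by auto
  next
    case (7 x)
    then show ?case by (intro bexI[of _ "\<ominus>\<^bsub>kG\<^esub> x"]) (auto simp: kG.l_neg)
  next
    case (11 a b x)
    then show ?case
      using kG.m_assoc[of "scl a" "scl b" x] by (simp add: mono_mult_mono)
  next
    case (12 x)
    then show ?case using kG.l_one[of x] by (simp add: kG_simps(3))
  qed (auto simp: kG.a_assoc kG.l_distr kG.r_distr mono_add)
qed

lemma coinduced_left_module:
  assumes "left_module kG V"
  shows "left_module kG (coinduced V)"
proof -
  interpret V: left_module kG V by fact
  interpret S: left_module k "scalars V" using assms by (rule scalars_left_module)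
  have reg: "left_module k regular" using V.R.ring_axioms by (rule regular_left_module)
  have val: "f b \<in> carrier V" if "f \<in> lin k regular (scalars V)" "b \<in> carrier kG" for f b
    using lin_closed[OF that(1)] that(2) by simp
  have ext: "f = h" if "f \<in> extensional (carrier kG)" "h \<in> extensional (carrier kG)"
    "\<And>b. b \<in> carrier kG \<Longrightarrow> f b = h b" for f h :: "('g \<Rightarrow> 'k) \<Rightarrow> 'a"
    using that by (rule extensionalityI)
  have lext: "f \<in> extensional (carrier kG)" if "f \<in> lin k regular (scalars V)" for f
    using lin_extensional[OF that] by simp
  show ?thesis
  proof (rule left_moduleI, goal_cases)
    case 1 then show ?case by (rule V.R.ring_axioms)
  next
    case (2 f h)
    then show ?case using lin_plus[OF reg S.left_module_axioms, of f h] by simp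
  next
    case 3
    then show ?case using lin_const_zero[OF reg S.left_module_axioms] by simp
  next
    case (4 f h e)
    then show ?case by (auto simp: val V.M.a_assoc)
  next
    case (5 f h)
    then show ?case by (auto simp: val V.M.a_comm intro!: restrict_ext)
  next
    case (6 f)
    then show ?case by (intro ext) (auto simp: val lext)
  next
    case (7 f)
    let ?h = "\<lambda>b \<in> carrier kG. \<zero>\<^bsub>V\<^esub> \<ominus>\<^bsub>scalars V\<^esub> f b"
    have "(\<lambda>b \<in> carrier kG. (\<lambda>b \<in> carrier kG. \<zero>\<^bsub>V\<^esub>) b \<ominus>\<^bsub>scalars V\<^esub> f b) \<in> lin k regular (scalars V)"
      using 7 lin_minus[OF reg S.left_module_axioms lin_const_zero[OF reg S.left_module_axioms], of f]
      by simp
    moreover have "(\<lambda>b \<in> carrier kG. (\<lambda>b \<in> carrier kG. \<zero>\<^bsub>V\<^esub>) b \<ominus>\<^bsub>scalars V\<^esub> f b) = ?h" by auto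
    ultimately have "?h \<in> lin k regular (scalars V)" by simp
    moreover have "(\<zero>\<^bsub>V\<^esub> \<ominus>\<^bsub>scalars V\<^esub> f b) \<oplus>\<^bsub>V\<^esub> f b = \<zero>\<^bsub>V\<^esub>" if "b \<in> carrier kG" for b
      using S.diff_add_cancel[of "\<zero>\<^bsub>V\<^esub>" "f b"] val that 7 by simp
    ultimately show ?case by (intro bexI[of _ ?h]) auto
  next
    case (8 a f)
    then have f: "f \<in> lin k regular (scalars V)" by simp
    show ?case
      using lin_simps[OF f] 8
      by (auto intro!: linI simp: V.R.l_distr V.R.m_assoc)
  next
    case (9 a b f)
    then have f: "f \<in> lin k regular (scalars V)" by simp
    show ?case using 9 lin_add[OF f] by (auto simp: V.R.r_distr)
  next
    case (10 a f h)
    then show ?case by auto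
  next
    case (11 a b f)
    then show ?case by (auto simp: V.R.m_assoc)
  next
    case (12 f)
    then show ?case by (intro ext) (auto simp: lext)
  qed
qed

text \<open>A map in the coinduced module is determined by its values on the finitely many group elements.\<close>

lemma coinduced_small:
  assumes V: "left_module kG V" "|carrier V| <o |UNIV :: 'm set|" and inf: "infinite (UNIV :: 'm set)"
  shows "|carrier (coinduced V)| <o |UNIV :: 'm set|"
proof -
  interpret V: left_module kG V by fact
  have S: "left_module k (scalars V)" using V(1) by (rule scalars_left_module)
  have reg: "left_module k regular" using V.R.ring_axioms by (rule regular_left_module)
  let ?r = "\<lambda>f. \<lambda>g \<in> carrier G. f (grp g)"
  have "f = h" if fh: "f \<in> lin k regular (scalars V)" "h \<in> lin k regular (scalars V)" "?r f = ?r h" for f h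
  proof (rule lin_eqI[OF fh(1,2)])
    fix a assume "a \<in> carrier regular"
    then have "a \<in> carrier kG" by simp
    then show "f a = h a"
    proof (induction a rule: kG_induct)
      case zero
      then show ?case using lin_zero[OF reg S fh(1)] lin_zero[OF reg S fh(2)] by simp
    next
      case (mono c g)
      have "f (grp g) = h (grp g)" using fun_cong[OF fh(3), of g] mono by simp
      then show ?case
        using lin_smult[OF fh(1), of c "grp g"] lin_smult[OF fh(2), of c "grp g"] mono
        by (simp add: mono_factor[of c g])
    next
      case (add a b)
      then show ?case using lin_add[OF fh(1), of a b] lin_add[OF fh(2), of a b] by simp
    qed
  qed
  then have "inj_on ?r (lin k regular (scalars V))" by (intro inj_onI) blast
  moreover have "?r ` lin k regular (scalars V) \<subseteq> (carrier G \<rightarrow>\<^sub>E carrier V)"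
    using lin_closed[of _ k regular "scalars V"] by fastforce
  ultimately have "|lin k regular (scalars V)| \<le>o |carrier G \<rightarrow>\<^sub>E carrier V|"
    using card_of_ordLeq by blast
  then show ?thesis using card_of_PiE_less[OF inf finite_G V(2)] ordLeq_ordLess_trans by simp
qed

lemma evaluation_lin:
  assumes "left_module kG V"
  shows "(\<lambda>f \<in> carrier (coinduced V). f \<one>\<^bsub>kG\<^esub>) \<in> lin k (scalars (coinduced V)) (scalars V)"
proof -
  interpret V: left_module kG V by fact
  interpret C: left_module kG "coinduced V" using assms by (rule coinduced_left_module)
  have C1: "f \<oplus>\<^bsub>coinduced V\<^esub> h \<in> carrier (coinduced V)" "f \<in> carrier (coinduced V) \<Longrightarrow> f \<one>\<^bsub>kG\<^esub> \<in> carrier V"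
    if "f \<in> carrier (coinduced V)" "h \<in> carrier (coinduced V)" for f h
    using that lin_closed[of f k regular "scalars V" "\<one>\<^bsub>kG\<^esub>"] by (blast, simp)
  show ?thesis
  proof (rule linI)
    fix f h assume "f \<in> carrier (scalars (coinduced V))" "h \<in> carrier (scalars (coinduced V))"
    then show "(\<lambda>f \<in> carrier (coinduced V). f \<one>\<^bsub>kG\<^esub>) (f \<oplus>\<^bsub>scalars (coinduced V)\<^esub> h) =
      (\<lambda>f \<in> carrier (coinduced V). f \<one>\<^bsub>kG\<^esub>) f \<oplus>\<^bsub>scalars V\<^esub> (\<lambda>f \<in> carrier (coinduced V). f \<one>\<^bsub>kG\<^esub>) h"
      using C.M.a_closed[of f h] by simp
  next
    fix c f assume c: "c \<in> carrier k" and "f \<in> carrier (scalars (coinduced V))"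
    then have f: "f \<in> lin k regular (scalars V)" by simp
    have "scl c \<odot>\<^bsub>coinduced V\<^esub> f \<in> carrier (coinduced V)"
      using f c by (intro C.smult_closed) auto
    then show "(\<lambda>f \<in> carrier (coinduced V). f \<one>\<^bsub>kG\<^esub>) (c \<odot>\<^bsub>scalars (coinduced V)\<^esub> f) =
      c \<odot>\<^bsub>scalars V\<^esub> (\<lambda>f \<in> carrier (coinduced V). f \<one>\<^bsub>kG\<^esub>) f"
      using f c lin_smult[OF f c, of "\<one>\<^bsub>kG\<^esub>"] V.R.one_closed by simp
  qed (use lin_closed[of _ k regular "scalars V" "\<one>\<^bsub>kG\<^esub>"] V.R.one_closed in auto)
qed

text \<open>Averaging the evaluation at \<open>1\<close> gives the surjection \<open>\<phi> \<mapsto> \<Sum> g \<phi>(g\<^sup>-\<^sup>1)\<close> from the coinduced module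
  onto \<open>V\<close>. A preimage of \<open>v\<close> is the map sending an element \<open>b\<close> of the group algebra to \<open>b(1) v\<close>.\<close>

lemma coinduced_counit_surj:
  assumes V: "left_module kG V" and v: "v \<in> carrier V"
  shows "\<exists>f \<in> carrier (coinduced V).
    average (coinduced V) V (\<lambda>f \<in> carrier (coinduced V). f \<one>\<^bsub>kG\<^esub>) f = v"
proof -
  interpret V: left_module kG V by fact
  interpret C: left_module kG "coinduced V" using V by (rule coinduced_left_module)
  define f where "f = (\<lambda>b \<in> carrier kG. scl (b \<one>\<^bsub>G\<^esub>) \<odot>\<^bsub>V\<^esub> v)"
  have b1: "b \<one>\<^bsub>G\<^esub> \<in> carrier k" if "b \<in> carrier kG" for b using that by (auto simp: kG_simps)
  have f: "f \<in> lin k regular (scalars V)"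
  proof (rule linI)
    fix x y assume "x \<in> carrier regular" "y \<in> carrier regular"
    then have xy: "x \<in> carrier kG" "y \<in> carrier kG" by auto
    then have "(x \<oplus>\<^bsub>kG\<^esub> y) \<one>\<^bsub>G\<^esub> = x \<one>\<^bsub>G\<^esub> \<oplus>\<^bsub>k\<^esub> y \<one>\<^bsub>G\<^esub>" by (simp add: kG_simps)
    then show "f (x \<oplus>\<^bsub>regular\<^esub> y) = f x \<oplus>\<^bsub>scalars V\<^esub> f y"
      using xy v b1 by (simp add: f_def mono_add V.smult_l_distr)
  next
    fix c x assume c: "c \<in> carrier k" and "x \<in> carrier regular"
    then have x: "x \<in> carrier kG" by auto
    then have "(scl c \<otimes>\<^bsub>kG\<^esub> x) \<one>\<^bsub>G\<^esub> = c \<otimes>\<^bsub>k\<^esub> x \<one>\<^bsub>G\<^esub>"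
      using c by (simp add: mono_mult_left)
    moreover have "scl (c \<otimes>\<^bsub>k\<^esub> x \<one>\<^bsub>G\<^esub>) = scl c \<otimes>\<^bsub>kG\<^esub> scl (x \<one>\<^bsub>G\<^esub>)"
      using c x b1 by (simp add: mono_mult_mono)
    ultimately show "f (c \<odot>\<^bsub>regular\<^esub> x) = c \<odot>\<^bsub>scalars V\<^esub> f x"
      using c x v b1 by (simp add: f_def V.smult_assoc)
  qed (use v b1 in \<open>auto simp: f_def V.smult_closed\<close>)
  then have fc: "f \<in> carrier (coinduced V)" by simp
  let ?ev = "\<lambda>f \<in> carrier (coinduced V). f \<one>\<^bsub>kG\<^esub>"
  have ev: "?ev (grp (inv\<^bsub>G\<^esub> g) \<odot>\<^bsub>coinduced V\<^esub> f) = (if g = \<one>\<^bsub>G\<^esub> then v else \<zero>\<^bsub>V\<^esub>)"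
    if g: "g \<in> carrier G" for g
  proof -
    have m1: "grp (inv\<^bsub>G\<^esub> g) \<one>\<^bsub>G\<^esub> = (if \<one>\<^bsub>G\<^esub> = inv\<^bsub>G\<^esub> g then \<one>\<^bsub>k\<^esub> else \<zero>\<^bsub>k\<^esub>)"
      by (simp add: mono_def)
    have "grp (inv\<^bsub>G\<^esub> g) \<odot>\<^bsub>coinduced V\<^esub> f \<in> carrier (coinduced V)"
      using fc by (intro C.smult_closed) auto
    then have "?ev (grp (inv\<^bsub>G\<^esub> g) \<odot>\<^bsub>coinduced V\<^esub> f) = f (grp (inv\<^bsub>G\<^esub> g))"
      using V.R.one_closed by simp
    also have "\<dots> = scl (if \<one>\<^bsub>G\<^esub> = inv\<^bsub>G\<^esub> g then \<one>\<^bsub>k\<^esub> else \<zero>\<^bsub>k\<^esub>) \<odot>\<^bsub>V\<^esub> v"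
      using m1 unfolding f_def by simp
    also have "\<dots> = (if g = \<one>\<^bsub>G\<^esub> then v else \<zero>\<^bsub>V\<^esub>)"
    proof (cases "g = \<one>\<^bsub>G\<^esub>")
      case True
      then show ?thesis using V.smult_one[OF v] by (simp add: kG_simps(3))
    next
      case False
      then have "\<one>\<^bsub>G\<^esub> \<noteq> inv\<^bsub>G\<^esub> g" using g G.inv_eq_1_iff by metis
      moreover have "mono \<zero>\<^bsub>k\<^esub> \<one>\<^bsub>G\<^esub> = \<zero>\<^bsub>kG\<^esub>" by (auto simp: mono_def kG_simps)
      ultimately show ?thesis using False V.smult_zero_left[OF v] by simp
    qed
    finally show ?thesis .
  qed
  have "average (coinduced V) V ?ev f =
      (\<Oplus>\<^bsub>V\<^esub>g \<in> carrier G. grp g \<odot>\<^bsub>V\<^esub> ?ev (grp (inv\<^bsub>G\<^esub> g) \<odot>\<^bsub>coinduced V\<^esub> f))"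
    using fc unfolding average_def by simp
  also have "\<dots> = (\<Oplus>\<^bsub>V\<^esub>g \<in> carrier G. if g = \<one>\<^bsub>G\<^esub> then v else \<zero>\<^bsub>V\<^esub>)"
  proof (rule V.M.finsum_cong')
    fix g assume g: "g \<in> carrier G"
    show "grp g \<odot>\<^bsub>V\<^esub> ?ev (grp (inv\<^bsub>G\<^esub> g) \<odot>\<^bsub>coinduced V\<^esub> f) = (if g = \<one>\<^bsub>G\<^esub> then v else \<zero>\<^bsub>V\<^esub>)"
      unfolding ev[OF g] using V.smult_one[OF v] V.smult_zero_right[of "grp g"]
      by (simp add: kG_simps(3))
  qed (use v in auto)
  also have "\<dots> = v" using v finite_G by (intro V.M.add.finprod_singleton_swap) auto
  finally show ?thesis using fc by blast
qed

text \<open>Higman's criterion. A projective module \<open>Q\<close> is a retract, by a linear section \<open>s\<close>, of its coinduced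
  module, so the map \<open>\<theta> : v \<mapsto> s(v)(1)\<close>, linear over the field, has the identity as the sum of its
  conjugates. If \<open>r\<close> is a retraction of \<open>i\<close> over the field, the average of \<open>\<theta> f r\<close> extends \<open>f\<close>, because
  \<open>r\<close> can be cancelled on the submodule \<open>i(A)\<close>.\<close>

theorem projective_injective:
  fixes Q :: "('g \<Rightarrow> 'k, 'm) module"
  assumes inf: "infinite (UNIV :: 'm set)" and Q: "projective_module kG Q"
    and A: "left_module kG A" and B: "left_module kG B"
    and i: "i \<in> lin kG A B" "inj_on i (carrier A)" and f: "f \<in> lin kG A Q"
  obtains h where "h \<in> lin kG B Q" "\<And>a. a \<in> carrier A \<Longrightarrow> h (i a) = f a"
proof -
  have QM: "Q \<in> Mods kG" using Q by (simp add: projective_module_def)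
  then have Qm: "left_module kG Q" and Qs: "|carrier Q| <o |UNIV :: 'm set|" by (auto simp: Mods_def)
  interpret A: left_module kG A by fact
  interpret B: left_module kG B by fact
  interpret Q: left_module kG Q by fact
  let ?C = "coinduced Q"
  have C: "left_module kG ?C" using Qm by (rule coinduced_left_module)
  interpret C: left_module kG ?C by fact
  let ?ev = "\<lambda>f \<in> carrier ?C. f \<one>\<^bsub>kG\<^esub>"
  define p where "p = average ?C Q ?ev"
  have ev: "?ev \<in> lin k (scalars ?C) (scalars Q)" using Qm by (rule evaluation_lin)
  have p: "p \<in> lin kG ?C Q" unfolding p_def using C Qm ev by (rule average_lin)
  obtain C' :: "('g \<Rightarrow> 'k, 'm) module" and c d where C': "C' \<in> Mods kG" "c \<in> lin kG C' ?C" "d \<in> lin kG ?C C'"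
    "\<And>x. x \<in> carrier ?C \<Longrightarrow> c (d x) = x" "\<And>y. y \<in> carrier C' \<Longrightarrow> d (c y) = y"
    using transport_left_module[OF C coinduced_small[OF Qm Qs inf]] by metis
  have C'm: "left_module kG C'" using C'(1) by (simp add: Mods_def)
  let ?pc = "compose (carrier C') p c"
  have pc: "?pc \<in> lin kG C' Q" using lin_compose[OF C'm C'(2) p] .
  have "?pc ` carrier C' = carrier Q"
  proof (intro equalityI subsetI)
    fix v assume "v \<in> carrier Q"
    then obtain x where x: "x \<in> carrier ?C" "p x = v" using coinduced_counit_surj[OF Qm] p_def by blast
    then have "?pc (d x) = v" using C' lin_closed[OF C'(3) x(1)] by (simp add: compose_def)
    then show "v \<in> ?pc ` carrier C'" using lin_closed[OF C'(3) x(1)] by blast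
  qed (use lin_closed[OF pc] in blast)
  then obtain s' where s': "s' \<in> lin kG Q C'" "(\<lambda>x \<in> carrier Q. x) = compose (carrier Q) ?pc s'"
    using Q QM C'(1) pc lin_id[OF Qm] unfolding projective_module_def lin_maps_eq_lin by blast
  define s where "s = compose (carrier Q) c s'"
  have s: "s \<in> lin kG Q ?C" unfolding s_def using lin_compose[OF Qm s'(1) C'(2)] .
  have ps: "p (s v) = v" if "v \<in> carrier Q" for v
    using fun_cong[OF s'(2), of v] that lin_closed[OF s'(1)] by (simp add: s_def compose_def)
  obtain r where r: "r \<in> lin k (scalars B) (scalars A)" "\<And>a. a \<in> carrier A \<Longrightarrow> r (i a) = a"
    using vector_space_retraction[OF k.field_axioms scalars_left_module[OF A] scalars_left_module[OF B]
        lin_scalars[OF i(1)]] i(2) by auto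
  define t where "t = compose (carrier B) (compose (carrier A) (compose (carrier Q) ?ev s) f) r"
  have es: "compose (carrier Q) ?ev s \<in> lin k (scalars Q) (scalars Q)"
    using lin_compose[OF scalars_left_module[OF Qm] lin_scalars[OF s] ev] by simp
  have esf: "compose (carrier A) (compose (carrier Q) ?ev s) f \<in> lin k (scalars A) (scalars Q)"
    using lin_compose[OF scalars_left_module[OF A] lin_scalars[OF f] es] by simp
  have t: "t \<in> lin k (scalars B) (scalars Q)"
    unfolding t_def using lin_compose[OF scalars_left_module[OF B] r(1) esf] by simp
  let ?h = "average B Q t"
  have "?h \<in> lin kG B Q" using B Qm t by (rule average_lin)
  moreover have "?h (i a) = f a" if a: "a \<in> carrier A" for a
  proof -
    have ta: "t (grp (inv\<^bsub>G\<^esub> g) \<odot>\<^bsub>B\<^esub> i a) = ?ev (grp (inv\<^bsub>G\<^esub> g) \<odot>\<^bsub>?C\<^esub> s (f a))" for g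
    proof -
      let ?m = "grp (inv\<^bsub>G\<^esub> g)"
      have "t (?m \<odot>\<^bsub>B\<^esub> i a) = t (i (?m \<odot>\<^bsub>A\<^esub> a))" using a lin_smult[OF i(1)] by simp
      also have "\<dots> = ?ev (s (f (?m \<odot>\<^bsub>A\<^esub> a)))"
        using a r(2) lin_closed[OF i(1)] lin_closed[OF f] A.smult_closed[of ?m a]
        by (simp add: t_def compose_def)
      also have "s (f (?m \<odot>\<^bsub>A\<^esub> a)) = ?m \<odot>\<^bsub>?C\<^esub> s (f a)"
        using a lin_smult[OF f] lin_smult[OF s] lin_closed[OF f] by simp
      finally show ?thesis .
    qed
    have "?h (i a) = p (s (f a))"
      unfolding p_def average_def
      using a lin_closed[OF i(1)] lin_closed[OF s lin_closed[OF f a]] ta by (simp cong del: restrict_apply)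
    then show ?thesis using ps lin_closed[OF f a] by simp
  qed
  ultimately show thesis using that by blast
qed

end

section \<open>The stable category when projective modules are injective\<close>

lemma Mods_left_module: "M \<in> Mods R \<Longrightarrow> left_module R M"
  by (simp add: Mods_def)

text \<open>Projective modules are required to be injective relative to the modules of the category, that
  is, to those of cardinality below the universe.\<close>

locale frobenius_modules =
  fixes R :: "('r, 'x) ring_scheme" and \<pi> :: "('r, 'm) presentation"
  assumes presentation: "projective_presentation R \<pi>"
    and infinite_universe: "infinite (UNIV :: 'm set)"
    and projective_extension:
      "\<And>(Q :: ('r, 'm) module) (A :: ('r, 'm) module) (B :: ('r, 'm) module) i f.
       \<lbrakk>projective_module R Q; A \<in> Mods R; B \<in> Mods R; i \<in> lin R A B; inj_on i (carrier A);
        f \<in> lin R A Q\<rbrakk> \<Longrightarrow> \<exists>h \<in> lin R B Q. \<forall>a \<in> carrier A. h (i a) = f a"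
begin

abbreviation P :: "('r, 'm) module \<Rightarrow> ('r, 'm) module" where "P X \<equiv> fst (\<pi> X)"
abbreviation p :: "('r, 'm) module \<Rightarrow> 'm \<Rightarrow> 'm" where "p X \<equiv> snd (\<pi> X)"
abbreviation \<Omega> :: "('r, 'm) module \<Rightarrow> ('r, 'm) module" where "\<Omega> \<equiv> Omega \<pi>"
abbreviation T where "T \<equiv> stable_cat R \<pi>"

lemma P_projective: "X \<in> Mods R \<Longrightarrow> projective_module R (P X)"
  and p_lin: "X \<in> Mods R \<Longrightarrow> p X \<in> lin R (P X) X"
  and p_surj: "X \<in> Mods R \<Longrightarrow> p X ` carrier (P X) = carrier X"
  using presentation unfolding projective_presentation_def lin_maps_eq_lin
  by (auto simp: case_prod_beta)

lemma projective_Mods: "projective_module R Q \<Longrightarrow> Q \<in> Mods R"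
  by (simp add: projective_module_def)

lemma P_Mods: "X \<in> Mods R \<Longrightarrow> P X \<in> Mods R"
  using P_projective projective_Mods by blast

lemma p_closed: "\<lbrakk>X \<in> Mods R; x \<in> carrier (P X)\<rbrakk> \<Longrightarrow> p X x \<in> carrier X"
  using lin_closed[OF p_lin] by blast

lemma Omega_simps [simp]:
  "carrier (\<Omega> X) = {x \<in> carrier (P X). p X x = \<zero>\<^bsub>X\<^esub>}" "add (\<Omega> X) = add (P X)"
  "smult (\<Omega> X) = smult (P X)" "\<zero>\<^bsub>\<Omega> X\<^esub> = \<zero>\<^bsub>P X\<^esub>"
  by (auto simp: Omega_def case_prod_beta a_kernel_def' )

lemma Omega_eq: "\<Omega> X = (P X)\<lparr>carrier := {x \<in> carrier (P X). p X x = \<zero>\<^bsub>X\<^esub>}\<rparr>"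
  by (simp add: Omega_def case_prod_beta a_kernel_def')

lemma Omega_Mods:
  assumes X: "X \<in> Mods R"
  shows "\<Omega> X \<in> Mods R"
proof -
  interpret X: left_module R X using X by (rule Mods_left_module)
  interpret PX: left_module R "P X" using P_Mods[OF X] by (rule Mods_left_module)
  note p = p_lin[OF X]
  have "left_module R (\<Omega> X)"
    unfolding Omega_eq
    by (rule PX.submodule_left_module)
      (auto simp: lin_simps[OF p] lin_zero[OF PX.left_module_axioms X.left_module_axioms p]
        PX.smult_closed X.smult_zero_right)
  moreover have "|carrier (\<Omega> X)| \<le>o |carrier (P X)|" by (rule card_of_mono1) auto
  then have "|carrier (\<Omega> X)| <o |UNIV :: 'm set|"
    using P_Mods[OF X] ordLeq_ordLess_trans unfolding Mods_def by blast
  ultimately show ?thesis by (simp add: Mods_def)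
qed

lemma Omega_incl: "X \<in> Mods R \<Longrightarrow> (\<lambda>x \<in> carrier (\<Omega> X). x) \<in> lin R (\<Omega> X) (P X)"
  using lin_inclusion[of R "carrier (\<Omega> X)" "P X"] Mods_left_module[OF Omega_Mods[of X]]
  by (simp add: Omega_eq)

lemma lift:
  fixes Q B C :: "('r, 'm) module"
  assumes "projective_module R Q" "B \<in> Mods R" "C \<in> Mods R" "g \<in> lin R B C"
    "g ` carrier B = carrier C" "f \<in> lin R Q C"
  obtains h where "h \<in> lin R Q B" "\<And>x. x \<in> carrier Q \<Longrightarrow> g (h x) = f x"
proof -
  obtain h where h: "h \<in> lin R Q B" "f = compose (carrier Q) g h"
    using assms unfolding projective_module_def lin_maps_eq_lin by blast
  have "g (h x) = f x" if "x \<in> carrier Q" for x using fun_cong[OF h(2), of x] that by (simp add: compose_def)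
  then show thesis using that h by blast
qed

lemma lift_p:
  fixes Q :: "('r, 'm) module"
  assumes "projective_module R Q" "Y \<in> Mods R" "f \<in> lin R Q Y"
  obtains h where "h \<in> lin R Q (P Y)" "\<And>x. x \<in> carrier Q \<Longrightarrow> p Y (h x) = f x"
  using lift[OF assms(1) P_Mods[OF assms(2)] assms(2) p_lin[OF assms(2)] p_surj[OF assms(2)] assms(3)]
  by metis

lemma extend:
  fixes Q A B :: "('r, 'm) module"
  assumes "projective_module R Q" "A \<in> Mods R" "B \<in> Mods R" "i \<in> lin R A B" "inj_on i (carrier A)"
    "f \<in> lin R A Q"
  obtains h where "h \<in> lin R B Q" "\<And>a. a \<in> carrier A \<Longrightarrow> h (i a) = f a"
  using projective_extension[OF assms] by blast

lemma extend_Omega: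
  fixes Q :: "('r, 'm) module"
  assumes "projective_module R Q" "X \<in> Mods R" "f \<in> lin R (\<Omega> X) Q"
  obtains h where "h \<in> lin R (P X) Q" "\<And>a. a \<in> carrier (\<Omega> X) \<Longrightarrow> h a = f a"
proof -
  have "inj_on (\<lambda>x \<in> carrier (\<Omega> X). x) (carrier (\<Omega> X))" by (auto simp: inj_on_def)
  from extend[OF assms(1) Omega_Mods[OF assms(2)] P_Mods[OF assms(2)] Omega_incl[OF assms(2)] this assms(3)]
  obtain h where h: "h \<in> lin R (P X) Q"
    "\<And>a. a \<in> carrier (\<Omega> X) \<Longrightarrow> h ((\<lambda>x \<in> carrier (\<Omega> X). x) a) = f a" by metis
  then have "h a = f a" if "a \<in> carrier (\<Omega> X)" for a using h(2)[OF that] that by simp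
  then show thesis using that h(1) by blast
qed

lemma lin_comp_fun:
  assumes "X \<in> Mods R" "f \<in> lin R X Y" "g \<in> lin R Y Z"
  shows "(\<lambda>x \<in> carrier X. g (f x)) \<in> lin R X Z"
  using lin_compose[OF Mods_left_module[OF assms(1)] assms(2,3)] by (simp add: compose_def)

lemma lin_corestrict_Omega:
  assumes X: "X \<in> Mods R" and Y: "Y \<in> Mods R" and f: "f \<in> lin R Y (P X)"
    and z: "\<And>y. y \<in> carrier Y \<Longrightarrow> p X (f y) = \<zero>\<^bsub>X\<^esub>"
  shows "f \<in> lin R Y (\<Omega> X)"
  using lin_simps[OF f] z lin_extensional[OF f] by (intro linI) auto

lemma lin_from_Omega:
  assumes X: "X \<in> Mods R" and f: "f \<in> lin R (P X) Y"
  shows "restrict f (carrier (\<Omega> X)) \<in> lin R (\<Omega> X) Y"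
proof -
  interpret O: left_module R "\<Omega> X" using Omega_Mods[OF X] by (rule Mods_left_module)
  show ?thesis
    using lin_simps[OF f] O.a_closed O.smult_closed by (intro linI) (auto simp del: O.a_closed)
qed

lemma lin_restrict_Omega:
  assumes X: "X \<in> Mods R" and Y: "Y \<in> Mods R" and q: "q \<in> lin R (P X) (P Y)"
    and z: "\<And>x. x \<in> carrier (\<Omega> X) \<Longrightarrow> p Y (q x) = \<zero>\<^bsub>Y\<^esub>"
  shows "restrict q (carrier (\<Omega> X)) \<in> lin R (\<Omega> X) (\<Omega> Y)"
  by (rule lin_corestrict_Omega[OF Y Omega_Mods[OF X] lin_from_Omega[OF X q]]) (use z in simp)

text \<open>Stable equality. A map that factors through some projective module factors through the chosen
  surjection onto its codomain. This normal form is additive without forming sums of projective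
  modules.\<close>

definition steq :: "('r, 'm) module \<Rightarrow> ('r, 'm) module \<Rightarrow> ('m \<Rightarrow> 'm) \<Rightarrow> ('m \<Rightarrow> 'm) \<Rightarrow> bool" where
  "steq X Y f g \<longleftrightarrow> (\<exists>u \<in> lin R X (P Y). \<forall>x \<in> carrier X. f x = g x \<oplus>\<^bsub>Y\<^esub> p Y (u x))"

lemma steqI:
  assumes "u \<in> lin R X (P Y)" "\<And>x. x \<in> carrier X \<Longrightarrow> f x = g x \<oplus>\<^bsub>Y\<^esub> p Y (u x)"
  shows "steq X Y f g"
  using assms unfolding steq_def by blast

lemma steq_projective:
  fixes Q :: "('r, 'm) module"
  assumes X: "X \<in> Mods R" and Y: "Y \<in> Mods R" and Q: "projective_module R Q"
    and u: "u \<in> lin R X Q" and v: "v \<in> lin R Q Y"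
    and eq: "\<And>x. x \<in> carrier X \<Longrightarrow> f x = g x \<oplus>\<^bsub>Y\<^esub> v (u x)"
  shows "steq X Y f g"
proof -
  obtain w where w: "w \<in> lin R Q (P Y)" "\<And>x. x \<in> carrier Q \<Longrightarrow> p Y (w x) = v x"
    using lift_p[OF Q Y v] by metis
  show ?thesis
    by (rule steqI[OF lin_comp_fun[OF X u w(1)]]) (use eq w lin_closed[OF u] in auto)
qed

lemma factors_iff:
  assumes X: "X \<in> Mods R" and Y: "Y \<in> Mods R" and f: "f \<in> lin R X Y" and g: "g \<in> lin R X Y"
  shows "factors_through_projective R X Y (\<lambda>x \<in> carrier X. f x \<ominus>\<^bsub>Y\<^esub> g x) \<longleftrightarrow> steq X Y f g"
proof -
  interpret Y: left_module R Y using Y by (rule Mods_left_module)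
  have fc: "f x \<in> carrier Y" "g x \<in> carrier Y" if "x \<in> carrier X" for x
    using lin_closed[OF f that] lin_closed[OF g that] by auto
  show ?thesis
  proof
    assume "factors_through_projective R X Y (\<lambda>x \<in> carrier X. f x \<ominus>\<^bsub>Y\<^esub> g x)"
    then obtain Q :: "('r, 'm) module" and u v where Q: "projective_module R Q" "u \<in> lin R X Q" "v \<in> lin R Q Y"
      and eq: "(\<lambda>x \<in> carrier X. f x \<ominus>\<^bsub>Y\<^esub> g x) = compose (carrier X) v u"
      unfolding factors_through_projective_def lin_maps_eq_lin by blast
    show "steq X Y f g"
    proof (rule steq_projective[OF X Y Q])
      fix x assume x: "x \<in> carrier X"
      then have "f x \<ominus>\<^bsub>Y\<^esub> g x = v (u x)" using fun_cong[OF eq, of x] by (simp add: compose_def)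
      then show "f x = g x \<oplus>\<^bsub>Y\<^esub> v (u x)"
        using fc[OF x] Y.diff_add_cancel[of "f x" "g x"]
          Y.a_comm[OF lin_closed[OF Q(3) lin_closed[OF Q(2) x]] fc(2)[OF x]] by simp
    qed
  next
    assume "steq X Y f g"
    then obtain u where u: "u \<in> lin R X (P Y)" "\<And>x. x \<in> carrier X \<Longrightarrow> f x = g x \<oplus>\<^bsub>Y\<^esub> p Y (u x)"
      unfolding steq_def by blast
    have "f x \<ominus>\<^bsub>Y\<^esub> g x = p Y (u x)" if x: "x \<in> carrier X" for x
      using u(2)[OF x] fc[OF x] p_closed[OF Y lin_closed[OF u(1) x]]
        Y.add_diff_cancel[of "p Y (u x)" "g x"] Y.a_comm[of "g x" "p Y (u x)"] by simp
    then have "(\<lambda>x \<in> carrier X. f x \<ominus>\<^bsub>Y\<^esub> g x) = compose (carrier X) (p Y) u"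
      by (auto simp: compose_def)
    then show "factors_through_projective R X Y (\<lambda>x \<in> carrier X. f x \<ominus>\<^bsub>Y\<^esub> g x)"
      unfolding factors_through_projective_def lin_maps_eq_lin
      using P_projective[OF Y] u(1) p_lin[OF Y] by blast
  qed
qed

lemma steq_refl:
  assumes X: "X \<in> Mods R" and Y: "Y \<in> Mods R" and f: "\<And>x. x \<in> carrier X \<Longrightarrow> f x = g x"
    "\<And>x. x \<in> carrier X \<Longrightarrow> g x \<in> carrier Y"
  shows "steq X Y f g"
proof -
  interpret Y: left_module R Y using Y by (rule Mods_left_module)
  note PY = Mods_left_module[OF P_Mods[OF Y]]
  show ?thesis
    using lin_zero[OF PY Y.left_module_axioms p_lin[OF Y]] f
    by (intro steqI[OF lin_const_zero[OF Mods_left_module[OF X] PY]]) simp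
qed

lemma steq_sym:
  assumes X: "X \<in> Mods R" and Y: "Y \<in> Mods R" and g: "g \<in> lin R X Y" and s: "steq X Y f g"
  shows "steq X Y g f"
proof -
  interpret Y: left_module R Y using Y by (rule Mods_left_module)
  interpret PY: left_module R "P Y" using P_Mods[OF Y] by (rule Mods_left_module)
  obtain u where u: "u \<in> lin R X (P Y)" "\<And>x. x \<in> carrier X \<Longrightarrow> f x = g x \<oplus>\<^bsub>Y\<^esub> p Y (u x)"
    using s unfolding steq_def by blast
  let ?u = "\<lambda>x \<in> carrier X. (\<lambda>x \<in> carrier X. \<zero>\<^bsub>P Y\<^esub>) x \<ominus>\<^bsub>P Y\<^esub> u x"
  have u': "?u \<in> lin R X (P Y)"
    using lin_minus[OF Mods_left_module[OF X] PY.left_module_axioms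
        lin_const_zero[OF Mods_left_module[OF X] PY.left_module_axioms] u(1)] .
  show ?thesis
  proof (rule steqI[OF u'])
    fix x assume x: "x \<in> carrier X"
    have pu: "p Y (u x) \<in> carrier Y" using p_closed[OF Y lin_closed[OF u(1) x]] .
    have "p Y (?u x) = \<ominus>\<^bsub>Y\<^esub> p Y (u x)"
      using x lin_closed[OF u(1) x] lin_neg[OF PY.left_module_axioms Y.left_module_axioms p_lin[OF Y]]
      by (simp add: a_minus_def)
    then show "g x = f x \<oplus>\<^bsub>Y\<^esub> p Y (?u x)"
      using u(2)[OF x] pu lin_closed[OF g x] Y.add_diff_cancel[of "g x" "p Y (u x)"]
      by (simp add: a_minus_def)
  qed
qed

lemma steq_trans:
  assumes X: "X \<in> Mods R" and Y: "Y \<in> Mods R" and h: "\<And>x. x \<in> carrier X \<Longrightarrow> h x \<in> carrier Y"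
    and s: "steq X Y f g" "steq X Y g h"
  shows "steq X Y f h"
proof -
  interpret Y: left_module R Y using Y by (rule Mods_left_module)
  interpret PY: left_module R "P Y" using P_Mods[OF Y] by (rule Mods_left_module)
  obtain u where u: "u \<in> lin R X (P Y)" "\<And>x. x \<in> carrier X \<Longrightarrow> f x = g x \<oplus>\<^bsub>Y\<^esub> p Y (u x)"
    using s(1) unfolding steq_def by blast
  obtain v where v: "v \<in> lin R X (P Y)" "\<And>x. x \<in> carrier X \<Longrightarrow> g x = h x \<oplus>\<^bsub>Y\<^esub> p Y (v x)"
    using s(2) unfolding steq_def by blast
  show ?thesis
  proof (rule steqI[OF lin_plus[OF Mods_left_module[OF X] PY.left_module_axioms v(1) u(1)]])
    fix x assume x: "x \<in> carrier X"
    show "f x = h x \<oplus>\<^bsub>Y\<^esub> p Y ((\<lambda>x\<in>carrier X. v x \<oplus>\<^bsub>P Y\<^esub> u x) x)"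
      using x u v h lin_closed[OF u(1) x] lin_closed[OF v(1) x]
      by (simp add: lin_add[OF p_lin[OF Y]] p_closed[OF Y] Y.a_assoc)
  qed
qed

lemma stable_class_steq:
  assumes "X \<in> Mods R" "Y \<in> Mods R" "f \<in> lin R X Y"
  shows "stable_class R X Y f = {g \<in> lin R X Y. steq X Y g f}"
  unfolding stable_class_def lin_maps_eq_lin using factors_iff[OF assms(1,2) _ assms(3)] by blast

lemma stable_arr_eq_iff:
  assumes X: "X \<in> Mods R" and Y: "Y \<in> Mods R" and f: "f \<in> lin R X Y" and g: "g \<in> lin R X Y"
  shows "stable_arr R X Y f = stable_arr R X Y g \<longleftrightarrow> steq X Y f g"
proof
  assume "stable_arr R X Y f = stable_arr R X Y g"
  then have "{h \<in> lin R X Y. steq X Y h f} = {h \<in> lin R X Y. steq X Y h g}"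
    using stable_class_steq[OF X Y] f g by (simp add: stable_arr_def)
  moreover have "f \<in> {h \<in> lin R X Y. steq X Y h f}"
    using f steq_refl[OF X Y, of f f] lin_closed[OF f] by blast
  ultimately show "steq X Y f g" by blast
next
  assume fg: "steq X Y f g"
  have "steq X Y h f \<longleftrightarrow> steq X Y h g" if "h \<in> lin R X Y" for h
    using steq_trans[OF X Y lin_closed[OF g] _ fg] steq_trans[OF X Y lin_closed[OF f] _ steq_sym[OF X Y g fg]]
    by blast
  then show "stable_arr R X Y f = stable_arr R X Y g"
    using stable_class_steq[OF X Y] f g by (auto simp: stable_arr_def)
qed

lemma steq_comp_left:
  assumes X: "X \<in> Mods R" and Y: "Y \<in> Mods R" and Z: "Z \<in> Mods R"
    and f: "steq X Y f f'" "f' \<in> lin R X Y" and g: "g \<in> lin R Y Z"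
  shows "steq X Z (\<lambda>x \<in> carrier X. g (f x)) (\<lambda>x \<in> carrier X. g (f' x))"
proof -
  obtain u where u: "u \<in> lin R X (P Y)" "\<And>x. x \<in> carrier X \<Longrightarrow> f x = f' x \<oplus>\<^bsub>Y\<^esub> p Y (u x)"
    using f(1) unfolding steq_def by blast
  show ?thesis
    by (rule steq_projective[OF X Z P_projective[OF Y] u(1) lin_comp_fun[OF P_Mods[OF Y] p_lin[OF Y] g]])
      (use u(2) lin_closed[OF u(1)] lin_closed[OF f(2)] p_closed[OF Y] lin_add[OF g] in simp)
qed

lemma steq_comp_right:
  assumes X: "X \<in> Mods R" and Y: "Y \<in> Mods R" and Z: "Z \<in> Mods R"
    and f: "f \<in> lin R X Y" and g: "steq Y Z g g'"
  shows "steq X Z (\<lambda>x \<in> carrier X. g (f x)) (\<lambda>x \<in> carrier X. g' (f x))"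
proof -
  obtain u where u: "u \<in> lin R Y (P Z)" "\<And>x. x \<in> carrier Y \<Longrightarrow> g x = g' x \<oplus>\<^bsub>Z\<^esub> p Z (u x)"
    using g unfolding steq_def by blast
  show ?thesis
    by (rule steqI[OF lin_comp_fun[OF X f u(1)]]) (use u(2) lin_closed[OF f] in simp)
qed

abbreviation arr :: "('r, 'm) module \<Rightarrow> ('r, 'm) module \<Rightarrow> ('m \<Rightarrow> 'm) \<Rightarrow> ('r, 'm) stable_arrow"
  where "arr X Y f \<equiv> stable_arr R X Y f"

lemma T_simps:
  "Obj T = Mods R" "Dom T = fst" "Cod T = (\<lambda>a. fst (snd a))" "Ide T X = arr X X (\<lambda>x \<in> carrier X. x)"
  "ZeroA T X Y = arr X Y (\<lambda>x \<in> carrier X. \<zero>\<^bsub>Y\<^esub>)" "Desusp T = \<Omega>" "DesuspA T = Omega_arr R \<pi>"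
  "Arr T = {arr X Y f | X Y f. X \<in> Mods R \<and> Y \<in> Mods R \<and> f \<in> lin R X Y}"
  by (simp_all add: stable_cat_def lin_maps_eq_lin)

lemma Homs_iff: "a \<in> Homs T X Y \<longleftrightarrow> X \<in> Mods R \<and> Y \<in> Mods R \<and> (\<exists>f \<in> lin R X Y. a = arr X Y f)"
  unfolding Homs_def T_simps by (auto simp: stable_arr_def)

lemma HomsE:
  assumes "a \<in> Homs T X Y"
  obtains f where "X \<in> Mods R" "Y \<in> Mods R" "f \<in> lin R X Y" "a = arr X Y f"
  using assms Homs_iff by blast

lemma HomsI: "\<lbrakk>X \<in> Mods R; Y \<in> Mods R; f \<in> lin R X Y\<rbrakk> \<Longrightarrow> arr X Y f \<in> Homs T X Y"
  using Homs_iff by blast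

lemma stable_class_union:
  assumes "X \<in> Mods R" "Y \<in> Mods R" "g \<in> lin R X Y" "S \<noteq> {}"
    and "\<And>h. h \<in> S \<Longrightarrow> h \<in> lin R X Y \<and> steq X Y h g"
  shows "(\<Union>h \<in> S. stable_class R X Y h) = stable_class R X Y g"
proof -
  have "stable_class R X Y h = stable_class R X Y g" if "h \<in> S" for h
    using stable_arr_eq_iff[OF assms(1,2), of h g] assms(3,5) that by (simp add: stable_arr_def)
  then show ?thesis using assms(4) by blast
qed

lemma Cmp_arr:
  assumes X: "X \<in> Mods R" and Y: "Y \<in> Mods R" and Z: "Z \<in> Mods R"
    and f: "f \<in> lin R X Y" and g: "g \<in> lin R Y Z"
  shows "arr Y Z g \<cdot>\<^bsub>T\<^esub> arr X Y f = arr X Z (\<lambda>x \<in> carrier X. g (f x))"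
proof -
  let ?K = "stable_class R Y Z g" and ?F = "stable_class R X Y f"
  let ?c = "\<lambda>g f. \<lambda>x \<in> carrier X. g (f x)"
  let ?S = "{?c g' f' | g' f'. g' \<in> ?K \<and> f' \<in> ?F}"
  have "(\<Union>g' \<in> ?K. \<Union>f' \<in> ?F. stable_class R X Z (compose (carrier X) g' f'))
      = (\<Union>h \<in> ?S. stable_class R X Z h)" unfolding compose_def by blast
  also have "\<dots> = stable_class R X Z (?c g f)"
  proof (rule stable_class_union[OF X Z])
    show "?c g f \<in> lin R X Z" using lin_comp_fun[OF X f g] .
    have "g \<in> ?K" "f \<in> ?F"
      using stable_class_steq[OF Y Z g] stable_class_steq[OF X Y f] f g
        steq_refl[OF X Y, of f f] steq_refl[OF Y Z, of g g] lin_closed[OF f] lin_closed[OF g] by blast+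
    then show "?S \<noteq> {}" by blast
    fix h assume "h \<in> ?S"
    then obtain g' f' where h: "h = ?c g' f'" "g' \<in> lin R Y Z" "steq Y Z g' g" "f' \<in> lin R X Y" "steq X Y f' f"
      using stable_class_steq[OF Y Z g] stable_class_steq[OF X Y f] by blast
    have "steq X Z (?c g' f') (?c g' f)" using steq_comp_left[OF X Y Z h(5) f h(2)] .
    moreover have "steq X Z (?c g' f) (?c g f)" using steq_comp_right[OF X Y Z f h(3)] .
    ultimately have "steq X Z (?c g' f') (?c g f)"
      using steq_trans[OF X Z] lin_closed[OF lin_comp_fun[OF X f g]] by blast
    then show "h \<in> lin R X Z \<and> steq X Z h (?c g f)" using h lin_comp_fun[OF X h(4,2)] by simp
  qed
  finally show ?thesis by (simp add: stable_cat_def stable_arr_def)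
qed

lemma lift_exists:
  assumes X: "X \<in> Mods R" and Y: "Y \<in> Mods R" and f: "f \<in> lin R X Y"
  obtains q where "q \<in> lin R (P X) (P Y)" "\<And>x. x \<in> carrier (P X) \<Longrightarrow> p Y (q x) = f (p X x)"
proof -
  obtain q where "q \<in> lin R (P X) (P Y)" "\<And>x. x \<in> carrier (P X) \<Longrightarrow> p Y (q x) = (\<lambda>x\<in>carrier (P X). f (p X x)) x"
    using lift_p[OF P_projective[OF X] Y lin_comp_fun[OF P_Mods[OF X] p_lin[OF X] f]] by metis
  then show thesis by (intro that[of q]) auto
qed

lemma lift_Omega:
  assumes X: "X \<in> Mods R" and Y: "Y \<in> Mods R" and f: "f \<in> lin R X Y"
    and q: "q \<in> lin R (P X) (P Y)" "\<And>x. x \<in> carrier (P X) \<Longrightarrow> p Y (q x) = f (p X x)"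
  shows "restrict q (carrier (\<Omega> X)) \<in> lin R (\<Omega> X) (\<Omega> Y)"
  by (rule lin_restrict_Omega[OF X Y q(1)])
    (use q(2) lin_zero[OF Mods_left_module[OF X] Mods_left_module[OF Y] f] in auto)

text \<open>If \<open>f - f' = p u\<close> with \<open>p\<close> the chosen surjection onto \<open>Y\<close>, then \<open>q - q' - u p\<close> maps \<open>P X\<close> into \<open>\<Omega>Y\<close>;
  on \<open>\<Omega>X\<close> the term \<open>u p\<close> vanishes, so there \<open>q - q'\<close> factors through the projective module \<open>P X\<close>.\<close>

lemma lift_unique:
  assumes X: "X \<in> Mods R" and Y: "Y \<in> Mods R" and f: "f \<in> lin R X Y" and f': "f' \<in> lin R X Y"
    and s: "steq X Y f f'"
    and q: "q \<in> lin R (P X) (P Y)" "\<And>x. x \<in> carrier (P X) \<Longrightarrow> p Y (q x) = f (p X x)"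
    and q': "q' \<in> lin R (P X) (P Y)" "\<And>x. x \<in> carrier (P X) \<Longrightarrow> p Y (q' x) = f' (p X x)"
  shows "steq (\<Omega> X) (\<Omega> Y) (restrict q (carrier (\<Omega> X))) (restrict q' (carrier (\<Omega> X)))"
proof -
  interpret Y: left_module R Y using Y by (rule Mods_left_module)
  interpret PY: left_module R "P Y" using P_Mods[OF Y] by (rule Mods_left_module)
  interpret X: left_module R X using X by (rule Mods_left_module)
  interpret PX: left_module R "P X" using P_Mods[OF X] by (rule Mods_left_module)
  note pY = p_lin[OF Y] and pX = p_lin[OF X]
  obtain u where u: "u \<in> lin R X (P Y)" "\<And>x. x \<in> carrier X \<Longrightarrow> f x = f' x \<oplus>\<^bsub>Y\<^esub> p Y (u x)"
    using s unfolding steq_def by blast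
  let ?d = "\<lambda>x \<in> carrier (P X). q x \<ominus>\<^bsub>P Y\<^esub> q' x"
  let ?e = "\<lambda>x \<in> carrier (P X). ?d x \<ominus>\<^bsub>P Y\<^esub> (\<lambda>x\<in>carrier (P X). u (p X x)) x"
  have e: "?e \<in> lin R (P X) (P Y)"
    using lin_minus[OF PX.left_module_axioms PY.left_module_axioms
        lin_minus[OF PX.left_module_axioms PY.left_module_axioms q(1) q'(1)]
        lin_comp_fun[OF P_Mods[OF X] pX u(1)]] .
  have "p Y (?e x) = \<zero>\<^bsub>Y\<^esub>" if x: "x \<in> carrier (P X)" for x
  proof -
    note c = lin_closed[OF q(1) x] lin_closed[OF q'(1) x] p_closed[OF X x]
    note c2 = lin_closed[OF u(1) c(3)] lin_closed[OF f c(3)] lin_closed[OF f' c(3)]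
    have "p Y (?e x) = (f (p X x) \<ominus>\<^bsub>Y\<^esub> f' (p X x)) \<ominus>\<^bsub>Y\<^esub> p Y (u (p X x))"
      using x c c2 q(2) q'(2)
      by (simp add: lin_diff[OF PY.left_module_axioms Y.left_module_axioms pY])
    also have "f (p X x) \<ominus>\<^bsub>Y\<^esub> f' (p X x) = p Y (u (p X x))"
      using u(2)[OF c(3)] c2 p_closed[OF Y c2(1)] Y.a_comm[of "f' (p X x)"]
        Y.add_diff_cancel[of "p Y (u (p X x))" "f' (p X x)"] by simp
    finally show ?thesis using p_closed[OF Y c2(1)] Y.diff_zero_iff by simp
  qed
  then have "?e \<in> lin R (P X) (\<Omega> Y)" using lin_corestrict_Omega[OF Y P_Mods[OF X] e] by simp
  then show ?thesis
  proof (rule steq_projective[OF Omega_Mods[OF X] Omega_Mods[OF Y] P_projective[OF X] Omega_incl[OF X]])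
    fix x assume "x \<in> carrier (\<Omega> X)"
    then have x: "x \<in> carrier (P X)" "p X x = \<zero>\<^bsub>X\<^esub>" by auto
    have u0: "u (p X x) = \<zero>\<^bsub>P Y\<^esub>"
      using x lin_zero[OF X.left_module_axioms PY.left_module_axioms u(1)] by simp
    note c = lin_closed[OF q(1) x(1)] lin_closed[OF q'(1) x(1)]
    have "?e x = q x \<ominus>\<^bsub>P Y\<^esub> q' x" using x c u0 by (simp add: a_minus_def)
    then have "q x = q' x \<oplus>\<^bsub>P Y\<^esub> ?e x"
      using c PY.diff_add_cancel[of "q x" "q' x"] PY.a_comm[of "q' x" "q x \<ominus>\<^bsub>P Y\<^esub> q' x"] by simp
    then show "restrict q (carrier (\<Omega> X)) x = restrict q' (carrier (\<Omega> X)) x \<oplus>\<^bsub>\<Omega> Y\<^esub>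
        ?e ((\<lambda>x\<in>carrier (\<Omega> X). x) x)"
      using x by simp
  qed
qed

lemma Omega_arr_lift:
  assumes X: "X \<in> Mods R" and Y: "Y \<in> Mods R" and f: "f \<in> lin R X Y"
    and q: "q \<in> lin R (P X) (P Y)" "\<And>x. x \<in> carrier (P X) \<Longrightarrow> p Y (q x) = f (p X x)"
  shows "Omega_arr R \<pi> (arr X Y f) = arr (\<Omega> X) (\<Omega> Y) (restrict q (carrier (\<Omega> X)))"
proof -
  let ?F = "stable_class R X Y f" and ?r = "\<lambda>q. restrict q (carrier (\<Omega> X))"
  let ?S = "{?r q | q. q \<in> lin R (P X) (P Y) \<and> (\<exists>f \<in> ?F. \<forall>x \<in> carrier (P X). p Y (q x) = f (p X x))}"
  have "\<Union> {stable_class R (\<Omega> X) (\<Omega> Y) (?r q) | q. q \<in> lin_maps R (P X) (P Y) \<and>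
            (\<exists>f \<in> ?F. \<forall>x \<in> carrier (P X). p Y (q x) = f (p X x))}
      = (\<Union>h \<in> ?S. stable_class R (\<Omega> X) (\<Omega> Y) h)" unfolding lin_maps_eq_lin by blast
  also have "\<dots> = stable_class R (\<Omega> X) (\<Omega> Y) (?r q)"
  proof (rule stable_class_union[OF Omega_Mods[OF X] Omega_Mods[OF Y]])
    show "?r q \<in> lin R (\<Omega> X) (\<Omega> Y)" by (rule lift_Omega[OF X Y f q])
    have "f \<in> ?F" using stable_class_steq[OF X Y f] f steq_refl[OF X Y, of f f] lin_closed[OF f] by blast
    then show "?S \<noteq> {}" using q by blast
    fix h assume "h \<in> ?S"
    then obtain q' f' where h: "h = ?r q'" "q' \<in> lin R (P X) (P Y)" "f' \<in> lin R X Y" "steq X Y f' f"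
      and q': "\<And>x. x \<in> carrier (P X) \<Longrightarrow> p Y (q' x) = f' (p X x)"
      using stable_class_steq[OF X Y f] by blast
    show "h \<in> lin R (\<Omega> X) (\<Omega> Y) \<and> steq (\<Omega> X) (\<Omega> Y) h (?r q)"
      using lift_Omega[OF X Y h(3,2) q'] lift_unique[OF X Y h(3) f h(4,2) q' q] h(1) by simp
  qed
  finally show ?thesis by (simp add: Omega_arr_def stable_arr_def)
qed

text \<open>A factorization of \<open>q - r\<close> on \<open>\<Omega>X\<close> through a projective module extends to \<open>P X\<close>, projective
  modules being injective. Subtracting the extension leaves a map \<open>P X \<rightarrow> P Y\<close> that kills \<open>\<Omega>X\<close> and
  so comes from a map \<open>X \<rightarrow> P Y\<close>, through which \<open>f - g\<close> factors.\<close>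

lemma Omega_faithful:
  assumes X: "X \<in> Mods R" and Y: "Y \<in> Mods R" and f: "f \<in> lin R X Y" and g: "g \<in> lin R X Y"
    and eq: "Omega_arr R \<pi> (arr X Y f) = Omega_arr R \<pi> (arr X Y g)"
  shows "arr X Y f = arr X Y g"
proof -
  interpret Y: left_module R Y using Y by (rule Mods_left_module)
  interpret PY: left_module R "P Y" using P_Mods[OF Y] by (rule Mods_left_module)
  interpret X: left_module R X using X by (rule Mods_left_module)
  interpret PX: left_module R "P X" using P_Mods[OF X] by (rule Mods_left_module)
  note pY = p_lin[OF Y] and pX = p_lin[OF X]
  note OX = Omega_Mods[OF X] and OY = Omega_Mods[OF Y]
  obtain q where q: "q \<in> lin R (P X) (P Y)" "\<And>x. x \<in> carrier (P X) \<Longrightarrow> p Y (q x) = f (p X x)"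
    using lift_exists[OF X Y f] by metis
  obtain r where r: "r \<in> lin R (P X) (P Y)" "\<And>x. x \<in> carrier (P X) \<Longrightarrow> p Y (r x) = g (p X x)"
    using lift_exists[OF X Y g] by metis
  have "steq (\<Omega> X) (\<Omega> Y) (restrict q (carrier (\<Omega> X))) (restrict r (carrier (\<Omega> X)))"
    using eq Omega_arr_lift[OF X Y f q] Omega_arr_lift[OF X Y g r]
      stable_arr_eq_iff[OF OX OY lift_Omega[OF X Y f q] lift_Omega[OF X Y g r]] by simp
  then obtain u where u: "u \<in> lin R (\<Omega> X) (P (\<Omega> Y))"
    "\<And>x. x \<in> carrier (\<Omega> X) \<Longrightarrow> q x = r x \<oplus>\<^bsub>P Y\<^esub> p (\<Omega> Y) (u x)"
  proof -
    assume that: "\<And>u. \<lbrakk>u \<in> lin R (\<Omega> X) (P (\<Omega> Y));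
      \<And>x. x \<in> carrier (\<Omega> X) \<Longrightarrow> q x = r x \<oplus>\<^bsub>P Y\<^esub> p (\<Omega> Y) (u x)\<rbrakk> \<Longrightarrow> thesis"
    assume "steq (\<Omega> X) (\<Omega> Y) (restrict q (carrier (\<Omega> X))) (restrict r (carrier (\<Omega> X)))"
    then obtain u where "u \<in> lin R (\<Omega> X) (P (\<Omega> Y))"
      "\<forall>x \<in> carrier (\<Omega> X). restrict q (carrier (\<Omega> X)) x =
         restrict r (carrier (\<Omega> X)) x \<oplus>\<^bsub>\<Omega> Y\<^esub> p (\<Omega> Y) (u x)" unfolding steq_def by blast
    then show thesis by (intro that[of u]) auto
  qed
  obtain h where h: "h \<in> lin R (P X) (P (\<Omega> Y))" "\<And>a. a \<in> carrier (\<Omega> X) \<Longrightarrow> h a = u a"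
    using extend_Omega[OF P_projective[OF OY] X u(1)] by metis
  have ph: "p (\<Omega> Y) (h x) \<in> carrier (P Y)" "p Y (p (\<Omega> Y) (h x)) = \<zero>\<^bsub>Y\<^esub>" if "x \<in> carrier (P X)" for x
    using p_closed[OF OY lin_closed[OF h(1) that]] by auto
  let ?d = "\<lambda>x \<in> carrier (P X). q x \<ominus>\<^bsub>P Y\<^esub> r x"
  let ?k = "\<lambda>x \<in> carrier (P X). p (\<Omega> Y) (h x)"
  have k: "?k \<in> lin R (P X) (P Y)"
    using lin_simps[OF lin_comp_fun[OF P_Mods[OF X] h(1) p_lin[OF OY]]] by (intro linI) auto
  let ?e = "\<lambda>x \<in> carrier (P X). ?d x \<ominus>\<^bsub>P Y\<^esub> ?k x"
  have e: "?e \<in> lin R (P X) (P Y)"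
    using lin_minus[OF PX.left_module_axioms PY.left_module_axioms
        lin_minus[OF PX.left_module_axioms PY.left_module_axioms q(1) r(1)] k] .
  have "\<exists>w \<in> lin R X (P Y). \<forall>b \<in> carrier (P X). w (p X b) = ?e b"
  proof (rule lin_descend[OF PX.left_module_axioms X.left_module_axioms PY.left_module_axioms pX p_surj[OF X] e])
    fix b assume b: "b \<in> carrier (P X)" "p X b = \<zero>\<^bsub>X\<^esub>"
    then have "q b = r b \<oplus>\<^bsub>P Y\<^esub> p (\<Omega> Y) (h b)" using u(2)[of b] h(2)[of b] by simp
    then have "q b \<ominus>\<^bsub>P Y\<^esub> r b = p (\<Omega> Y) (h b)"
      using PY.add_diff_cancel[of "p (\<Omega> Y) (h b)" "r b"] PY.a_comm[of "r b"] ph[OF b(1)]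
        lin_closed[OF r(1) b(1)] by simp
    then show "?e b = \<zero>\<^bsub>P Y\<^esub>" using b PY.diff_zero_iff ph[OF b(1)] by simp
  qed
  then obtain w where w: "w \<in> lin R X (P Y)" "\<And>b. b \<in> carrier (P X) \<Longrightarrow> w (p X b) = ?e b"
    by blast
  have "steq X Y f g"
  proof (rule steqI[OF w(1)])
    fix x assume "x \<in> carrier X"
    then obtain b where b: "b \<in> carrier (P X)" "x = p X b" using p_surj[OF X] by auto
    note c = lin_closed[OF q(1) b(1)] lin_closed[OF r(1) b(1)] ph[OF b(1)]
    have "p Y (w x) = (p Y (q b) \<ominus>\<^bsub>Y\<^esub> p Y (r b)) \<ominus>\<^bsub>Y\<^esub> \<zero>\<^bsub>Y\<^esub>"
      using b c w(2)[OF b(1)] by (simp add: lin_diff[OF PY.left_module_axioms Y.left_module_axioms pY])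
    also have "\<dots> = f x \<ominus>\<^bsub>Y\<^esub> g x"
      using b q(2) r(2) lin_closed[OF f p_closed[OF X b(1)]] lin_closed[OF g p_closed[OF X b(1)]]
      by (simp add: a_minus_def)
    finally show "f x = g x \<oplus>\<^bsub>Y\<^esub> p Y (w x)"
      using b lin_closed[OF f p_closed[OF X b(1)]] lin_closed[OF g p_closed[OF X b(1)]]
        Y.diff_add_cancel[of "f x" "g x"] Y.a_comm[of "g x" "f x \<ominus>\<^bsub>Y\<^esub> g x"] by simp
  qed
  then show ?thesis using stable_arr_eq_iff[OF X Y f g] by blast
qed

text \<open>The map extends to \<open>P X \<rightarrow> P Y\<close> because \<open>P Y\<close> is injective, and then descends to quotients.\<close>

lemma Omega_full:
  assumes X: "X \<in> Mods R" and Y: "Y \<in> Mods R" and g: "g \<in> lin R (\<Omega> X) (\<Omega> Y)"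
  obtains f where "f \<in> lin R X Y" "Omega_arr R \<pi> (arr X Y f) = arr (\<Omega> X) (\<Omega> Y) g"
proof -
  note OX = Omega_Mods[OF X] and OY = Omega_Mods[OF Y]
  have gc: "g x \<in> carrier (P Y)" "p Y (g x) = \<zero>\<^bsub>Y\<^esub>" if "x \<in> carrier (\<Omega> X)" for x
    using lin_closed[OF g that] by auto
  have "g \<in> lin R (\<Omega> X) (P Y)"
    using lin_simps[OF g] lin_extensional[OF g] by (intro linI) auto
  then obtain q where q: "q \<in> lin R (P X) (P Y)" "\<And>a. a \<in> carrier (\<Omega> X) \<Longrightarrow> q a = g a"
    using extend_Omega[OF P_projective[OF Y] X] by metis
  have "\<exists>f \<in> lin R X Y. \<forall>b \<in> carrier (P X). f (p X b) = (\<lambda>x \<in> carrier (P X). p Y (q x)) b"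
  proof (rule lin_descend[OF Mods_left_module[OF P_Mods[OF X]] Mods_left_module[OF X] Mods_left_module[OF Y]
        p_lin[OF X] p_surj[OF X] lin_comp_fun[OF P_Mods[OF X] q(1) p_lin[OF Y]]])
    fix b assume "b \<in> carrier (P X)" "p X b = \<zero>\<^bsub>X\<^esub>"
    then show "(\<lambda>x \<in> carrier (P X). p Y (q x)) b = \<zero>\<^bsub>Y\<^esub>" using q(2)[of b] gc[of b] by simp
  qed
  then obtain f where f: "f \<in> lin R X Y"
    "\<And>b. b \<in> carrier (P X) \<Longrightarrow> f (p X b) = (\<lambda>x \<in> carrier (P X). p Y (q x)) b" by blast
  have "Omega_arr R \<pi> (arr X Y f) = arr (\<Omega> X) (\<Omega> Y) (restrict q (carrier (\<Omega> X)))"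
    by (rule Omega_arr_lift[OF X Y f(1) q(1)]) (use f(2) in simp)
  moreover have "restrict q (carrier (\<Omega> X)) = g"
    using q(2) lin_extensional[OF g] by (intro extensionalityI[of _ "carrier (\<Omega> X)"]) auto
  ultimately show thesis using that f by simp
qed

sublocale T: desusp_category T
proof (unfold_locales, goal_cases)
  case (1 f X Y)
  then show ?case using Homs_iff by (simp add: T_simps)
next
  case (2 X)
  then show ?case using Homs_iff lin_id[OF Mods_left_module, of X R] by (auto simp: T_simps)
next
  case (3 g Y Z f X)
  then show ?case by (elim HomsE) (auto simp: Cmp_arr intro: HomsI lin_comp_fun)
next
  case (4 h Z W g Y f X)
  from 4(1) obtain h' where h: "Z \<in> Mods R" "W \<in> Mods R" "h' \<in> lin R Z W" "h = arr Z W h'" by (rule HomsE)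
  from 4(2) obtain g' where g: "Y \<in> Mods R" "Z \<in> Mods R" "g' \<in> lin R Y Z" "g = arr Y Z g'" by (rule HomsE)
  from 4(3) obtain f' where f: "X \<in> Mods R" "Y \<in> Mods R" "f' \<in> lin R X Y" "f = arr X Y f'" by (rule HomsE)
  have "(\<lambda>x \<in> carrier X. (\<lambda>x \<in> carrier Y. h' (g' x)) (f' x)) = (\<lambda>x \<in> carrier X. h' ((\<lambda>x \<in> carrier X. g' (f' x)) x))"
    using lin_closed[OF f(3)] by auto
  then show ?case
    using f g h Cmp_arr lin_comp_fun[OF f(1) f(3) g(3)] lin_comp_fun[OF g(1) g(3) h(3)] by simp
next
  case (5 f X Y)
  from 5 obtain f' where f: "X \<in> Mods R" "Y \<in> Mods R" "f' \<in> lin R X Y" "f = arr X Y f'" by (rule HomsE)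
  have "(\<lambda>x \<in> carrier X. (\<lambda>x \<in> carrier Y. x) (f' x)) = f'"
    using lin_closed[OF f(3)] lin_extensional[OF f(3)] by (intro extensionalityI[of _ "carrier X"]) auto
  then show ?case
    using f Cmp_arr[OF f(1,2,2,3) lin_id[OF Mods_left_module[OF f(2)]]] by (simp add: T_simps)
next
  case (6 f X Y)
  from 6 obtain f' where f: "X \<in> Mods R" "Y \<in> Mods R" "f' \<in> lin R X Y" "f = arr X Y f'" by (rule HomsE)
  have "(\<lambda>x \<in> carrier X. f' ((\<lambda>x \<in> carrier X. x) x)) = f'"
    using lin_extensional[OF f(3)] by (intro extensionalityI[of _ "carrier X"]) auto
  then show ?case
    using f Cmp_arr[OF f(1,1,2) lin_id[OF Mods_left_module[OF f(1)]] f(3)] by (simp add: T_simps)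
next
  case (7 X Y)
  then show ?case
    using HomsI lin_const_zero[OF Mods_left_module Mods_left_module, of X R Y] by (simp add: T_simps)
next
  case (8 f X Y Z)
  from 8(1) obtain f' where f: "X \<in> Mods R" "Y \<in> Mods R" "f' \<in> lin R X Y" "f = arr X Y f'" by (rule HomsE)
  have Z: "Z \<in> Mods R" using 8(2) by (simp add: T_simps)
  have "(\<lambda>x \<in> carrier X. (\<lambda>x \<in> carrier Y. \<zero>\<^bsub>Z\<^esub>) (f' x)) = (\<lambda>x \<in> carrier X. \<zero>\<^bsub>Z\<^esub>)"
    using lin_closed[OF f(3)] by auto
  then show ?case
    using f Cmp_arr[OF f(1,2) Z f(3) lin_const_zero[OF Mods_left_module[OF f(2)] Mods_left_module[OF Z]]]
    by (simp add: T_simps)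
next
  case (9 f Y Z X)
  from 9(1) obtain f' where f: "Y \<in> Mods R" "Z \<in> Mods R" "f' \<in> lin R Y Z" "f = arr Y Z f'" by (rule HomsE)
  have X: "X \<in> Mods R" using 9(2) by (simp add: T_simps)
  have "(\<lambda>x \<in> carrier X. f' ((\<lambda>x \<in> carrier X. \<zero>\<^bsub>Y\<^esub>) x)) = (\<lambda>x \<in> carrier X. \<zero>\<^bsub>Z\<^esub>)"
    using lin_zero[OF Mods_left_module[OF f(1)] Mods_left_module[OF f(2)] f(3)] by auto
  then show ?case
    using f Cmp_arr[OF X f(1,2) lin_const_zero[OF Mods_left_module[OF X] Mods_left_module[OF f(1)]] f(3)]
    by (simp add: T_simps)
next
  case (10 X)
  then have X: "X \<in> Mods R" by (simp add: T_simps)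
  note PX = P_Mods[OF X]
  note PXm = Mods_left_module[OF PX]
  interpret PX: left_module R "P X" by (fact PXm)
  \<comment> \<open>A projective module is a zero object of the stable category.\<close>
  have "steq (P X) (P X) (\<lambda>x \<in> carrier (P X). x) (\<lambda>x \<in> carrier (P X). \<zero>\<^bsub>P X\<^esub>)"
    by (rule steq_projective[OF PX PX P_projective[OF X] lin_id[OF PXm] lin_id[OF PXm]]) simp
  then have "P X \<in> zero_objs T"
    using stable_arr_eq_iff[OF PX PX lin_id[OF PXm] lin_const_zero[OF PXm PXm]] PX
    by (simp add: zero_objs_def T_simps)
  then show ?case by blast
next
  case (11 X)
  then show ?case using Omega_Mods by (simp add: T_simps)
next
  case (12 f X Y)
  from 12 obtain f' where f: "X \<in> Mods R" "Y \<in> Mods R" "f' \<in> lin R X Y" "f = arr X Y f'" by (rule HomsE)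
  obtain q where q: "q \<in> lin R (P X) (P Y)" "\<And>x. x \<in> carrier (P X) \<Longrightarrow> p Y (q x) = f' (p X x)"
    using lift_exists[OF f(1-3)] by metis
  show ?case
    using f Omega_arr_lift[OF f(1-3) q] lift_Omega[OF f(1-3) q] HomsI Omega_Mods by (simp add: T_simps)
next
  case (13 g Y Z f X)
  from 13(1) obtain g' where g: "Y \<in> Mods R" "Z \<in> Mods R" "g' \<in> lin R Y Z" "g = arr Y Z g'" by (rule HomsE)
  from 13(2) obtain f' where f: "X \<in> Mods R" "Y \<in> Mods R" "f' \<in> lin R X Y" "f = arr X Y f'" by (rule HomsE)
  obtain q where q: "q \<in> lin R (P X) (P Y)" "\<And>x. x \<in> carrier (P X) \<Longrightarrow> p Y (q x) = f' (p X x)"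
    using lift_exists[OF f(1-3)] by metis
  obtain r where r: "r \<in> lin R (P Y) (P Z)" "\<And>x. x \<in> carrier (P Y) \<Longrightarrow> p Z (r x) = g' (p Y x)"
    using lift_exists[OF g(1-3)] by metis
  let ?rq = "\<lambda>x \<in> carrier (P X). r (q x)"
  have "Omega_arr R \<pi> (arr X Z (\<lambda>x \<in> carrier X. g' (f' x))) = arr (\<Omega> X) (\<Omega> Z) (restrict ?rq (carrier (\<Omega> X)))"
    by (rule Omega_arr_lift[OF f(1) g(2) lin_comp_fun[OF f(1,3) g(3)] lin_comp_fun[OF P_Mods[OF f(1)] q(1) r(1)]])
      (use q(2) r(2) lin_closed[OF q(1)] p_closed[OF f(1)] in simp)
  also have "restrict ?rq (carrier (\<Omega> X)) =
      (\<lambda>x \<in> carrier (\<Omega> X). restrict r (carrier (\<Omega> Y)) (restrict q (carrier (\<Omega> X)) x))"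
    using lin_closed[OF lift_Omega[OF f(1-3) q]] by auto
  finally show ?case
    using Cmp_arr[OF f(1,2) g(2) f(3) g(3)] Omega_arr_lift[OF f(1-3) q] Omega_arr_lift[OF g(1-3) r]
      Cmp_arr[OF Omega_Mods[OF f(1)] Omega_Mods[OF f(2)] Omega_Mods[OF g(2)]
        lift_Omega[OF f(1-3) q] lift_Omega[OF g(1-3) r]] f g
    by (simp add: T_simps(7) del: Omega_simps restrict_apply)
next
  case (14 X)
  then have X: "X \<in> Mods R" by (simp add: T_simps)
  have "Omega_arr R \<pi> (arr X X (\<lambda>x \<in> carrier X. x)) =
      arr (\<Omega> X) (\<Omega> X) (restrict (\<lambda>x \<in> carrier (P X). x) (carrier (\<Omega> X)))"
    by (rule Omega_arr_lift[OF X X lin_id[OF Mods_left_module[OF X]] lin_id[OF Mods_left_module[OF P_Mods[OF X]]]])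
      (use p_closed[OF X] in simp)
  also have "restrict (\<lambda>x \<in> carrier (P X). x) (carrier (\<Omega> X)) = (\<lambda>x \<in> carrier (\<Omega> X). x)" by auto
  finally show ?case by (simp add: T_simps del: restrict_apply)
next
  case (15 X Y)
  then have X: "X \<in> Mods R" and Y: "Y \<in> Mods R" by (simp_all add: T_simps)
  have "Omega_arr R \<pi> (arr X Y (\<lambda>x \<in> carrier X. \<zero>\<^bsub>Y\<^esub>)) =
      arr (\<Omega> X) (\<Omega> Y) (restrict (\<lambda>x \<in> carrier (P X). \<zero>\<^bsub>P Y\<^esub>) (carrier (\<Omega> X)))"
    by (rule Omega_arr_lift[OF X Y lin_const_zero[OF Mods_left_module[OF X] Mods_left_module[OF Y]]
          lin_const_zero[OF Mods_left_module[OF P_Mods[OF X]] Mods_left_module[OF P_Mods[OF Y]]]])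
      (use p_closed[OF X] lin_zero[OF Mods_left_module[OF P_Mods[OF Y]] Mods_left_module[OF Y] p_lin[OF Y]] in simp)
  also have "restrict (\<lambda>x \<in> carrier (P X). \<zero>\<^bsub>P Y\<^esub>) (carrier (\<Omega> X)) = (\<lambda>x \<in> carrier (\<Omega> X). \<zero>\<^bsub>\<Omega> Y\<^esub>)" by auto
  finally show ?case by (simp add: T_simps del: restrict_apply)
next
  case (16 X Y g)
  then have X: "X \<in> Mods R" and Y: "Y \<in> Mods R" by (simp_all add: T_simps)
  from 16(3) obtain g' where g: "g' \<in> lin R (\<Omega> X) (\<Omega> Y)" "g = arr (\<Omega> X) (\<Omega> Y) g'"
    unfolding T_simps by (rule HomsE)
  from g(1) obtain f where "f \<in> lin R X Y" "Omega_arr R \<pi> (arr X Y f) = arr (\<Omega> X) (\<Omega> Y) g'"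
    by (rule Omega_full[OF X Y])
  then show ?case using g(2) HomsI[OF X Y] by (metis T_simps(7))
next
  case (17 f X Y g)
  then show ?case using Omega_faithful by (elim HomsE) (auto simp: T_simps)
qed

end

section \<open>Triangles from short exact sequences\<close>

context frobenius_modules
begin

lemma p_zero: "Y \<in> Mods R \<Longrightarrow> p Y \<zero>\<^bsub>P Y\<^esub> = \<zero>\<^bsub>Y\<^esub>"
  using lin_zero[OF Mods_left_module[OF P_Mods] Mods_left_module p_lin, of Y] by blast

lemma Cmp_zero_iff:
  assumes X: "X \<in> Mods R" and Y: "Y \<in> Mods R" and Z: "Z \<in> Mods R"
    and f: "f \<in> lin R X Y" and g: "g \<in> lin R Y Z"
  shows "arr Y Z g \<cdot>\<^bsub>T\<^esub> arr X Y f = ZeroA T X Z \<longleftrightarrow>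
    (\<exists>u \<in> lin R X (P Z). \<forall>x \<in> carrier X. g (f x) = p Z (u x))"
proof -
  interpret Z: left_module R Z using Z by (rule Mods_left_module)
  have "(\<lambda>x \<in> carrier X. g (f x)) x = (\<lambda>x \<in> carrier X. \<zero>\<^bsub>Z\<^esub>) x \<oplus>\<^bsub>Z\<^esub> p Z (u x) \<longleftrightarrow> g (f x) = p Z (u x)"
    if "x \<in> carrier X" "u \<in> lin R X (P Z)" for x u
    using that p_closed[OF Z lin_closed[OF that(2,1)]] by simp
  then have "steq X Z (\<lambda>x \<in> carrier X. g (f x)) (\<lambda>x \<in> carrier X. \<zero>\<^bsub>Z\<^esub>) \<longleftrightarrow>
    (\<exists>u \<in> lin R X (P Z). \<forall>x \<in> carrier X. g (f x) = p Z (u x))"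
    unfolding steq_def by blast
  then show ?thesis
    using Cmp_arr[OF X Y Z f g] stable_arr_eq_iff[OF X Z lin_comp_fun[OF X f g]
        lin_const_zero[OF Mods_left_module[OF X] Z.left_module_axioms]] by (simp add: T_simps(5))
qed

lemma arr_factorI:
  assumes X: "X \<in> Mods R" and Y: "Y \<in> Mods R" and Z: "Z \<in> Mods R"
    and f: "f \<in> lin R X Y" and g: "g \<in> lin R Y Z" and h: "h \<in> lin R X Z"
    and u: "u \<in> lin R X (P Z)" and eq: "\<And>x. x \<in> carrier X \<Longrightarrow> h x = g (f x) \<oplus>\<^bsub>Z\<^esub> p Z (u x)"
  shows "arr X Z h = arr Y Z g \<cdot>\<^bsub>T\<^esub> arr X Y f"
  using Cmp_arr[OF X Y Z f g] stable_arr_eq_iff[OF X Z h lin_comp_fun[OF X f g]] steqI[OF u] eq by simp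

end

locale short_exact = frobenius_modules R \<pi>
  for R :: "('r, 'x) ring_scheme" and \<pi> :: "('r, 'm) presentation" +
  fixes A B C :: "('r, 'm) module" and f g :: "'m \<Rightarrow> 'm"
  assumes AM: "A \<in> Mods R" and BM: "B \<in> Mods R" and CM: "C \<in> Mods R"
    and f: "f \<in> lin R A B" and g: "g \<in> lin R B C"
    and inj: "inj_on f (carrier A)" and image: "f ` carrier A = a_kernel B C g"
    and surj: "g ` carrier B = carrier C"
begin

sublocale A: left_module R A by (rule Mods_left_module[OF AM])
sublocale B: left_module R B by (rule Mods_left_module[OF BM])
sublocale C: left_module R C by (rule Mods_left_module[OF CM])
sublocale PB: left_module R "P B" by (rule Mods_left_module[OF P_Mods[OF BM]])
sublocale PC: left_module R "P C" by (rule Mods_left_module[OF P_Mods[OF CM]])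
sublocale PA: left_module R "P A" by (rule Mods_left_module[OF P_Mods[OF AM]])

lemmas Am = A.left_module_axioms and Bm = B.left_module_axioms and Cm = C.left_module_axioms
lemmas fc = lin_closed[OF f] and gc = lin_closed[OF g]

lemma gf: "a \<in> carrier A \<Longrightarrow> g (f a) = \<zero>\<^bsub>C\<^esub>"
  using image by (auto simp: a_kernel_def')

lemma kernel_image: "\<lbrakk>b \<in> carrier B; g b = \<zero>\<^bsub>C\<^esub>\<rbrakk> \<Longrightarrow> b \<in> f ` carrier A"
  unfolding image by (simp add: a_kernel_def')

lemma f_eqD: "\<lbrakk>a \<in> carrier A; a' \<in> carrier A; f a = f a'\<rbrakk> \<Longrightarrow> a = a'"
  using inj by (rule inj_onD)

lemma factor_kernel:
  assumes "left_module R X" "t \<in> lin R X B" "\<And>x. x \<in> carrier X \<Longrightarrow> g (t x) = \<zero>\<^bsub>C\<^esub>"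
  shows "\<exists>s \<in> lin R X A. \<forall>x \<in> carrier X. f (s x) = t x"
  by (rule lin_corestrict[OF Am Bm assms(1) f inj assms(2)])
    (use kernel_image lin_closed[OF assms(2)] assms(3) in blast)

lemma lift_exists_C:
  obtains l where "l \<in> lin R (P C) B" "\<And>x. x \<in> carrier (P C) \<Longrightarrow> g (l x) = p C x"
  using lift[OF P_projective[OF CM] BM CM g surj p_lin[OF CM]] by metis

lemma connecting_map:
  assumes l: "l \<in> lin R (P C) B" "\<And>x. x \<in> carrier (P C) \<Longrightarrow> g (l x) = p C x"
  obtains d where "d \<in> lin R (\<Omega> C) A" "\<And>x. x \<in> carrier (\<Omega> C) \<Longrightarrow> f (d x) = l x"
proof -
  obtain d where d: "d \<in> lin R (\<Omega> C) A"
    "\<And>x. x \<in> carrier (\<Omega> C) \<Longrightarrow> f (d x) = restrict l (carrier (\<Omega> C)) x"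
    using factor_kernel[OF Mods_left_module[OF Omega_Mods[OF CM]] lin_from_Omega[OF CM l(1)]] l(2)
    by fastforce
  then show thesis by (intro that[of d]) auto
qed

text \<open>The next five lemmas are the exactness properties of the triangle of a short exact sequence,
  in terms of maps of modules. Here the surjectivity of \<open>g\<close> suffices: a factorization of \<open>g t\<close>
  through \<open>P C\<close> lifts to \<open>B\<close>, and what remains of \<open>t\<close> lands in the kernel of \<open>g\<close>.\<close>

lemma module_weak_kernel:
  assumes S: "S \<in> Mods R" and t: "t \<in> lin R S B" and u: "u \<in> lin R S (P C)"
    and eq: "\<And>x. x \<in> carrier S \<Longrightarrow> g (t x) = p C (u x)"
  shows "\<exists>r \<in> lin R S A. \<exists>w \<in> lin R S (P B). \<forall>x \<in> carrier S. t x = f (r x) \<oplus>\<^bsub>B\<^esub> p B (w x)"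
proof -
  obtain l where l: "l \<in> lin R (P C) B" "\<And>x. x \<in> carrier (P C) \<Longrightarrow> g (l x) = p C x"
    using lift_exists_C by metis
  obtain L where L: "L \<in> lin R (P C) (P B)" "\<And>x. x \<in> carrier (P C) \<Longrightarrow> p B (L x) = l x"
    using lift_p[OF P_projective[OF CM] BM l(1)] by metis
  note lu = lin_comp_fun[OF S u l(1)]
  note t' = lin_minus[OF Mods_left_module[OF S] Bm t lu]
  have c: "t x \<in> carrier B" "l (u x) \<in> carrier B" "u x \<in> carrier (P C)" if "x \<in> carrier S" for x
    using that lin_closed[OF t] lin_closed[OF l(1)] lin_closed[OF u] by auto
  have "g ((\<lambda>x\<in>carrier S. t x \<ominus>\<^bsub>B\<^esub> (\<lambda>x\<in>carrier S. l (u x)) x) x) = \<zero>\<^bsub>C\<^esub>" if x: "x \<in> carrier S" for x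
    using x c[OF x] eq[OF x] l(2) lin_diff[OF Bm Cm g] C.diff_zero_iff p_closed[OF CM] by simp
  from factor_kernel[OF Mods_left_module[OF S] t' this] obtain r where r: "r \<in> lin R S A"
    "\<And>x. x \<in> carrier S \<Longrightarrow> f (r x) = (\<lambda>x\<in>carrier S. t x \<ominus>\<^bsub>B\<^esub> (\<lambda>x\<in>carrier S. l (u x)) x) x"
    by blast
  have "t x = f (r x) \<oplus>\<^bsub>B\<^esub> p B ((\<lambda>x\<in>carrier S. L (u x)) x)" if x: "x \<in> carrier S" for x
    using x r(2)[OF x] L(2) c[OF x] B.diff_add_cancel by simp
  then show ?thesis using r(1) lin_comp_fun[OF S u L(1)] by blast
qed

text \<open>The dual argument: the factorization of \<open>h f\<close> through \<open>P S\<close> extends along \<open>f\<close> by injectivity.\<close>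

lemma module_weak_cokernel:
  assumes S: "S \<in> Mods R" and h: "h \<in> lin R B S" and u: "u \<in> lin R A (P S)"
    and eq: "\<And>a. a \<in> carrier A \<Longrightarrow> h (f a) = p S (u a)"
  shows "\<exists>r \<in> lin R C S. \<exists>w \<in> lin R B (P S). \<forall>b \<in> carrier B. h b = r (g b) \<oplus>\<^bsub>S\<^esub> p S (w b)"
proof -
  interpret S: left_module R S using S by (rule Mods_left_module)
  obtain w where w: "w \<in> lin R B (P S)" "\<And>a. a \<in> carrier A \<Longrightarrow> w (f a) = u a"
    using extend[OF P_projective[OF S] AM BM f inj u] by metis
  note pw = lin_comp_fun[OF BM w(1) p_lin[OF S]]
  note h' = lin_minus[OF Bm S.left_module_axioms h pw]
  have c: "h b \<in> carrier S" "p S (w b) \<in> carrier S" if "b \<in> carrier B" for b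
    using that lin_closed[OF h] lin_closed[OF w(1)] p_closed[OF S] by auto
  have "\<exists>r \<in> lin R C S. \<forall>b \<in> carrier B. r (g b) =
    (\<lambda>x\<in>carrier B. h x \<ominus>\<^bsub>S\<^esub> (\<lambda>x\<in>carrier B. p S (w x)) x) b"
  proof (rule lin_descend[OF Bm Cm S.left_module_axioms g surj h'])
    fix b assume b: "b \<in> carrier B" "g b = \<zero>\<^bsub>C\<^esub>"
    then obtain a where "a \<in> carrier A" "b = f a" using kernel_image by blast
    then show "(\<lambda>x\<in>carrier B. h x \<ominus>\<^bsub>S\<^esub> (\<lambda>x\<in>carrier B. p S (w x)) x) b = \<zero>\<^bsub>S\<^esub>"
      using b eq w(2) S.diff_zero_iff c[OF b(1)] by simp
  qed
  then obtain r where r: "r \<in> lin R C S" "\<And>b. b \<in> carrier B \<Longrightarrow> r (g b) = h b \<ominus>\<^bsub>S\<^esub> p S (w b)"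
    by auto
  have "h b = r (g b) \<oplus>\<^bsub>S\<^esub> p S (w b)" if b: "b \<in> carrier B" for b
    using r(2)[OF b] S.diff_add_cancel c[OF b] by simp
  then show ?thesis using r(1) w(1) by blast
qed

end

locale standard_triangle = short_exact R \<pi> A B C f g
  for R :: "('r, 'x) ring_scheme" and \<pi> :: "('r, 'm) presentation" and A B C f g +
  fixes l d :: "'m \<Rightarrow> 'm"
  assumes l: "l \<in> lin R (P C) B" "\<And>x. x \<in> carrier (P C) \<Longrightarrow> g (l x) = p C x"
    and d: "d \<in> lin R (\<Omega> C) A" "\<And>x. x \<in> carrier (\<Omega> C) \<Longrightarrow> f (d x) = l x"
begin

text \<open>\<open>B\<close> is the pushout of \<open>d\<close> along the inclusion of \<open>\<Omega>C\<close> in \<open>P C\<close>: every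
  element of \<open>B\<close> is \<open>f a + l q\<close>, where \<open>(a, q)\<close> is unique up to \<open>(- d x, x)\<close> with \<open>x\<close> in \<open>\<Omega>C\<close>. So
  \<open>h\<close> on \<open>A\<close> and an extension \<open>e\<close> of \<open>h d\<close> to \<open>P C\<close> combine to a map on \<open>B\<close>.\<close>

lemma module_connecting_weak_cokernel:
  assumes S: "S \<in> Mods R" and h: "h \<in> lin R A S" and u: "u \<in> lin R (\<Omega> C) (P S)"
    and eq: "\<And>x. x \<in> carrier (\<Omega> C) \<Longrightarrow> h (d x) = p S (u x)"
  shows "\<exists>r \<in> lin R B S. \<forall>a \<in> carrier A. h a = r (f a)"
proof -
  interpret S: left_module R S using S by (rule Mods_left_module)
  interpret OC: left_module R "\<Omega> C" using Omega_Mods[OF CM] by (rule Mods_left_module)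
  obtain w where w: "w \<in> lin R (P C) (P S)" "\<And>a. a \<in> carrier (\<Omega> C) \<Longrightarrow> w a = u a"
    using extend_Omega[OF P_projective[OF S] CM u] by metis
  define e where "e = (\<lambda>x \<in> carrier (P C). p S (w x))"
  have e: "e \<in> lin R (P C) S" unfolding e_def using lin_comp_fun[OF P_Mods[OF CM] w(1) p_lin[OF S]] .
  note lc = lin_closed[OF l(1)] and hc = lin_closed[OF h] and ec = lin_closed[OF e]
  let ?D = "\<lambda>b z. \<exists>a \<in> carrier A. \<exists>q \<in> carrier (P C). b = f a \<oplus>\<^bsub>B\<^esub> l q \<and> z = h a \<oplus>\<^bsub>S\<^esub> e q"
  have D: "?D (f a \<oplus>\<^bsub>B\<^esub> l q) (h a \<oplus>\<^bsub>S\<^esub> e q)" if "a \<in> carrier A" "q \<in> carrier (P C)" for a q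
    using that by blast
  obtain r where r: "r \<in> lin R B S" "\<And>b z. ?D b z \<Longrightarrow> r b = z"
  proof (rule lin_of_relation[OF Bm S.left_module_axioms, where D = ?D], goal_cases)
    case (1 c z)
    then show ?case using fc lc hc ec by auto
  next
    case (2 b)
    then obtain q where q: "q \<in> carrier (P C)" "p C q = g b" using p_surj[OF CM] gc by (metis imageE)
    have "g (b \<ominus>\<^bsub>B\<^esub> l q) = \<zero>\<^bsub>C\<^esub>"
      using 2 q lc[OF q(1)] l(2)[OF q(1)] lin_diff[OF Bm Cm g] C.diff_zero_iff gc by simp
    then obtain a where a: "a \<in> carrier A" "f a = b \<ominus>\<^bsub>B\<^esub> l q"
      using kernel_image[of "b \<ominus>\<^bsub>B\<^esub> l q"] 2 lc[OF q(1)] by auto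
    then show ?case using D[OF a(1) q(1)] B.diff_add_cancel 2 lc[OF q(1)] by auto
  next
    case (3 b z b' z')
    then obtain a q a' q' where m: "a \<in> carrier A" "q \<in> carrier (P C)" "a' \<in> carrier A" "q' \<in> carrier (P C)"
      and e: "b = f a \<oplus>\<^bsub>B\<^esub> l q" "z = h a \<oplus>\<^bsub>S\<^esub> e q" "b' = f a' \<oplus>\<^bsub>B\<^esub> l q'" "z' = h a' \<oplus>\<^bsub>S\<^esub> e q'"
      by blast
    then show ?case
      using D[of "a \<oplus>\<^bsub>A\<^esub> a'" "q \<oplus>\<^bsub>P C\<^esub> q'"] fc lc hc ec
      by (simp add: lin_add[OF f] lin_add[OF h] lin_add[OF l(1)] lin_add[OF \<open>e \<in> lin R (P C) S\<close>]
          B.add_add_add S.add_add_add)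
  next
    case (4 c b z)
    then obtain a q where m: "a \<in> carrier A" "q \<in> carrier (P C)"
      and e: "b = f a \<oplus>\<^bsub>B\<^esub> l q" "z = h a \<oplus>\<^bsub>S\<^esub> e q" by blast
    then show ?case
      using 4(2) D[of "c \<odot>\<^bsub>A\<^esub> a" "c \<odot>\<^bsub>P C\<^esub> q"] fc lc hc ec
      by (simp add: lin_smult[OF f] lin_smult[OF h] lin_smult[OF l(1)] lin_smult[OF \<open>e \<in> lin R (P C) S\<close>]
          B.smult_r_distr S.smult_r_distr A.smult_closed PC.smult_closed)
  next
    case (5 z)
    then obtain a q where m: "a \<in> carrier A" "q \<in> carrier (P C)"
      and eqs: "f a \<oplus>\<^bsub>B\<^esub> l q = \<zero>\<^bsub>B\<^esub>" "z = h a \<oplus>\<^bsub>S\<^esub> e q" by metis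
    have "p C q = g (f a \<oplus>\<^bsub>B\<^esub> l q)"
      using m fc lc l(2) gf p_closed[OF CM] by (simp add: lin_add[OF g])
    then have q: "q \<in> carrier (\<Omega> C)" using eqs(1) m lin_zero[OF Bm Cm g] by simp
    have dq: "d q \<in> carrier A" using lin_closed[OF d(1) q] .
    have "f (a \<oplus>\<^bsub>A\<^esub> d q) = f \<zero>\<^bsub>A\<^esub>"
      using eqs(1) m dq d(2)[OF q] lin_zero[OF Am Bm f] by (simp add: lin_add[OF f])
    then have "a \<oplus>\<^bsub>A\<^esub> d q = \<zero>\<^bsub>A\<^esub>" using f_eqD m dq by blast
    moreover have "z = h (a \<oplus>\<^bsub>A\<^esub> d q)"
      using eqs(2) m dq eq[OF q] w(2)[OF q] by (simp add: lin_add[OF h] e_def)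
    ultimately show ?case using lin_zero[OF Am S.left_module_axioms h] by simp
  next
    case (6 f)
    show ?case by (rule 6(1)[OF 6(2,3)])
  qed
  have "h a = r (f a)" if a: "a \<in> carrier A" for a
  proof -
    have "?D (f a) (h a)"
      using D[OF a PC.zero_closed] a fc hc lin_zero[OF PC.left_module_axioms Bm l(1)]
        lin_zero[OF PC.left_module_axioms S.left_module_axioms e] by simp
    then show ?thesis using r(2) by simp
  qed
  then show ?thesis using r(1) by blast
qed

text \<open>On all of \<open>P B\<close>, \<open>l q\<close> and \<open>p\<close> differ by a map into \<open>f(A)\<close>; as \<open>p\<close> vanishes on \<open>\<Omega>B\<close>, this map
  extends \<open>d q\<close> from \<open>\<Omega>B\<close> to \<open>P B\<close>.\<close>

lemma module_connecting_zero:
  assumes q: "q \<in> lin R (P B) (P C)" "\<And>x. x \<in> carrier (P B) \<Longrightarrow> p C (q x) = g (p B x)"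
  shows "\<exists>w \<in> lin R (\<Omega> B) (P A). \<forall>x \<in> carrier (\<Omega> B). d (q x) = p A (w x)"
proof -
  note lq = lin_comp_fun[OF P_Mods[OF BM] q(1) l(1)]
  note m = lin_minus[OF PB.left_module_axioms Bm lq p_lin[OF BM]]
  have c: "q x \<in> carrier (P C)" "l (q x) \<in> carrier B" "p B x \<in> carrier B" if "x \<in> carrier (P B)" for x
    using that lin_closed[OF q(1)] lin_closed[OF l(1)] p_closed[OF BM] by auto
  have "\<exists>s \<in> lin R (P B) A. \<forall>x \<in> carrier (P B).
      f (s x) = (\<lambda>x\<in>carrier (P B). (\<lambda>x\<in>carrier (P B). l (q x)) x \<ominus>\<^bsub>B\<^esub> p B x) x"
  proof (rule factor_kernel[OF PB.left_module_axioms m])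
    fix x assume x: "x \<in> carrier (P B)"
    then show "g ((\<lambda>x\<in>carrier (P B). (\<lambda>x\<in>carrier (P B). l (q x)) x \<ominus>\<^bsub>B\<^esub> p B x) x) = \<zero>\<^bsub>C\<^esub>"
      using c[OF x] q(2)[OF x] l(2) gc C.diff_zero_iff by (simp add: lin_diff[OF Bm Cm g])
  qed
  then obtain s where s: "s \<in> lin R (P B) A" "\<And>x. x \<in> carrier (P B) \<Longrightarrow>
      f (s x) = (\<lambda>x\<in>carrier (P B). (\<lambda>x\<in>carrier (P B). l (q x)) x \<ominus>\<^bsub>B\<^esub> p B x) x" by blast
  obtain w where w: "w \<in> lin R (P B) (P A)" "\<And>x. x \<in> carrier (P B) \<Longrightarrow> p A (w x) = s x"
    using lift_p[OF P_projective[OF BM] AM s(1)] by metis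
  have "d (q x) = p A (restrict w (carrier (\<Omega> B)) x)" if x: "x \<in> carrier (\<Omega> B)" for x
  proof -
    have x': "x \<in> carrier (P B)" "p B x = \<zero>\<^bsub>B\<^esub>" using x by auto
    have qx: "q x \<in> carrier (\<Omega> C)" using x' q(2)[OF x'(1)] c[OF x'(1)] lin_zero[OF Bm Cm g] by simp
    have "f (s x) = l (q x)" using s(2)[OF x'(1)] x' c[OF x'(1)] by (simp add: a_minus_def)
    then have "f (s x) = f (d (q x))" using d(2)[OF qx] by simp
    then have "s x = d (q x)" using f_eqD lin_closed[OF s(1) x'(1)] lin_closed[OF d(1) qx] by blast
    then show ?thesis using w(2)[OF x'(1)] x by simp
  qed
  then show ?thesis using lin_from_Omega[OF BM w(1)] by blast
qed

text \<open>Let \<open>L\<close> lift \<open>l\<close> to \<open>P C \<rightarrow> P B\<close>. For \<open>c\<close> in \<open>\<Omega>C\<close> and \<open>a\<close> in \<open>P A\<close> over \<open>d c\<close>, the element \<open>L c - F a\<close> lies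
  in \<open>\<Omega>B\<close>, and \<open>a\<close> is unique up to \<open>\<Omega>A\<close>, where \<open>h F\<close> extends to a map \<open>e\<close> on \<open>P A\<close>. Hence
  \<open>r c = h(L c - F a) + e a\<close> is well defined. The difference between \<open>h\<close> and \<open>r G\<close> extends from \<open>\<Omega>B\<close> to
  \<open>P B\<close>: with \<open>N : P B \<rightarrow> P A\<close> lifting \<open>p - l G\<close>, it is \<open>h n + e N\<close>, where \<open>n x = x - L G x - F N x\<close>
  lies in \<open>\<Omega>B\<close> for every \<open>x\<close>.\<close>

lemma module_Omega_weak_cokernel:
  assumes S: "S \<in> Mods R" and h: "h \<in> lin R (\<Omega> B) S" and u: "u \<in> lin R (\<Omega> A) (P S)"
    and F: "F \<in> lin R (P A) (P B)" "\<And>x. x \<in> carrier (P A) \<Longrightarrow> p B (F x) = f (p A x)"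
    and G: "G \<in> lin R (P B) (P C)" "\<And>x. x \<in> carrier (P B) \<Longrightarrow> p C (G x) = g (p B x)"
    and eq: "\<And>x. x \<in> carrier (\<Omega> A) \<Longrightarrow> h (F x) = p S (u x)"
  shows "\<exists>r \<in> lin R (\<Omega> C) S. \<exists>w \<in> lin R (\<Omega> B) (P S).
    \<forall>x \<in> carrier (\<Omega> B). h x = r (G x) \<oplus>\<^bsub>S\<^esub> p S (w x)"
proof -
  interpret S: left_module R S using S by (rule Mods_left_module)
  interpret PS: left_module R "P S" using P_Mods[OF S] by (rule Mods_left_module)
  interpret OC: left_module R "\<Omega> C" using Omega_Mods[OF CM] by (rule Mods_left_module)
  interpret OB: left_module R "\<Omega> B" using Omega_Mods[OF BM] by (rule Mods_left_module)
  note pA = p_lin[OF AM] and pB = p_lin[OF BM]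
  note pBm = PB.left_module_axioms
  obtain w where w: "w \<in> lin R (P A) (P S)" "\<And>a. a \<in> carrier (\<Omega> A) \<Longrightarrow> w a = u a"
    using extend_Omega[OF P_projective[OF S] AM u] by metis
  define e where "e = (\<lambda>x \<in> carrier (P A). p S (w x))"
  have e: "e \<in> lin R (P A) S" unfolding e_def using lin_comp_fun[OF P_Mods[OF AM] w(1) p_lin[OF S]] .
  obtain L where L: "L \<in> lin R (P C) (P B)" "\<And>x. x \<in> carrier (P C) \<Longrightarrow> p B (L x) = l x"
    using lift_p[OF P_projective[OF CM] BM l(1)] by metis
  note Lc = lin_closed[OF L(1)] and Fc = lin_closed[OF F(1)] and Gc = lin_closed[OF G(1)]
    and hc = lin_closed[OF h] and ec = lin_closed[OF e] and dc = lin_closed[OF d(1)]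
  let ?ok = "\<lambda>c a. c \<in> carrier (\<Omega> C) \<and> a \<in> carrier (P A) \<and> p A a = d c"
  let ?x = "\<lambda>c a. L c \<ominus>\<^bsub>P B\<^esub> F a"
  let ?D = "\<lambda>c z. \<exists>a. ?ok c a \<and> z = h (?x c a) \<oplus>\<^bsub>S\<^esub> e a"
  have xc: "?x c a \<in> carrier (\<Omega> B)" if "?ok c a" for c a
  proof -
    have "p B (?x c a) = l c \<ominus>\<^bsub>B\<^esub> f (d c)"
      using that L(2) F(2) Lc Fc by (simp add: lin_diff[OF pBm Bm pB])
    also have "\<dots> = \<zero>\<^bsub>B\<^esub>" using that d(2)[of c] B.diff_zero_iff[of "l c" "l c"] lin_closed[OF l(1)] by simp
    finally show ?thesis using that Lc Fc by simp
  qed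
  have D: "?D c (h (?x c a) \<oplus>\<^bsub>S\<^esub> e a)" if "?ok c a" for c a using that by blast
  obtain r where r: "r \<in> lin R (\<Omega> C) S" "\<And>c z. ?D c z \<Longrightarrow> r c = z"
  proof (rule lin_of_relation[OF OC.left_module_axioms S.left_module_axioms, where D = ?D], goal_cases)
    case (1 c z)
    then show ?case using xc hc ec by blast
  next
    case (2 c)
    then obtain a where "a \<in> carrier (P A)" "p A a = d c" using p_surj[OF AM] dc by (metis imageE)
    then show ?case using 2 by blast
  next
    case (3 c z c' z')
    then obtain a a' where m: "?ok c a" "?ok c' a'"
      and zz: "z = h (?x c a) \<oplus>\<^bsub>S\<^esub> e a" "z' = h (?x c' a') \<oplus>\<^bsub>S\<^esub> e a'" by blast
    have ok: "?ok (c \<oplus>\<^bsub>\<Omega> C\<^esub> c') (a \<oplus>\<^bsub>P A\<^esub> a')"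
      using m OC.a_closed[of c c'] lin_add[OF pA] lin_add[OF d(1), of c c'] by simp
    have "?x (c \<oplus>\<^bsub>\<Omega> C\<^esub> c') (a \<oplus>\<^bsub>P A\<^esub> a') = ?x c a \<oplus>\<^bsub>\<Omega> B\<^esub> ?x c' a'"
      using m Lc Fc by (simp add: lin_add[OF L(1)] lin_add[OF F(1)] PB.add_diff_add)
    then have "h (?x (c \<oplus>\<^bsub>\<Omega> C\<^esub> c') (a \<oplus>\<^bsub>P A\<^esub> a')) \<oplus>\<^bsub>S\<^esub> e (a \<oplus>\<^bsub>P A\<^esub> a') = z \<oplus>\<^bsub>S\<^esub> z'"
      using m zz xc[OF m(1)] xc[OF m(2)] hc ec
      by (simp add: lin_add[OF h] lin_add[OF e] S.add_add_add del: Omega_simps)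
    then show ?case using D[OF ok] by simp
  next
    case (4 k c z)
    then obtain a where m: "?ok c a" and zz: "z = h (?x c a) \<oplus>\<^bsub>S\<^esub> e a" by blast
    have ok: "?ok (k \<odot>\<^bsub>\<Omega> C\<^esub> c) (k \<odot>\<^bsub>P A\<^esub> a)"
      using m 4(2) OC.smult_closed[of k c] lin_smult[OF pA] lin_smult[OF d(1), of k c] PA.smult_closed
      by simp
    have "?x (k \<odot>\<^bsub>\<Omega> C\<^esub> c) (k \<odot>\<^bsub>P A\<^esub> a) = k \<odot>\<^bsub>\<Omega> B\<^esub> ?x c a"
      using m 4(2) Lc Fc by (simp add: lin_smult[OF L(1)] lin_smult[OF F(1)] PB.smult_diff)
    then have "h (?x (k \<odot>\<^bsub>\<Omega> C\<^esub> c) (k \<odot>\<^bsub>P A\<^esub> a)) \<oplus>\<^bsub>S\<^esub> e (k \<odot>\<^bsub>P A\<^esub> a) = k \<odot>\<^bsub>S\<^esub> z"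
      using m zz 4(2) xc[OF m] hc ec
      by (simp add: lin_smult[OF h] lin_smult[OF e] S.smult_r_distr del: Omega_simps)
    then show ?case using D[OF ok] by simp
  next
    case (5 z)
    then obtain a where m: "?ok \<zero>\<^bsub>\<Omega> C\<^esub> a" and zz: "z = h (?x \<zero>\<^bsub>\<Omega> C\<^esub> a) \<oplus>\<^bsub>S\<^esub> e a" by blast
    have a: "a \<in> carrier (\<Omega> A)" using m lin_zero[OF OC.left_module_axioms Am d(1)] by simp
    have L0: "L \<zero>\<^bsub>P C\<^esub> = \<zero>\<^bsub>P B\<^esub>" using lin_zero[OF PC.left_module_axioms pBm L(1)] .
    have x0: "?x \<zero>\<^bsub>\<Omega> C\<^esub> a \<oplus>\<^bsub>\<Omega> B\<^esub> F a = \<zero>\<^bsub>\<Omega> B\<^esub>"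
      using L0 Fc m PB.diff_add_cancel[of "\<zero>\<^bsub>P B\<^esub>" "F a"] by simp
    have Fa: "F a \<in> carrier (\<Omega> B)" using a F(2)[of a] Fc lin_zero[OF Am Bm f] by simp
    have "z = h (?x \<zero>\<^bsub>\<Omega> C\<^esub> a) \<oplus>\<^bsub>S\<^esub> h (F a)"
      using zz m eq[OF a] w(2)[OF a] by (simp add: e_def)
    also have "\<dots> = h (?x \<zero>\<^bsub>\<Omega> C\<^esub> a \<oplus>\<^bsub>\<Omega> B\<^esub> F a)" using lin_add[OF h xc[OF m] Fa] by simp
    also have "\<dots> = \<zero>\<^bsub>S\<^esub>" unfolding x0 using lin_zero[OF OB.left_module_axioms S.left_module_axioms h] .
    finally show ?case .
  next
    case (6 f)
    show ?case by (rule 6(1)[OF 6(2,3)])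
  qed
  have "?thesis" if N: "N \<in> lin R (P B) (P A)"
    "\<And>x. x \<in> carrier (P B) \<Longrightarrow> f (p A (N x)) = p B x \<ominus>\<^bsub>B\<^esub> l (G x)" for N
  proof -
    note Nc = lin_closed[OF N(1)]
    define n where "n = (\<lambda>x \<in> carrier (P B). (\<lambda>x \<in> carrier (P B). x \<ominus>\<^bsub>P B\<^esub> L (G x)) x \<ominus>\<^bsub>P B\<^esub> F (N x))"
    have n: "n x = (x \<ominus>\<^bsub>P B\<^esub> L (G x)) \<ominus>\<^bsub>P B\<^esub> F (N x)" if "x \<in> carrier (P B)" for x
      using that by (simp add: n_def)
    have "(\<lambda>x \<in> carrier (P B). x \<ominus>\<^bsub>P B\<^esub> L (G x)) \<in> lin R (P B) (P B)"
      using lin_minus[OF pBm pBm lin_id[OF pBm] lin_comp_fun[OF P_Mods[OF BM] G(1) L(1)]]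
      by (simp cong: restrict_cong)
    from lin_minus[OF pBm pBm this lin_comp_fun[OF P_Mods[OF BM] N(1) F(1)]]
    have "n \<in> lin R (P B) (P B)" unfolding n_def by (simp cong: restrict_cong)
    moreover have "p B (n x) = \<zero>\<^bsub>B\<^esub>" if x: "x \<in> carrier (P B)" for x
    proof -
      have "p B (n x) = (p B x \<ominus>\<^bsub>B\<^esub> l (G x)) \<ominus>\<^bsub>B\<^esub> (p B x \<ominus>\<^bsub>B\<^esub> l (G x))"
        using x Lc Gc Fc Nc L(2) F(2) N(2) by (simp add: n lin_diff[OF pBm Bm pB])
      then show ?thesis
        using x Gc lin_closed[OF l(1)] p_closed[OF BM]
          B.diff_zero_iff[of "p B x \<ominus>\<^bsub>B\<^esub> l (G x)" "p B x \<ominus>\<^bsub>B\<^esub> l (G x)"] by simp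
    qed
    ultimately have nO: "n \<in> lin R (P B) (\<Omega> B)" by (rule lin_corestrict_Omega[OF BM P_Mods[OF BM]])
    have hn: "(\<lambda>x \<in> carrier (P B). h (n x)) \<in> lin R (P B) S" using lin_comp_fun[OF P_Mods[OF BM] nO h] .
    obtain y where y: "y \<in> lin R (P B) (P S)"
      "\<And>x. x \<in> carrier (P B) \<Longrightarrow> p S (y x) = (\<lambda>x \<in> carrier (P B). h (n x)) x"
      using lift_p[OF P_projective[OF BM] S hn] by metis
    let ?v = "\<lambda>x \<in> carrier (P B). y x \<oplus>\<^bsub>P S\<^esub> (\<lambda>x \<in> carrier (P B). w (N x)) x"
    have v: "?v \<in> lin R (P B) (P S)"
      using lin_plus[OF pBm PS.left_module_axioms y(1) lin_comp_fun[OF P_Mods[OF BM] N(1) w(1)]] .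
    have "h x = r (G x) \<oplus>\<^bsub>S\<^esub> p S (restrict ?v (carrier (\<Omega> B)) x)" if x: "x \<in> carrier (\<Omega> B)" for x
    proof -
      have xP: "x \<in> carrier (P B)" and px: "p B x = \<zero>\<^bsub>B\<^esub>" using x by auto
      note Nx = Nc[OF xP] and Gx = Gc[OF xP]
      have GO: "G x \<in> carrier (\<Omega> C)" using G(2)[OF xP] px Gx lin_zero[OF Bm Cm g] by simp
      \<comment> \<open>An admissible element of \<open>P A\<close> over \<open>d (G x)\<close>, as \<open>p\<close> vanishes at x.\<close>
      let ?a = "\<ominus>\<^bsub>P A\<^esub> N x"
      have "f (p A ?a) = \<ominus>\<^bsub>B\<^esub> (p B x \<ominus>\<^bsub>B\<^esub> l (G x))"
        using N(2)[OF xP] Nx p_closed[OF AM Nx]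
        by (simp add: lin_neg[OF PA.left_module_axioms Am pA] lin_neg[OF Am Bm f])
      also have "\<dots> = l (G x)" using px lin_closed[OF l(1) Gx] by (simp add: a_minus_def)
      finally have "f (p A ?a) = f (d (G x))" using d(2)[OF GO] by simp
      then have "p A ?a = d (G x)" using f_eqD p_closed[OF AM] Nx dc[OF GO] by simp
      then have ok: "?ok (G x) ?a" using GO Nx by simp
      have rG: "r (G x) = h (?x (G x) ?a) \<oplus>\<^bsub>S\<^esub> e ?a" using r(2) D[OF ok] by blast
      have ea: "e ?a \<oplus>\<^bsub>S\<^esub> e (N x) = \<zero>\<^bsub>S\<^esub>"
        using lin_add[OF e, of ?a "N x"] Nx lin_zero[OF PA.left_module_axioms S.left_module_axioms e]
        by (simp add: PA.l_neg)
      have nx: "n x \<in> carrier (\<Omega> B)" using lin_closed[OF nO xP] .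
      have FN: "F ?a = \<ominus>\<^bsub>P B\<^esub> F (N x)" using lin_neg[OF PA.left_module_axioms pBm F(1) Nx] .
      have "n x \<oplus>\<^bsub>\<Omega> B\<^esub> ?x (G x) ?a = ((x \<ominus>\<^bsub>P B\<^esub> L (G x)) \<ominus>\<^bsub>P B\<^esub> F (N x)) \<oplus>\<^bsub>P B\<^esub> (F (N x) \<oplus>\<^bsub>P B\<^esub> L (G x))"
        using Lc[OF Gx] Fc[OF Nx] by (simp add: n[OF xP] FN a_minus_def PB.a_comm)
      also have "\<dots> = x"
        using PB.diff_add_cancel[of "x \<ominus>\<^bsub>P B\<^esub> L (G x)" "F (N x)"] PB.diff_add_cancel[of x "L (G x)"]
          Lc[OF Gx] Fc[OF Nx] xP by (simp flip: PB.a_assoc)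
      finally have nx_eq: "n x \<oplus>\<^bsub>\<Omega> B\<^esub> ?x (G x) ?a = x" .
      have hx: "h x = h (n x) \<oplus>\<^bsub>S\<^esub> h (?x (G x) ?a)" using lin_add[OF h nx xc[OF ok]] nx_eq by simp
      have "p S (restrict ?v (carrier (\<Omega> B)) x) = h (n x) \<oplus>\<^bsub>S\<^esub> e (N x)"
        using x xP y(2)[OF xP] lin_closed[OF y(1) xP] lin_closed[OF w(1) Nx] Nx
        by (simp add: lin_add[OF p_lin[OF S]] e_def)
      then have "r (G x) \<oplus>\<^bsub>S\<^esub> p S (restrict ?v (carrier (\<Omega> B)) x) =
          (h (n x) \<oplus>\<^bsub>S\<^esub> h (?x (G x) ?a)) \<oplus>\<^bsub>S\<^esub> (e ?a \<oplus>\<^bsub>S\<^esub> e (N x))"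
        using rG hc[OF nx] hc[OF xc[OF ok]] ec Nx by (simp add: S.a_ac)
      then show ?thesis using hx ea hc[OF nx] hc[OF xc[OF ok]] by simp
    qed
    then show ?thesis using r(1) lin_from_Omega[OF BM v] by blast
  qed
  moreover have "\<exists>N \<in> lin R (P B) (P A). \<forall>x \<in> carrier (P B). f (p A (N x)) = p B x \<ominus>\<^bsub>B\<^esub> l (G x)"
  proof -
    note m = lin_minus[OF pBm Bm pB lin_comp_fun[OF P_Mods[OF BM] G(1) l(1)]]
    have "g ((\<lambda>x\<in>carrier (P B). p B x \<ominus>\<^bsub>B\<^esub> (\<lambda>x\<in>carrier (P B). l (G x)) x) x) = \<zero>\<^bsub>C\<^esub>"
      if x: "x \<in> carrier (P B)" for x
      using x Gc[OF x] G(2)[OF x] l(2) lin_closed[OF l(1)] p_closed[OF BM x] gc C.diff_zero_iff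
      by (simp add: lin_diff[OF Bm Cm g])
    from factor_kernel[OF pBm m this]
    obtain s where s: "s \<in> lin R (P B) A" "\<And>x. x \<in> carrier (P B) \<Longrightarrow>
        f (s x) = (\<lambda>x\<in>carrier (P B). p B x \<ominus>\<^bsub>B\<^esub> (\<lambda>x\<in>carrier (P B). l (G x)) x) x"
      by blast
    obtain N where "N \<in> lin R (P B) (P A)" "\<And>x. x \<in> carrier (P B) \<Longrightarrow> p A (N x) = s x"
      using lift_p[OF P_projective[OF BM] AM s(1)] by metis
    then show ?thesis using s(2) by (intro bexI[of _ N]) auto
  qed
  ultimately show ?thesis by blast
qed

end

lemma (in standard_triangle) exact:
  "exact_triangle T (arr (\<Omega> C) A d) (arr A B f) (arr B C g)"
proof -
  have D: "Dom T (arr X Y h) = X" "Cod T (arr X Y h) = Y" for X Y h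
    by (simp_all add: T_simps stable_arr_def)
  have hom: "arr (\<Omega> C) A d \<in> Homs T (\<Omega> C) A" "arr A B f \<in> Homs T A B" "arr B C g \<in> Homs T B C"
    using HomsI AM BM CM Omega_Mods d(1) f g by blast+
  obtain F where F: "F \<in> lin R (P A) (P B)" "\<And>x. x \<in> carrier (P A) \<Longrightarrow> p B (F x) = f (p A x)"
    using lift_exists[OF AM BM f] by metis
  obtain G where G: "G \<in> lin R (P B) (P C)" "\<And>x. x \<in> carrier (P B) \<Longrightarrow> p C (G x) = g (p B x)"
    using lift_exists[OF BM CM g] by metis
  note Ff = lift_Omega[OF AM BM f F] and Gg = lift_Omega[OF BM CM g G]
  note OF_f = Omega_arr_lift[OF AM BM f F] and OF_g = Omega_arr_lift[OF BM CM g G]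
  note OA = Omega_Mods[OF AM] and OB = Omega_Mods[OF BM] and OC = Omega_Mods[OF CM]
  have rF: "restrict F (carrier (\<Omega> A)) x = F x" if "x \<in> carrier (\<Omega> A)" for x
    using that by (simp del: Omega_simps)
  have rG: "restrict G (carrier (\<Omega> B)) x = G x" if "x \<in> carrier (\<Omega> B)" for x
    using that by (simp del: Omega_simps)
  show ?thesis unfolding exact_triangle_def D T_simps(6)
  proof (intro conjI allI impI)
    show "triangle_shape T (arr (\<Omega> C) A d, arr A B f, arr B C g)"
      using hom by (auto simp: triangle_shape_def D T_simps(6) T.Homs_Arr)
    show "arr B C g \<cdot>\<^bsub>T\<^esub> arr A B f = ZeroA T A C"
      unfolding Cmp_zero_iff[OF AM BM CM f g]
      using lin_const_zero[OF Am PC.left_module_axioms] gf p_zero[OF CM] by force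
    have "\<exists>w \<in> lin R (\<Omega> B) (P A). \<forall>x \<in> carrier (\<Omega> B). d (restrict G (carrier (\<Omega> B)) x) = p A (w x)"
      using module_connecting_zero[OF G] rG by (simp del: restrict_apply Omega_simps cong: ball_cong)
    then show "arr (\<Omega> C) A d \<cdot>\<^bsub>T\<^esub> DesuspA T (arr B C g) = ZeroA T (\<Omega> B) A"
      using Cmp_zero_iff[OF OB OC AM Gg d(1)] OF_g by (simp add: T_simps(7) del: Omega_simps restrict_apply)
  next
    fix S t assume t: "t \<in> Homs T S B \<and> arr B C g \<cdot>\<^bsub>T\<^esub> t = ZeroA T S C"
    then obtain t' where S: "S \<in> Mods R" and t': "t' \<in> lin R S B" "t = arr S B t'" by (blast elim: HomsE)
    obtain u where u: "u \<in> lin R S (P C)" "\<And>x. x \<in> carrier S \<Longrightarrow> g (t' x) = p C (u x)"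
      using t t' Cmp_zero_iff[OF S BM CM t'(1) g] by blast
    obtain r w where "r \<in> lin R S A" "w \<in> lin R S (P B)"
      "\<And>x. x \<in> carrier S \<Longrightarrow> t' x = f (r x) \<oplus>\<^bsub>B\<^esub> p B (w x)"
      using module_weak_kernel[OF S t'(1) u] by blast
    then show "\<exists>r\<in>Homs T S A. t = arr A B f \<cdot>\<^bsub>T\<^esub> r"
      using t'(2) arr_factorI[OF S AM BM _ f t'(1)] HomsI[OF S AM] by blast
  next
    fix S h assume h: "h \<in> Homs T A S \<and> h \<cdot>\<^bsub>T\<^esub> arr (\<Omega> C) A d = ZeroA T (\<Omega> C) S"
    then obtain h' where S: "S \<in> Mods R" and h': "h' \<in> lin R A S" "h = arr A S h'" by (blast elim: HomsE)
    interpret S: left_module R S using S by (rule Mods_left_module)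
    obtain u where u: "u \<in> lin R (\<Omega> C) (P S)" "\<And>x. x \<in> carrier (\<Omega> C) \<Longrightarrow> h' (d x) = p S (u x)"
      using h h' Cmp_zero_iff[OF OC AM S d(1) h'(1)] by blast
    obtain r where r: "r \<in> lin R B S" "\<And>a. a \<in> carrier A \<Longrightarrow> h' a = r (f a)"
      using module_connecting_weak_cokernel[OF S h'(1) u] by blast
    have "arr A S h' = arr B S r \<cdot>\<^bsub>T\<^esub> arr A B f"
      by (rule arr_factorI[OF AM BM S f r(1) h'(1)
            lin_const_zero[OF Am Mods_left_module[OF P_Mods[OF S]]]])
        (use r lin_closed[OF r(1)] fc p_zero[OF S] in simp)
    then show "\<exists>r\<in>Homs T B S. h = r \<cdot>\<^bsub>T\<^esub> arr A B f" using h'(2) HomsI[OF BM S r(1)] by blast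
  next
    fix S h assume h: "h \<in> Homs T B S \<and> h \<cdot>\<^bsub>T\<^esub> arr A B f = ZeroA T A S"
    then obtain h' where S: "S \<in> Mods R" and h': "h' \<in> lin R B S" "h = arr B S h'" by (blast elim: HomsE)
    obtain u where u: "u \<in> lin R A (P S)" "\<And>x. x \<in> carrier A \<Longrightarrow> h' (f x) = p S (u x)"
      using h h' Cmp_zero_iff[OF AM BM S f h'(1)] by blast
    obtain r w where r: "r \<in> lin R C S" "w \<in> lin R B (P S)"
      "\<And>b. b \<in> carrier B \<Longrightarrow> h' b = r (g b) \<oplus>\<^bsub>S\<^esub> p S (w b)"
      using module_weak_cokernel[OF S h'(1) u] by blast
    then show "\<exists>r\<in>Homs T C S. h = r \<cdot>\<^bsub>T\<^esub> arr B C g"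
      using h'(2) arr_factorI[OF BM CM S g _ h'(1)] HomsI[OF CM S] by blast
  next
    fix S h assume h: "h \<in> Homs T (\<Omega> B) S \<and> h \<cdot>\<^bsub>T\<^esub> DesuspA T (arr A B f) = ZeroA T (\<Omega> A) S"
    then obtain h' where S: "S \<in> Mods R" and h': "h' \<in> lin R (\<Omega> B) S" "h = arr (\<Omega> B) S h'"
      by (blast elim: HomsE)
    obtain u where u: "u \<in> lin R (\<Omega> A) (P S)"
      "\<And>x. x \<in> carrier (\<Omega> A) \<Longrightarrow> h' (restrict F (carrier (\<Omega> A)) x) = p S (u x)"
      using h h' Cmp_zero_iff[OF OA OB S Ff h'(1)] OF_f unfolding T_simps(7) by metis
    have "h' (F x) = p S (u x)" if "x \<in> carrier (\<Omega> A)" for x using u(2)[OF that] rF[OF that] by simp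
    then obtain r w where r: "r \<in> lin R (\<Omega> C) S" "w \<in> lin R (\<Omega> B) (P S)"
      "\<And>b. b \<in> carrier (\<Omega> B) \<Longrightarrow> h' b = r (G b) \<oplus>\<^bsub>S\<^esub> p S (w b)"
      using module_Omega_weak_cokernel[OF S h'(1) u(1) F G] by blast
    have hr: "h' x = r (restrict G (carrier (\<Omega> B)) x) \<oplus>\<^bsub>S\<^esub> p S (w x)" if "x \<in> carrier (\<Omega> B)" for x
      unfolding rG[OF that] by (rule r(3)[OF that])
    have "arr (\<Omega> B) S h' = arr (\<Omega> C) S r \<cdot>\<^bsub>T\<^esub> arr (\<Omega> B) (\<Omega> C) (restrict G (carrier (\<Omega> B)))"
      by (rule arr_factorI[OF OB OC S Gg r(1) h'(1) r(2)], assumption, rule hr)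
    then show "\<exists>r\<in>Homs T (\<Omega> C) S. h = r \<cdot>\<^bsub>T\<^esub> DesuspA T (arr B C g)"
      using h'(2) HomsI[OF OC S r(1)] OF_g unfolding T_simps(7) by metis
  qed
qed

lemma (in short_exact) standard_triangle_exists:
  "\<exists>w. (w, arr A B f, arr B C g) \<in> standard_triangles R \<pi>"
proof -
  obtain l where l: "l \<in> lin R (P C) B" "\<And>x. x \<in> carrier (P C) \<Longrightarrow> g (l x) = p C x"
    using lift_exists_C by metis
  obtain d where d: "d \<in> lin R (\<Omega> C) A" "\<And>x. x \<in> carrier (\<Omega> C) \<Longrightarrow> f (d x) = l x"
    using connecting_map[OF l] by metis
  have "(arr (\<Omega> C) A d, arr A B f, arr B C g) \<in> standard_triangles R \<pi>"
    unfolding standard_triangles_def lin_maps_eq_lin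
    using AM BM CM f g inj image surj d l by blast
  then show ?thesis by blast
qed

context short_exact
begin

text \<open>The pullback is a submodule of \<open>B \<times> W\<close>, and both are transported to the universe type together.
  The copy \<open>F\<close> of \<open>B \<times> W\<close> with its two inclusions is part of the statement because maps on \<open>E\<close> will be
  extended to it.\<close>

lemma pullback_exists:
  fixes W :: "('r, 'm) module"
  assumes W: "W \<in> Mods R" and s: "s \<in> lin R W C"
  obtains E F :: "('r, 'm) module" and q1 q2 m1 m2 where
    "E \<in> Mods R" "q1 \<in> lin R E B" "q2 \<in> lin R E W" "F \<in> Mods R" "m1 \<in> lin R B F" "m2 \<in> lin R W F"
    "\<And>x. x \<in> carrier E \<Longrightarrow> g (q1 x) = s (q2 x)"
    "\<And>b w. \<lbrakk>b \<in> carrier B; w \<in> carrier W; g b = s w\<rbrakk> \<Longrightarrow> \<exists>x \<in> carrier E. q1 x = b \<and> q2 x = w"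
    "\<And>x y. \<lbrakk>x \<in> carrier E; y \<in> carrier E; q1 x = q1 y; q2 x = q2 y\<rbrakk> \<Longrightarrow> x = y"
    "\<exists>i \<in> lin R E F. inj_on i (carrier E) \<and> (\<forall>x \<in> carrier E. i x = m1 (q1 x) \<oplus>\<^bsub>F\<^esub> m2 (q2 x))"
proof -
  interpret W: left_module R W using W by (rule Mods_left_module)
  have Wm: "left_module R W" ..
  let ?BW = "prod_module B W"
  interpret BW: left_module R ?BW using prod_left_module[OF Bm Wm] .
  have small: "|carrier ?BW| <o |UNIV :: 'm set|"
    using BM W card_of_Times_less[OF infinite_universe, of "carrier B" "carrier W"] by (simp add: Mods_def)
  obtain F :: "('r, 'm) module" and i j where F: "F \<in> Mods R" "i \<in> lin R F ?BW" "j \<in> lin R ?BW F"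
    "\<And>x. x \<in> carrier ?BW \<Longrightarrow> i (j x) = x" "\<And>y. y \<in> carrier F \<Longrightarrow> j (i y) = y"
    using transport_left_module[OF BW.left_module_axioms small] by metis
  interpret F: left_module R F using F(1) by (rule Mods_left_module)
  note ic = lin_closed[OF F(2)] and jc = lin_closed[OF F(3)]
  define S where "S = {y \<in> carrier F. g (fst (i y)) = s (snd (i y))}"
  have i1: "fst (i y) \<in> carrier B" "snd (i y) \<in> carrier W" if "y \<in> carrier F" for y
    using ic[OF that] by auto
  have iadd: "i (x \<oplus>\<^bsub>F\<^esub> y) = (fst (i x) \<oplus>\<^bsub>B\<^esub> fst (i y), snd (i x) \<oplus>\<^bsub>W\<^esub> snd (i y))"
    if "x \<in> carrier F" "y \<in> carrier F" for x y
    using lin_add[OF F(2) that] by (metis prod.collapse prod_module_simps(3))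
  have ismult: "i (a \<odot>\<^bsub>F\<^esub> x) = (a \<odot>\<^bsub>B\<^esub> fst (i x), a \<odot>\<^bsub>W\<^esub> snd (i x))"
    if "x \<in> carrier F" "a \<in> carrier R" for x a
    using lin_smult[OF F(2) that(2,1)] by (metis prod.collapse prod_module_simps(4))
  have i0: "i \<zero>\<^bsub>F\<^esub> = (\<zero>\<^bsub>B\<^esub>, \<zero>\<^bsub>W\<^esub>)"
    using lin_zero[OF F.left_module_axioms BW.left_module_axioms F(2)] by simp
  let ?E = "F\<lparr>carrier := S\<rparr>"
  have SF: "S \<subseteq> carrier F" unfolding S_def by blast
  have Em: "left_module R ?E"
  proof (rule F.submodule_left_module[OF SF])
    show "\<zero>\<^bsub>F\<^esub> \<in> S" using i0 lin_zero[OF Bm Cm g] lin_zero[OF Wm Cm s] by (simp add: S_def)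
    show "x \<oplus>\<^bsub>F\<^esub> y \<in> S" if "x \<in> S" "y \<in> S" for x y
      using that i1 by (simp add: S_def iadd lin_add[OF g] lin_add[OF s])
    show "a \<odot>\<^bsub>F\<^esub> x \<in> S" if "a \<in> carrier R" "x \<in> S" for a x
      using that i1 by (simp add: S_def ismult lin_smult[OF g] lin_smult[OF s] F.smult_closed)
  qed
  interpret E: left_module R ?E by (fact Em)
  have "|S| \<le>o |carrier F|" using SF by (rule card_of_mono1)
  then have E: "?E \<in> Mods R" using Em F(1) ordLeq_ordLess_trans unfolding Mods_def by auto
  let ?q1 = "\<lambda>x \<in> S. fst (i x)" and ?q2 = "\<lambda>x \<in> S. snd (i x)"
  let ?m1 = "\<lambda>b \<in> carrier B. j (b, \<zero>\<^bsub>W\<^esub>)" and ?m2 = "\<lambda>w \<in> carrier W. j (\<zero>\<^bsub>B\<^esub>, w)"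
  have q1: "?q1 \<in> lin R ?E B" and q2: "?q2 \<in> lin R ?E W"
    using SF E.a_closed E.smult_closed i1 by (intro linI; auto simp: iadd ismult subset_iff)+
  have m1: "?m1 \<in> lin R B F"
    using jc lin_add[OF F(3), of "(_, \<zero>\<^bsub>W\<^esub>)" "(_, \<zero>\<^bsub>W\<^esub>)"] lin_smult[OF F(3), of _ "(_, \<zero>\<^bsub>W\<^esub>)"]
    by (intro linI) (auto simp: W.smult_zero_right B.smult_closed)
  have m2: "?m2 \<in> lin R W F"
    using jc lin_add[OF F(3), of "(\<zero>\<^bsub>B\<^esub>, _)" "(\<zero>\<^bsub>B\<^esub>, _)"] lin_smult[OF F(3), of _ "(\<zero>\<^bsub>B\<^esub>, _)"]
    by (intro linI) (auto simp: B.smult_zero_right W.smult_closed)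
  show thesis
  proof (rule that[OF E q1 q2 F(1) m1 m2])
    show "g (?q1 x) = s (?q2 x)" if "x \<in> carrier ?E" for x using that by (simp add: S_def)
    show "\<exists>x \<in> carrier ?E. ?q1 x = b \<and> ?q2 x = w" if "b \<in> carrier B" "w \<in> carrier W" "g b = s w" for b w
    proof -
      have "i (j (b, w)) = (b, w)" "j (b, w) \<in> carrier F" using that F(4) jc by auto
      then show ?thesis using that(3) by (intro bexI[of _ "j (b, w)"]) (auto simp: S_def)
    qed
    show "x = y" if "x \<in> carrier ?E" "y \<in> carrier ?E" "?q1 x = ?q1 y" "?q2 x = ?q2 y" for x y
    proof -
      have "i x = i y" using that by (simp add: prod_eq_iff)
      then show ?thesis using F(5)[of x] F(5)[of y] that SF by auto
    qed
    show "\<exists>i \<in> lin R ?E F. inj_on i (carrier ?E) \<and>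
        (\<forall>x \<in> carrier ?E. i x = ?m1 (?q1 x) \<oplus>\<^bsub>F\<^esub> ?m2 (?q2 x))"
    proof (intro bexI[of _ "\<lambda>x \<in> S. x"] conjI ballI)
      show "(\<lambda>x \<in> S. x) \<in> lin R ?E F" using lin_inclusion[OF Em SF] .
      show "inj_on (\<lambda>x \<in> S. x) (carrier ?E)" by (auto simp: inj_on_def)
      fix x assume "x \<in> carrier ?E"
      then have x: "x \<in> S" "x \<in> carrier F" using SF by auto
      have "j (fst (i x), \<zero>\<^bsub>W\<^esub>) \<oplus>\<^bsub>F\<^esub> j (\<zero>\<^bsub>B\<^esub>, snd (i x)) = j (i x)"
        using lin_add[OF F(3), of "(fst (i x), \<zero>\<^bsub>W\<^esub>)" "(\<zero>\<^bsub>B\<^esub>, snd (i x))"] i1[OF x(2)] by simp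
      then show "(\<lambda>x \<in> S. x) x = ?m1 (?q1 x) \<oplus>\<^bsub>F\<^esub> ?m2 (?q2 x)"
        using x F(5)[OF x(2)] i1[OF x(2)] by simp
    qed
  qed
qed

text \<open>The pullback \<open>E\<close> of \<open>B \<rightarrow> C \<leftarrow> W\<close> is an extension of \<open>W\<close> by \<open>A\<close>. A stably commuting square over
  \<open>C\<close> becomes strictly commuting after changing one side by a map through \<open>P C\<close>. For the second
  property, a factorization through \<open>P S\<close> of \<open>h\<close> on \<open>E\<close> extends to \<open>B \<times> W\<close> as \<open>(b, w) \<mapsto> k\<^sub>1 b + k\<^sub>2 w\<close>. Then
  \<open>h - p k\<^sub>1\<close> agrees with \<open>p k\<^sub>2\<close> on \<open>E\<close>, so it kills \<open>A\<close>, descends to \<open>r\<close> on \<open>C\<close>, and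
  \<open>r s = p k\<^sub>2\<close> is stably zero.\<close>

lemma base_change_standard:
  assumes s: "s \<in> Homs T W C"
  shows "\<exists>u v e. (\<exists>w. (w, u, v) \<in> standard_triangles R \<pi>) \<and>
    weak_base_change T (arr A B f) (arr B C g) s u v e"
proof -
  obtain s' where W: "W \<in> Mods R" and s': "s' \<in> lin R W C" "s = arr W C s'" using s by (rule HomsE)
  interpret W: left_module R W using W by (rule Mods_left_module)
  have Wm: "left_module R W" ..
  obtain E F :: "('r, 'm) module" and q1 q2 m1 m2 where E: "E \<in> Mods R" and q1: "q1 \<in> lin R E B" and q2: "q2 \<in> lin R E W"
    and F: "F \<in> Mods R" and m1: "m1 \<in> lin R B F" and m2: "m2 \<in> lin R W F"
    and sq: "\<And>x. x \<in> carrier E \<Longrightarrow> g (q1 x) = s' (q2 x)"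
    and ex: "\<And>b w. \<lbrakk>b \<in> carrier B; w \<in> carrier W; g b = s' w\<rbrakk> \<Longrightarrow> \<exists>x \<in> carrier E. q1 x = b \<and> q2 x = w"
    and uniq: "\<And>x y. \<lbrakk>x \<in> carrier E; y \<in> carrier E; q1 x = q1 y; q2 x = q2 y\<rbrakk> \<Longrightarrow> x = y"
    and emb: "\<exists>i \<in> lin R E F. inj_on i (carrier E) \<and> (\<forall>x \<in> carrier E. i x = m1 (q1 x) \<oplus>\<^bsub>F\<^esub> m2 (q2 x))"
    by (rule pullback_exists[OF W s'(1)]) (rule that)
  interpret E: left_module R E using E by (rule Mods_left_module)
  note Em = E.left_module_axioms
  note q1c = lin_closed[OF q1] and q2c = lin_closed[OF q2] and sc = lin_closed[OF s'(1)]
  have pair: "\<exists>y \<in> lin R X E. \<forall>x \<in> carrier X. q1 (y x) = b x \<and> q2 (y x) = w x"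
    if X: "left_module R X" and b: "b \<in> lin R X B" and w: "w \<in> lin R X W"
      and bw: "\<And>x. x \<in> carrier X \<Longrightarrow> g (b x) = s' (w x)" for b w and X :: "('r, 'm) module"
  proof -
    interpret X: left_module R X by fact
    show ?thesis
    proof (rule lin_of_relation[OF X Em,
          where D = "\<lambda>x y. x \<in> carrier X \<and> y \<in> carrier E \<and> q1 y = b x \<and> q2 y = w x"], goal_cases)
      case (2 x)
      then show ?case using ex[of "b x" "w x"] bw lin_closed[OF b] lin_closed[OF w] by blast
    next
      case (5 y)
      then show ?case
        using lin_zero[OF X Bm b] lin_zero[OF X Wm w] lin_zero[OF Em Bm q1] lin_zero[OF Em Wm q2]
        by (simp add: uniq)
    next
      case (6 y)
      then show ?case by (intro bexI[of _ y]) auto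
    qed (auto simp: lin_add[OF q1] lin_add[OF q2] lin_add[OF b] lin_add[OF w] lin_smult[OF q1]
        lin_smult[OF q2] lin_smult[OF b] lin_smult[OF w] X.smult_closed E.smult_closed)
  qed
  have "g (f a) = s' ((\<lambda>x \<in> carrier A. \<zero>\<^bsub>W\<^esub>) a)" if "a \<in> carrier A" for a
    using that gf lin_zero[OF Wm Cm s'(1)] by simp
  from pair[OF Am f lin_const_zero[OF Am Wm] this]
  obtain f' where f'0: "f' \<in> lin R A E"
    "\<forall>a \<in> carrier A. q1 (f' a) = f a \<and> q2 (f' a) = (\<lambda>x \<in> carrier A. \<zero>\<^bsub>W\<^esub>) a" by blast
  then have f': "f' \<in> lin R A E" "\<And>a. a \<in> carrier A \<Longrightarrow> q1 (f' a) = f a"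
    "\<And>a. a \<in> carrier A \<Longrightarrow> q2 (f' a) = \<zero>\<^bsub>W\<^esub>" by simp_all
  have surj': "q2 ` carrier E = carrier W"
  proof (intro equalityI subsetI)
    fix w assume w: "w \<in> carrier W"
    then obtain b where "b \<in> carrier B" "g b = s' w" using surj sc by (metis imageE)
    then show "w \<in> q2 ` carrier E" using ex[of b w] w by blast
  qed (use q2c in blast)
  have inj': "inj_on f' (carrier A)" using f'(2) f_eqD by (metis inj_onI)
  have im': "f' ` carrier A = a_kernel E W q2"
  proof (intro equalityI subsetI)
    fix x assume "x \<in> f' ` carrier A"
    then show "x \<in> a_kernel E W q2" using f' lin_closed[OF f'(1)] by (auto simp: a_kernel_def')
  next
    fix x assume "x \<in> a_kernel E W q2"
    then have x: "x \<in> carrier E" "q2 x = \<zero>\<^bsub>W\<^esub>" by (auto simp: a_kernel_def')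
    then have "g (q1 x) = \<zero>\<^bsub>C\<^esub>" using sq lin_zero[OF Wm Cm s'(1)] by simp
    then obtain a where a: "a \<in> carrier A" "q1 x = f a" using kernel_image q1c x by blast
    then have "x = f' a" using x f'(2,3) lin_closed[OF f'(1)] by (simp add: uniq)
    then show "x \<in> f' ` carrier A" using a by blast
  qed
  interpret pb: short_exact R \<pi> A E W f' q2
    by unfold_locales (fact AM E W f'(1) q2 inj' im' surj')+
  have D: "Dom T (arr X Y h) = X" "Cod T (arr X Y h) = Y" for X Y h
    by (simp_all add: T_simps stable_arr_def)
  have "isomorphic_in T A A"
    unfolding isomorphic_in_def iso_arr_def
    using T.Ide_in[of A] T.Ide_left[OF T.Ide_in[of A]] AM T.Homs_Dom[OF T.Ide_in[of A]]
      T.Homs_Cod[OF T.Ide_in[of A]] T.Homs_Arr[OF T.Ide_in[of A]] by (auto simp: T_simps(1))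
  moreover have "\<exists>y \<in> Homs T S E. t = arr E B q1 \<cdot>\<^bsub>T\<^esub> y"
    if t: "t \<in> Homs T S B" "r \<in> Homs T S W" "arr B C g \<cdot>\<^bsub>T\<^esub> t = s \<cdot>\<^bsub>T\<^esub> r" for S t r
  proof -
    obtain t' where S: "S \<in> Mods R" and t': "t' \<in> lin R S B" "t = arr S B t'" using t(1) by (rule HomsE)
    obtain r' where r': "r' \<in> lin R S W" "r = arr S W r'" using t(2) by (rule HomsE)
    interpret S: left_module R S using S by (rule Mods_left_module)
    have Sm: "left_module R S" ..
    have "steq S C (\<lambda>x \<in> carrier S. g (t' x)) (\<lambda>x \<in> carrier S. s' (r' x))"
      using t(3) Cmp_arr[OF S BM CM t'(1) g] Cmp_arr[OF S W CM r'(1) s'(1)] t' r' s'(2)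
        stable_arr_eq_iff[OF S CM lin_comp_fun[OF S t'(1) g] lin_comp_fun[OF S r'(1) s'(1)]] by simp
    then obtain u where u: "u \<in> lin R S (P C)"
      "\<And>x. x \<in> carrier S \<Longrightarrow> g (t' x) = s' (r' x) \<oplus>\<^bsub>C\<^esub> p C (u x)" unfolding steq_def by auto
    obtain l where l: "l \<in> lin R (P C) B" "\<And>x. x \<in> carrier (P C) \<Longrightarrow> g (l x) = p C x"
      using lift_exists_C by metis
    obtain L where L: "L \<in> lin R (P C) (P B)" "\<And>x. x \<in> carrier (P C) \<Longrightarrow> p B (L x) = l x"
      using lift_p[OF P_projective[OF CM] BM l(1)] by metis
    have c: "t' x \<in> carrier B" "l (u x) \<in> carrier B" "u x \<in> carrier (P C)" "s' (r' x) \<in> carrier C"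
      "p C (u x) \<in> carrier C" if "x \<in> carrier S" for x
      using that lin_closed[OF t'(1)] lin_closed[OF l(1)] lin_closed[OF u(1)] sc lin_closed[OF r'(1)]
        p_closed[OF CM] by auto
    let ?t = "\<lambda>x \<in> carrier S. t' x \<ominus>\<^bsub>B\<^esub> (\<lambda>x \<in> carrier S. l (u x)) x"
    have "g (?t x) = s' (r' x)" if x: "x \<in> carrier S" for x
      using x c[OF x] u(2)[OF x] l(2) C.add_diff_cancel by (simp add: lin_diff[OF Bm Cm g])
    from pair[OF Sm lin_minus[OF Sm Bm t'(1) lin_comp_fun[OF S u(1) l(1)]] r'(1) this]
    obtain y where y: "y \<in> lin R S E" "\<And>x. x \<in> carrier S \<Longrightarrow> q1 (y x) = ?t x" by blast
    have "t = arr E B q1 \<cdot>\<^bsub>T\<^esub> arr S E y" unfolding t'(2)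
      by (rule arr_factorI[OF S E BM y(1) q1 t'(1) lin_comp_fun[OF S u(1) L(1)]])
        (use y(2) c L(2) B.diff_add_cancel in simp)
    then show ?thesis using HomsI[OF S E y(1)] by blast
  qed
  moreover have "\<exists>r \<in> Homs T C S. h = r \<cdot>\<^bsub>T\<^esub> arr B C g \<and> r \<cdot>\<^bsub>T\<^esub> s = ZeroA T W S"
    if h: "h \<in> Homs T B S" "h \<cdot>\<^bsub>T\<^esub> arr E B q1 = ZeroA T E S" for S h
  proof -
    obtain h' where S: "S \<in> Mods R" and h': "h' \<in> lin R B S" "h = arr B S h'" using h(1) by (rule HomsE)
    interpret S: left_module R S using S by (rule Mods_left_module)
    have Sm: "left_module R S" ..
    obtain u where u: "u \<in> lin R E (P S)" "\<And>x. x \<in> carrier E \<Longrightarrow> h' (q1 x) = p S (u x)"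
      using h(2) h'(2) Cmp_zero_iff[OF E BM S q1 h'(1)] by blast
    obtain i where i: "i \<in> lin R E F" "inj_on i (carrier E)"
      "\<And>x. x \<in> carrier E \<Longrightarrow> i x = m1 (q1 x) \<oplus>\<^bsub>F\<^esub> m2 (q2 x)" using emb by blast
    obtain k where k: "k \<in> lin R F (P S)" "\<And>x. x \<in> carrier E \<Longrightarrow> k (i x) = u x"
      using extend[OF P_projective[OF S] E F i(1,2) u(1)] by metis
    let ?k1 = "\<lambda>b \<in> carrier B. k (m1 b)" and ?k2 = "\<lambda>w \<in> carrier W. k (m2 w)"
    have k1: "?k1 \<in> lin R B (P S)" and k2: "?k2 \<in> lin R W (P S)"
      using lin_comp_fun[OF BM m1 k(1)] lin_comp_fun[OF W m2 k(1)] by auto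
    note k1c = lin_closed[OF k1] and k2c = lin_closed[OF k2]
    have hk: "h' (q1 x) = p S (?k1 (q1 x)) \<oplus>\<^bsub>S\<^esub> p S (?k2 (q2 x))" if x: "x \<in> carrier E" for x
      using u(2)[OF x] k(2)[OF x] i(3)[OF x] lin_closed[OF m1 q1c[OF x]] lin_closed[OF m2 q2c[OF x]]
        q1c[OF x] q2c[OF x] k1c[OF q1c[OF x]] k2c[OF q2c[OF x]]
        lin_add[OF p_lin[OF S] k1c[OF q1c[OF x]] k2c[OF q2c[OF x]]]
      by (simp add: lin_add[OF k(1)])
    let ?h = "\<lambda>b \<in> carrier B. h' b \<ominus>\<^bsub>S\<^esub> (\<lambda>b \<in> carrier B. p S (?k1 b)) b"
    have hl: "?h \<in> lin R B S"
      using lin_minus[OF Bm Sm h'(1) lin_comp_fun[OF BM k1 p_lin[OF S]]] .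
    have hb: "?h b = p S (?k2 w)" if bw: "b \<in> carrier B" "w \<in> carrier W" "g b = s' w" for b w
    proof -
      obtain x where "x \<in> carrier E" "q1 x = b" "q2 x = w" using ex[OF bw] by blast
      then have "h' b = p S (?k1 b) \<oplus>\<^bsub>S\<^esub> p S (?k2 w)" using hk by blast
      then show ?thesis
        using bw p_closed[OF S k1c[OF bw(1)]] p_closed[OF S k2c[OF bw(2)]]
          S.add_diff_cancel[of "p S (?k2 w)" "p S (?k1 b)"] S.a_comm[of "p S (?k1 b)" "p S (?k2 w)"] by simp
    qed
    have "\<exists>r \<in> lin R C S. \<forall>b \<in> carrier B. r (g b) = ?h b"
    proof (rule lin_descend[OF Bm Cm Sm g surj hl])
      fix b assume b: "b \<in> carrier B" "g b = \<zero>\<^bsub>C\<^esub>"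
      then have "?h b = p S (?k2 \<zero>\<^bsub>W\<^esub>)" using lin_zero[OF Wm Cm s'(1)] by (intro hb) auto
      also have "?k2 \<zero>\<^bsub>W\<^esub> = \<zero>\<^bsub>P S\<^esub>" using lin_zero[OF Wm Mods_left_module[OF P_Mods[OF S]] k2] .
      finally show "?h b = \<zero>\<^bsub>S\<^esub>" using p_zero[OF S] by simp
    qed
    then obtain r where r: "r \<in> lin R C S" "\<And>b. b \<in> carrier B \<Longrightarrow> r (g b) = ?h b" by blast
    have "h = arr C S r \<cdot>\<^bsub>T\<^esub> arr B C g" unfolding h'(2)
      by (rule arr_factorI[OF BM CM S g r(1) h'(1) k1])
        (use r(2) lin_closed[OF h'(1)] p_closed[OF S k1c] S.diff_add_cancel in simp)
    moreover have "arr C S r \<cdot>\<^bsub>T\<^esub> s = ZeroA T W S"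
      unfolding s'(2) Cmp_zero_iff[OF W CM S s'(1) r(1)]
    proof (intro bexI[OF _ k2] ballI)
      fix w assume w: "w \<in> carrier W"
      then obtain b where b: "b \<in> carrier B" "g b = s' w" using surj sc by (metis imageE)
      then show "r (s' w) = p S (?k2 w)" using r(2)[OF b(1)] hb[OF b(1) w b(2)] by simp
    qed
    ultimately show ?thesis using HomsI[OF CM S r(1)] by blast
  qed
  ultimately have "weak_base_change T (arr A B f) (arr B C g) s (arr A E f') (arr E W q2) (arr E B q1)"
    unfolding weak_base_change_def D T.Homs_Dom[OF s] using HomsI[OF E BM q1] by blast
  then show ?thesis using pb.standard_triangle_exists by blast
qed

end

context frobenius_modules
begin

lemma standard_triangleE:
  assumes "(w, u, v) \<in> standard_triangles R \<pi>"
  obtains A B C d f g l where "standard_triangle R \<pi> A B C f g l d"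
    "w = arr (\<Omega> C) A d" "u = arr A B f" "v = arr B C g"
proof -
  obtain A B C d f g l where eq: "w = arr (\<Omega> C) A d" "u = arr A B f" "v = arr B C g"
    and h: "A \<in> Mods R" "B \<in> Mods R" "C \<in> Mods R" "f \<in> lin R A B" "g \<in> lin R B C"
      "inj_on f (carrier A)" "f ` carrier A = a_kernel B C g" "g ` carrier B = carrier C"
      "d \<in> lin R (\<Omega> C) A" "l \<in> lin R (P C) B" "\<forall>x \<in> carrier (P C). g (l x) = p C x"
      "\<forall>x \<in> carrier (\<Omega> C). f (d x) = l x"
    using assms unfolding standard_triangles_def lin_maps_eq_lin mem_Collect_eq prod.inject
    by (elim exE conjE bexE) (rule that; assumption)
  have "standard_triangle R \<pi> A B C f g l d"
    using h by (intro standard_triangle.intro short_exact.intro short_exact_axioms.intro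
        standard_triangle_axioms.intro frobenius_modules_axioms) simp_all
  then show thesis using that eq by blast
qed

lemma standard_exact:
  assumes "(w, u, v) \<in> standard_triangles R \<pi>"
  shows "exact_triangle T w u v"
proof -
  obtain A B C d f g l where "standard_triangle R \<pi> A B C f g l d"
    "w = arr (\<Omega> C) A d" "u = arr A B f" "v = arr B C g"
    using standard_triangleE[OF assms] .
  then show ?thesis using standard_triangle.exact by blast
qed

lemma standard_distinguished:
  assumes "t \<in> standard_triangles R \<pi>"
  shows "t \<in> distinguished_triangles R \<pi>"
proof -
  obtain w u v where t: "t = (w, u, v)" by (cases t)
  have "exact_triangle T w u v" using standard_exact assms t by blast
  then have sh: "triangle_shape T (w, u, v)" unfolding exact_triangle_def by blast
  then have h: "w \<in> Homs T (Desusp T (Cod T v)) (Dom T u)" "u \<in> Homs T (Dom T u) (Dom T v)"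
    "v \<in> Homs T (Dom T v) (Cod T v)" by (auto simp: triangle_shape_def Homs_def)
  have iso: "iso_arr T (Ide T X)" if "X \<in> Obj T" for X
    unfolding iso_arr_def
    using T.Ide_in[OF that] T.Ide_left[OF T.Ide_in[OF that]] T.Homs_Dom[OF T.Ide_in[OF that]]
      T.Homs_Cod[OF T.Ide_in[OF that]] T.Homs_Arr[OF T.Ide_in[OF that]] by auto
  have O: "Dom T u \<in> Obj T" "Dom T v \<in> Obj T" "Cod T v \<in> Obj T"
    using T.Homs_Obj[OF h(2)] T.Homs_Obj[OF h(3)] by auto
  have "triangle_iso T (w, u, v) (w, u, v)"
    unfolding triangle_iso_def prod.case
    by (rule bexI[of _ "Ide T (Dom T u)"], rule bexI[of _ "Ide T (Dom T v)"],
        rule bexI[of _ "Ide T (Cod T v)"])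
      (use h O iso T.Ide_left T.Ide_right T.DesuspA_Ide T.Ide_in in \<open>simp_all\<close>)
  then show ?thesis unfolding distinguished_triangles_def t using assms t sh by blast
qed

lemma distinguishedE:
  assumes "(w, u, v) \<in> distinguished_triangles R \<pi>"
  obtains w0 u0 v0 where "(w0, u0, v0) \<in> standard_triangles R \<pi>"
    "triangle_iso T (w0, u0, v0) (w, u, v)" "triangle_shape T (w0, u0, v0)" "triangle_shape T (w, u, v)"
proof -
  obtain t where "t \<in> standard_triangles R \<pi>" "triangle_iso T t (w, u, v)" "triangle_shape T (w, u, v)"
    using assms unfolding distinguished_triangles_def by blast
  moreover obtain w0 u0 v0 where "t = (w0, u0, v0)" by (cases t)
  ultimately show thesis using that standard_exact unfolding exact_triangle_def by metis
qed

lemma distinguished_exact: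
  assumes "(w, u, v) \<in> distinguished_triangles R \<pi>"
  shows "exact_triangle T w u v"
proof -
  obtain w0 u0 v0 where "(w0, u0, v0) \<in> standard_triangles R \<pi>"
    "triangle_iso T (w0, u0, v0) (w, u, v)" "triangle_shape T (w, u, v)"
    using distinguishedE[OF assms] by metis
  then show ?thesis using T.exact_triangle_iso standard_exact by blast
qed

lemma distinguished_base_change:
  assumes t: "(w, u, v) \<in> distinguished_triangles R \<pi>" and s: "s \<in> Arr T" "Cod T s = Cod T v"
  shows "\<exists>u' v' e. (\<exists>w'. (w', u', v') \<in> distinguished_triangles R \<pi>) \<and>
    weak_base_change T u v s u' v' e"
proof -
  obtain w0 u0 v0 where std: "(w0, u0, v0) \<in> standard_triangles R \<pi>" and
    iso: "triangle_iso T (w0, u0, v0) (w, u, v)" "triangle_shape T (w0, u0, v0)" "triangle_shape T (w, u, v)"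
    using distinguishedE[OF t] by metis
  obtain A B C d f g l where st: "standard_triangle R \<pi> A B C f g l d"
    and e: "u0 = arr A B f" "v0 = arr B C g"
    using standard_triangleE[OF std] by metis
  interpret standard_triangle R \<pi> A B C f g l d by (fact st)
  have s': "s \<in> Homs T (Dom T s) (Cod T v)" using s by (simp add: Homs_def)
  show ?thesis
  proof (rule T.weak_base_change_iso[OF iso s'])
    fix s1 assume "s1 \<in> Homs T (Dom T s) (Cod T v0)"
    moreover have "Cod T v0 = C" by (simp add: e T_simps stable_arr_def)
    ultimately have "\<exists>u v e. (\<exists>w. (w, u, v) \<in> standard_triangles R \<pi>) \<and> weak_base_change T u0 v0 s1 u v e"
      using base_change_standard[of s1 "Dom T s"] unfolding e by simp
    then show "\<exists>u1 v1 e. (\<exists>w'. (w', u1, v1) \<in> distinguished_triangles R \<pi>) \<and> weak_base_change T u0 v0 s1 u1 v1 e"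
      using standard_distinguished by blast
  qed
qed

end

section \<open>The stable module category of a group algebra\<close>

lemma StMod_simps:
  "Obj (StMod k G \<pi>) = Obj (stable_cat (group_algebra k G) \<pi>)"
  "Arr (StMod k G \<pi>) = Arr (stable_cat (group_algebra k G) \<pi>)"
  "Dom (StMod k G \<pi>) = Dom (stable_cat (group_algebra k G) \<pi>)"
  "Cod (StMod k G \<pi>) = Cod (stable_cat (group_algebra k G) \<pi>)"
  "Ide (StMod k G \<pi>) = Ide (stable_cat (group_algebra k G) \<pi>)"
  "Cmp (StMod k G \<pi>) = Cmp (stable_cat (group_algebra k G) \<pi>)"
  "ZeroA (StMod k G \<pi>) = ZeroA (stable_cat (group_algebra k G) \<pi>)"
  "Desusp (StMod k G \<pi>) = Desusp (stable_cat (group_algebra k G) \<pi>)"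
  "DesuspA (StMod k G \<pi>) = DesuspA (stable_cat (group_algebra k G) \<pi>)"
  "Tri (StMod k G \<pi>) = distinguished_triangles (group_algebra k G) \<pi>"
  by (simp_all add: StMod_def desusp_cat.defs triang_cat.defs)

lemma StMod_Homs: "Homs (StMod k G \<pi>) = Homs (stable_cat (group_algebra k G) \<pi>)"
  by (intro ext) (simp add: Homs_def StMod_simps)

lemma StMod_exact_triangle:
  "exact_triangle (StMod k G \<pi>) = exact_triangle (stable_cat (group_algebra k G) \<pi>)"
  by (intro ext) (simp add: exact_triangle_def triangle_shape_def StMod_Homs StMod_simps)

lemma StMod_weak_base_change:
  "weak_base_change (StMod k G \<pi>) = weak_base_change (stable_cat (group_algebra k G) \<pi>)"
  by (intro ext)
    (simp add: weak_base_change_def isomorphic_in_def iso_arr_def StMod_Homs StMod_simps)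

lemma (in finite_group_algebra) frobenius:
  fixes \<pi> :: "('g \<Rightarrow> 'k, 'm) presentation"
  assumes "infinite (UNIV :: 'm set)" and "projective_presentation kG \<pi>"
  shows "frobenius_modules kG \<pi>"
proof
  fix Q A B :: "('g \<Rightarrow> 'k, 'm) module" and i f
  assume h: "projective_module kG Q" "A \<in> Mods kG" "B \<in> Mods kG" "i \<in> lin kG A B"
    "inj_on i (carrier A)" "f \<in> lin kG A Q"
  show "\<exists>h \<in> lin kG B Q. \<forall>a \<in> carrier A. h (i a) = f a"
    using projective_injective[OF assms(1) h(1) Mods_left_module[OF h(2)] Mods_left_module[OF h(3)] h(4-6)]
    by metis
qed (fact assms)+

lemma exact_triangles_StMod:
  assumes "frobenius_modules (group_algebra k G) \<pi>"
  shows "exact_triangles (StMod k G \<pi>)"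
proof -
  interpret frobenius_modules "group_algebra k G" \<pi> by fact
  show ?thesis
  proof (intro exact_triangles.intro exact_triangles_axioms.intro)
    show "desusp_category (StMod k G \<pi>)"
      using T.desusp_category_axioms
      unfolding desusp_category_def StMod_Homs StMod_simps zero_objs_def .
  next
    fix w u v assume "(w, u, v) \<in> Tri (StMod k G \<pi>)"
    then show "exact_triangle (StMod k G \<pi>) w u v"
      using distinguished_exact unfolding StMod_simps StMod_exact_triangle by blast
  next
    fix w u v s assume "(w, u, v) \<in> Tri (StMod k G \<pi>)" "s \<in> Arr (StMod k G \<pi>)"
      "Cod (StMod k G \<pi>) s = Cod (StMod k G \<pi>) v"
    then show "\<exists>u' v' e. cofibre_seq (StMod k G \<pi>) u' v' \<and> weak_base_change (StMod k G \<pi>) u v s u' v' e"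
      using distinguished_base_change unfolding StMod_simps StMod_weak_base_change cofibre_seq_def
      by blast
  qed
qed

theorem corollary3p7:
  fixes G :: "('g, 'y) monoid_scheme"
    and k :: "('k, 'x) ring_scheme"
    and \<pi> :: "('g \<Rightarrow> 'k, 'm) presentation"
    and \<P> :: "('g \<Rightarrow> 'k, 'm) module set"
    and \<I> :: "('g \<Rightarrow> 'k, 'm) stable_arrow set"
    and M H :: "('g \<Rightarrow> 'k, 'm) module"
    and \<alpha> \<beta> \<gamma> :: "('g \<Rightarrow> 'k, 'm) stable_arrow"
    and l :: nat
  assumes "group G" and "finite (carrier G)"
    and "field k" and "characteristic k dvd order G"
    and "infinite (UNIV :: 'm set)" and "|carrier k| <o |UNIV :: 'm set|"
    and "projective_presentation (group_algebra k G) \<pi>"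
    and "projective_class (StMod k G \<pi>) \<P> \<I>"
    and "M \<in> stmod_objs k G \<pi>"
    and "indecomposable_module (group_algebra k G) M"
    and "\<not> projective_module (group_algebra k G) M"
    and "\<alpha> \<in> Homs (StMod k G \<pi>) (Omega \<pi> (Omega \<pi> M)) H"
    and "\<beta> \<in> Homs (StMod k G \<pi>) H M"
    and "\<gamma> \<in> Homs (StMod k G \<pi>) M (Omega \<pi> M)"
    and "AR_triangle (StMod k G \<pi>) \<alpha> \<beta> \<gamma>"
    and "len (StMod k G \<pi>) \<P> M = enat l"
  shows "len (StMod k G \<pi>) \<P> M - 1 \<le> len (StMod k G \<pi>) \<P> H \<and>
    len (StMod k G \<pi>) \<P> H \<le> len (StMod k G \<pi>) \<P> M + 1 \<and>
    \<gamma> \<in> ideal_power (StMod k G \<pi>) \<I> (l - 1) \<and>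
    \<gamma> \<noteq> ZeroA (StMod k G \<pi>) M (Omega \<pi> M)"
proof -
  interpret finite_group_algebra G k
    using assms(1-3) by (simp add: finite_group_algebra_def finite_group_algebra_axioms_def)
  interpret frobenius_modules kG \<pi>
    using assms(5,7) by (rule frobenius)
  interpret exact_triangles "StMod k G \<pi>"
    by (rule exact_triangles_StMod) unfold_locales
  interpret length_theory "StMod k G \<pi>" \<P> \<I>
    using assms(8) by unfold_locales
  have "Desusp (StMod k G \<pi>) X = Omega \<pi> X" for X
    by (simp add: StMod_simps T_simps)
  then show ?thesis
    using AR_length[of \<alpha> \<beta> \<gamma> M H l] assms(12-16) by simp
qed

end
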